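(* Let $A$ be the generator of a $C_0$-semigroup $(T(t))_{t\ge0}$ on a Banach space $X$ and let $K:[0,\infty)\to B(X)$ be a strongly continuous function such that $K(t)$ is a compact (linear) operator for each $t\ge0$. Let $(U(t,\tau))_{t\ge\tau\ge0}\subset B(X)$ be the unique evolution family satisfying $$U(t,\tau)x=T(t-\tau)x+\int_\tau^tT(t-s)K(s)U(s,\tau)x\,ds,\qquad t\ge\tau\ge 0,\ x\in X.$$ Assume that $a:[0,\infty)\to[0,\infty)$ is a decreasing function satisfying $\lim_{t\to\infty}a(t)=0$. Then there exists a dense set of vectors $x\in X$ such that $$\|U(t,0)x\|\ge a(t)e^{s_R(A)t},\qquad t\ge t_0=t_0(x),$$ for some $t_0(x)\ge0$.
   Context: All Banach spaces are complex and infinite-dimensional. An evolution family is a strongly continuous family $(U(t,\tau))_{t\ge\tau\ge0}$ in $B(X)$ with $U(t,t)=I$ and $U(t,s)U(s,\tau)=U(t,\tau)$ for $t\ge s\ge\tau\ge0$; existence and uniqueness of the evolution family in the claim is a known result. $\sigma_e(A)=\{\lambda\in\mathbb C:\lambda-A\text{ is not Fredholm}\}$, $s_e(A)=\sup\{\operatorname{Re}\lambda:\lambda\in\sigma_e(A)\}$, $\sigma_p(A)$ is the point spectrum, $R(\lambda,A)=(\lambda-A)^{-1}$. The resolvent bound $s_R(A)$ is the infimum of the set of all real $a>s_e(A)$ satisfying $\operatorname{card}(\sigma_p(A)\cap(a+i\mathbb R))<\infty$ and $\limsup_{|b|\to\infty}\|R(a+ib,A)\|<\infty$. If $s_R(A)=-\infty$,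 then $e^{s_R(A)t}$ is read as $0$ for all $t\ge0$. *)

theory Defs
  imports "HOL-Analysis.Analysis"
begin

section \<open>Complex Banach spaces\<close>

text \<open>The distribution only provides real normed spaces. The complex scalar multiplication
  extends the real one, so all topological notions are those of the underlying real space.\<close>

class complex_normed_vector = real_normed_vector +
  fixes scaleC :: "complex \<Rightarrow> 'a \<Rightarrow> 'a" (infixr "*\<^sub>C" 75)
  assumes scaleC_add_right: "c *\<^sub>C (x + y) = c *\<^sub>C x + c *\<^sub>C y"
    and scaleC_add_left: "(c + d) *\<^sub>C x = c *\<^sub>C x + d *\<^sub>C x"
    and scaleC_scaleC: "c *\<^sub>C (d *\<^sub>C x) = (c * d) *\<^sub>C x"
    and scaleC_of_real: "complex_of_real r *\<^sub>C x = r *\<^sub>R x"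
    and norm_scaleC: "norm (c *\<^sub>C x) = cmod c * norm x"

class complex_banach = complex_normed_vector + banach

global_interpretation complex_vector:
  vector_space "scaleC :: complex \<Rightarrow> 'a \<Rightarrow> 'a::complex_normed_vector"
  defines cspan = complex_vector.span
proof
  show "1 *\<^sub>C x = x" for x :: 'a
    using scaleC_of_real[of 1 x] by simp
qed (simp_all add: scaleC_add_right scaleC_add_left scaleC_scaleC)

definition finite_cdim :: "'a::complex_normed_vector set \<Rightarrow> bool" where
  "finite_cdim V \<longleftrightarrow> (\<exists>B. finite B \<and> V \<subseteq> cspan B)"

definition finite_ccodim :: "'a::complex_normed_vector set \<Rightarrow> bool" where
  "finite_ccodim V \<longleftrightarrow> (\<exists>B. finite B \<and> cspan (V \<union> B) = UNIV)"

definition bounded_clinear ::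
    "('a::complex_normed_vector \<Rightarrow> 'b::complex_normed_vector) \<Rightarrow> bool" where
  "bounded_clinear f \<longleftrightarrow> bounded_linear f \<and> (\<forall>c x. f (c *\<^sub>C x) = c *\<^sub>C f x)"

definition compact_operator ::
    "('a::complex_normed_vector \<Rightarrow> 'b::complex_normed_vector) \<Rightarrow> bool" where
  "compact_operator f \<longleftrightarrow> bounded_clinear f \<and> compact (closure (f ` cball 0 1))"

section \<open>Unbounded operators and their spectra\<close>

text \<open>An operator is given by its domain \<open>D\<close> and a function \<open>A\<close> whose values outside
  \<open>D\<close> are irrelevant.\<close>

definition fredholm_on :: "'a::complex_normed_vector set \<Rightarrow> ('a \<Rightarrow> 'a) \<Rightarrow> bool" where
  "fredholm_on D B \<longleftrightarrow>
     finite_cdim {x \<in> D. B x = 0} \<and> closed (B ` D) \<and> finite_ccodim (B ` D)"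

definition essential_spectrum :: "'a::complex_normed_vector set \<Rightarrow> ('a \<Rightarrow> 'a) \<Rightarrow> complex set" where
  "essential_spectrum D A = {\<mu>. \<not> fredholm_on D (\<lambda>x. \<mu> *\<^sub>C x - A x)}"

definition point_spectrum :: "'a::complex_normed_vector set \<Rightarrow> ('a \<Rightarrow> 'a) \<Rightarrow> complex set" where
  "point_spectrum D A = {\<mu>. \<exists>x\<in>D. x \<noteq> 0 \<and> A x = \<mu> *\<^sub>C x}"

definition resolvent ::
    "'a::complex_normed_vector set \<Rightarrow> ('a \<Rightarrow> 'a) \<Rightarrow> complex \<Rightarrow> 'a \<Rightarrow> 'a" where
  "resolvent D A \<mu> = the_inv_into D (\<lambda>x. \<mu> *\<^sub>C x - A x)"

definition resolvent_set :: "'a::complex_normed_vector set \<Rightarrow> ('a \<Rightarrow> 'a) \<Rightarrow> complex set" where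
  "resolvent_set D A =
     {\<mu>. bij_betw (\<lambda>x. \<mu> *\<^sub>C x - A x) D UNIV \<and> bounded_clinear (resolvent D A \<mu>)}"

definition essential_spectral_bound ::
    "'a::complex_normed_vector set \<Rightarrow> ('a \<Rightarrow> 'a) \<Rightarrow> ereal" where
  "essential_spectral_bound D A = (SUP \<mu> \<in> essential_spectrum D A. ereal (Re \<mu>))"

text \<open>The upper limit of the resolvent norms presupposes that the resolvent exists for large
  \<open>\<bar>b\<bar>\<close>; the third condition makes this explicit. For generators it follows from the first two,
  as \<open>\<mu> - A\<close> is Fredholm of index zero to the right of the essential spectral bound.\<close>

definition resolvent_bound :: "'a::complex_normed_vector set \<Rightarrow> ('a \<Rightarrow> 'a) \<Rightarrow> ereal" where
  "resolvent_bound D A = Inf (ereal ` {a. essential_spectral_bound D A < ereal a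
     \<and> finite (point_spectrum D A \<inter> {\<mu>. Re \<mu> = a})
     \<and> (\<forall>\<^sub>F b in at_infinity. Complex a b \<in> resolvent_set D A)
     \<and> Limsup at_infinity (\<lambda>b. ereal (onorm (resolvent D A (Complex a b)))) < \<infinity>})"

text \<open>\<open>exp_bound s t\<close> is \<open>e\<^sup>s\<^sup>t\<close>, read as \<open>0\<close> for \<open>s = -\<infinity>\<close>. The junk value at \<open>s = \<infinity>\<close> is not
  used: the resolvent bound of a generator is at most the growth bound of its semigroup.\<close>

definition exp_bound :: "ereal \<Rightarrow> real \<Rightarrow> real" where
  "exp_bound s t = (if s = -\<infinity> then 0 else exp (real_of_ereal s * t))"

section \<open>Semigroups and evolution families\<close>

definition C0_semigroup :: "(real \<Rightarrow> 'a::complex_normed_vector \<Rightarrow> 'a) \<Rightarrow> bool" where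
  "C0_semigroup T \<longleftrightarrow>
     (\<forall>t\<ge>0. bounded_clinear (T t)) \<and>
     T 0 = id \<and>
     (\<forall>s\<ge>0. \<forall>t\<ge>0. T (s + t) = T s \<circ> T t) \<and>
     (\<forall>x. continuous_on {0..} (\<lambda>t. T t x))"

definition is_generator ::
    "'a::complex_normed_vector set \<Rightarrow> ('a \<Rightarrow> 'a) \<Rightarrow> (real \<Rightarrow> 'a \<Rightarrow> 'a) \<Rightarrow> bool" where
  "is_generator D A T \<longleftrightarrow>
     D = {x. \<exists>y. ((\<lambda>h. (1 / h) *\<^sub>R (T h x - x)) \<longlongrightarrow> y) (at_right 0)} \<and>
     (\<forall>x\<in>D. ((\<lambda>h. (1 / h) *\<^sub>R (T h x - x)) \<longlongrightarrow> A x) (at_right 0))"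

definition evolution_family :: "(real \<Rightarrow> real \<Rightarrow> 'a::complex_normed_vector \<Rightarrow> 'a) \<Rightarrow> bool" where
  "evolution_family U \<longleftrightarrow>
     (\<forall>t \<tau>. 0 \<le> \<tau> \<and> \<tau> \<le> t \<longrightarrow> bounded_clinear (U t \<tau>)) \<and>
     (\<forall>t\<ge>0. U t t = id) \<and>
     (\<forall>t s \<tau>. 0 \<le> \<tau> \<and> \<tau> \<le> s \<and> s \<le> t \<longrightarrow> U t s \<circ> U s \<tau> = U t \<tau>) \<and>
     (\<forall>x. continuous_on {(t, \<tau>). 0 \<le> \<tau> \<and> \<tau> \<le> t} (\<lambda>(t, \<tau>). U t \<tau> x))"

end

theory Submission
  imports Defs "HOL-Library.Ramsey"
begin

text \<open>Let \<open>\<sigma> > -\<infinity>\<close> be the resolvent bound of the generator \<open>A\<close>. The heart of the matter is a property of the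
semigroup alone. For every \<open>b < \<sigma>\<close> and every \<open>N\<close> there is a sequence \<open>v\<close> in the unit ball such that, for
each \<open>m\<close> and all large \<open>n\<close>, the lower bound \<open>\<parallel>T(t)(v\<^sub>m - v\<^sub>n)\<parallel> \<ge> c e\<^sup>b\<^sup>t\<close> holds on the whole interval \<open>[0,N]\<close>,
where \<open>c\<close> depends only on the size of the semigroup on \<open>[0,1]\<close> (\<open>separating\<close>). This is proved by
contraposition (\<open>resolvent_bound_le\<close>). There are three sources of such sequences:

  \<^item> bounded sequences \<open>u\<close> without convergent subsequence for which \<open>(\<mu> - A)u\<^sub>n\<close> converges, where
    \<open>Re \<mu> \<ge> b\<close>: on approximate eigenvectors \<open>T(t)\<close> acts like \<open>e\<^sup>\<mu>\<^sup>t\<close>, uniformly on \<open>[0,N]\<close>;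
  \<^item> infinitely many eigenvalues in the half-plane \<open>Re \<mu> \<ge> b\<close>, by Riesz's lemma in the spans of
    eigenvectors;
  \<^item> approximate eigenvectors on a vertical line whose frequencies tend to infinity: the average
    of \<open>T(s)\<close> over \<open>[0,h]\<close> nearly annihilates them but nearly fixes any given vector when \<open>h\<close> is small,
    so they stay away from every scalar multiple of modulus one of that vector.

If none of them exists, then \<open>\<mu> - A\<close> has finite-dimensional kernel and closed range whenever \<open>Re \<mu> \<ge> b\<close>,
and only finitely many \<open>\<mu>\<close> are eigenvalues. Continuation along a horizontal ray from the far right,
where \<open>\<mu> - A\<close> is invertible, shows that \<open>\<mu>\<close> lies in the resolvent set unless the ray hits an
eigenvalue. Hence every such \<open>\<mu>\<close> is a limit of points of the resolvent set, and this forces the range of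
\<open>\<mu> - A\<close> to have finite codimension: otherwise the inverses at nearby points would produce arbitrarily
many well separated vectors close to the unit sphere of the kernel. So the resolvent bound is at
most \<open>b\<close>.

The passage from \<open>T\<close> to \<open>U\<close> uses that \<open>U(t,0) - T(t)\<close> is compact (\<open>difference_compact\<close>), because a strong
integral of compact operators is compact (\<open>integral_of_compact_family\<close>). After thinning out the
sequence, \<open>U(t,0)\<close> and \<open>T(t)\<close> almost agree on the differences \<open>v\<^sub>m - v\<^sub>n\<close> for finitely many given times \<open>t\<close>.
Finitely many times suffice on a bounded interval: \<open>\<parallel>U(g,t)\<parallel>\<close> is bounded by a constant independent of
the interval as soon as \<open>g \<ge> t\<close> is close enough to \<open>t\<close>, so a lower bound at time \<open>g\<close> gives one at time
\<open>t\<close> (\<open>evolution_grid\<close>).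

Finally the vector is built as a series \<open>x = u\<^sub>0 + \<Sum>\<epsilon>\<^sub>k (v\<^sub>m - v\<^sub>n)\<close>, the sequence \<open>v\<close> and the pair \<open>(m,n)\<close>
depending on \<open>k\<close> (\<open>gliding_hump\<close>). The \<open>k\<close>-th term makes the orbit of size at least a multiple of
\<open>\<epsilon>\<^sub>k e\<^sup>\<sigma>\<^sup>t\<close> at the times of the \<open>k\<close>-th grid, and the later terms must not destroy this. Instead of choosing
them in the kernels of norming functionals, one chooses the pair by Ramsey's theorem: if all pairs
from an infinite set lowered the norm at one of the finitely many times, a telescoping average would
violate the triangle inequality (\<open>perturbation_step\<close>). The numbers \<open>\<epsilon>\<^sub>k\<close> are fixed first. Then one
picks times \<open>\<tau>\<^sub>k\<close> beyond which \<open>a\<close> stays below a fixed multiple of \<open>\<epsilon>\<^sub>k\<close>, and the \<open>k\<close>-th grid serves the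
times up to \<open>\<tau>\<^sub>k\<^sub>+\<^sub>1\<close>; so the lower bound at times between \<open>\<tau>\<^sub>k\<close> and \<open>\<tau>\<^sub>k\<^sub>+\<^sub>1\<close> is at least \<open>a(t) e\<^sup>\<sigma>\<^sup>t\<close>.\<close>

section \<open>Ramsey's theorem and separated sequences\<close>

text \<open>Colour a pair by the first index in an enumeration of \<open>I\<close> whose relation holds for it. This
form of the infinite Ramsey theorem is convenient for proofs by contradiction in which every pair
fails for one of finitely many reasons.\<close>

lemma Ramsey_cover:
  fixes R :: "'i \<Rightarrow> nat \<Rightarrow> nat \<Rightarrow> bool"
  assumes "finite I" and cover: "\<And>m n. m < n \<Longrightarrow> \<exists>i\<in>I. R i m n"
  obtains i and r :: "nat \<Rightarrow> nat" where "i \<in> I" "strict_mono r" "\<And>j k. j < k \<Longrightarrow> R i (r j) (r k)"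
proof -
  obtain h where h: "bij_betw h {0..<card I} I"
    using ex_bij_betw_nat_finite[OF \<open>finite I\<close>] by blast
  define f where "f X = (LEAST q. q < card I \<and> R (h q) (Min X) (Max X))" for X
  have f: "f {m, n} < card I \<and> R (h (f {m, n})) m n" if mn: "m < n" for m n
  proof -
    obtain i where "i \<in> I" "R i m n" using cover[OF mn] by blast
    moreover obtain q where "q \<in> {0..<card I}" "i = h q"
      using bij_betw_imp_surj_on[OF h] \<open>i \<in> I\<close> by blast
    ultimately have "q < card I" "R (h q) m n" by auto
    then have "q < card I \<and> R (h q) (Min {m, n}) (Max {m, n})"
      using that by simp
    then have "f {m, n} < card I \<and> R (h (f {m, n})) (Min {m, n}) (Max {m, n})"
      unfolding f_def by (rule LeastI)
    then show ?thesis using that by simp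
  qed
  have "\<forall>x\<in>UNIV. \<forall>y\<in>UNIV. x \<noteq> y \<longrightarrow> f {x, y} < card I"
  proof (intro ballI impI)
    fix x y :: nat assume "x \<noteq> y"
    then show "f {x, y} < card I"
      using f[of x y] f[of y x] by (cases "x < y") (auto simp: insert_commute)
  qed
  from Ramsey2[OF infinite_UNIV_nat this]
  obtain Y t where Y: "infinite Y" "t < card I" "\<forall>x\<in>Y. \<forall>y\<in>Y. x \<noteq> y \<longrightarrow> f {x, y} = t"
    by auto
  have sm: "strict_mono (enumerate Y)" using Y(1) by (rule strict_mono_enumerate)
  show thesis
  proof (rule that[of "h t" "enumerate Y"])
    show "h t \<in> I" using h Y(2) by (auto simp: bij_betw_def)
    show "strict_mono (enumerate Y)" by (rule sm)
    fix j k :: nat assume "j < k"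
    then have lt: "enumerate Y j < enumerate Y k" using sm by (simp add: strict_mono_less)
    moreover have "f {enumerate Y j, enumerate Y k} = t"
      using Y lt enumerate_in_set[OF Y(1)] by (metis less_irrefl)
    ultimately show "R (h t) (enumerate Y j) (enumerate Y k)"
      using f[OF lt] by simp
  qed
qed

definition has_convergent_subseq :: "(nat \<Rightarrow> 'a::topological_space) \<Rightarrow> bool" where
  "has_convergent_subseq u \<longleftrightarrow> (\<exists>r l. strict_mono r \<and> (\<lambda>n. u (r n)) \<longlonglongrightarrow> l)"

text \<open>If the range were totally bounded, its closure would be compact. Otherwise some radius
defeats every finite set of centres, and each new term can be chosen away from all earlier terms of
the original sequence, which also makes the chosen indices increase.\<close>

lemma separated_subseq:
  fixes u :: "nat \<Rightarrow> 'a::complete_space"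
  assumes "\<not> has_convergent_subseq u"
  obtains e and r :: "nat \<Rightarrow> nat" where "e > 0" "strict_mono r" "\<And>j k. j < k \<Longrightarrow> e \<le> dist (u (r j)) (u (r k))"
proof -
  have "\<not> compact (closure (range u))"
  proof
    assume "compact (closure (range u))"
    then have "seq_compact (closure (range u))" by (simp add: compact_eq_seq_compact_metric)
    moreover have "\<forall>n. u n \<in> closure (range u)" using closure_subset by fastforce
    ultimately obtain l r where "strict_mono r" "(u \<circ> r) \<longlonglongrightarrow> l"
      unfolding seq_compact_def by metis
    then show False using assms by (auto simp: has_convergent_subseq_def o_def)
  qed
  then obtain e where e: "e > 0" "\<And>k. finite k \<Longrightarrow> \<not> closure (range u) \<subseteq> (\<Union>x\<in>k. ball x e)"
    unfolding compact_eq_totally_bounded by (auto simp: complete_eq_closed)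
  have next_: "\<exists>n>N. \<forall>i\<le>N. e/2 \<le> dist (u i) (u n)" for N
  proof (rule ccontr)
    assume "\<not> ?thesis"
    then have *: "\<forall>n>N. \<exists>i\<le>N. dist (u i) (u n) < e/2" by (auto simp: not_le)
    have "range u \<subseteq> (\<Union>x\<in>u ` {..N}. cball x (e/2))"
    proof
      fix y assume "y \<in> range u"
      then obtain n where n: "y = u n" by blast
      show "y \<in> (\<Union>x\<in>u ` {..N}. cball x (e/2))"
      proof (cases "n \<le> N")
        case True
        then show ?thesis using n e(1) by (auto intro!: bexI[of _ n])
      next
        case False
        then show ?thesis using * n by (force simp: not_le intro: less_imp_le)
      qed
    qed
    then have "closure (range u) \<subseteq> (\<Union>x\<in>u ` {..N}. cball x (e/2))"
      by (intro closure_minimal closed_UN) auto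
    also have "\<dots> \<subseteq> (\<Union>x\<in>u ` {..N}. ball x e)" using e(1) by force
    finally show False using e(2)[of "u ` {..N}"] by simp
  qed
  have "\<exists>r. \<forall>n. True \<and> (r n < r (Suc n) \<and> (\<forall>i\<le>r n. e/2 \<le> dist (u i) (u (r (Suc n)))))"
    by (rule dependent_nat_choice) (use next_ in auto)
  then obtain r where r: "\<And>n. r n < r (Suc n)"
    "\<And>n i. i \<le> r n \<Longrightarrow> e/2 \<le> dist (u i) (u (r (Suc n)))" by auto
  have sm: "strict_mono r" using r(1) by (simp add: strict_mono_Suc_iff)
  show thesis
  proof (rule that[of "e/2" r])
    show "e/2 > 0" using e(1) by simp
    show "strict_mono r" by fact
    fix j k :: nat assume "j < k"
    then obtain q where "k = Suc q" "j \<le> q" by (cases k) auto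
    then show "e/2 \<le> dist (u (r j)) (u (r k))"
      using r(2)[of "r j" q] sm by (simp add: strict_mono_less_eq)
  qed
qed

lemma not_convergent_separated:
  fixes u :: "nat \<Rightarrow> 'a::real_normed_vector"
  assumes e: "0 < e" and sep: "\<And>m n. m < n \<Longrightarrow> e \<le> norm (u m - u n)"
  shows "\<not> has_convergent_subseq u"
proof
  assume "has_convergent_subseq u"
  then obtain r :: "nat \<Rightarrow> nat" and l where r: "strict_mono r" "(\<lambda>n. u (r n)) \<longlonglongrightarrow> l"
    unfolding has_convergent_subseq_def by blast
  have "Cauchy (\<lambda>n. u (r n))" using r(2) by (rule LIMSEQ_imp_Cauchy)
  then obtain M where "\<forall>m\<ge>M. \<forall>n\<ge>M. norm (u (r m) - u (r n)) < e"
    using e unfolding Cauchy_iff by blast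
  then have "norm (u (r M) - u (r (Suc M))) < e" by simp
  moreover have "r M < r (Suc M)" using r(1) by (simp add: strict_mono_less)
  ultimately show False using sep[of "r M" "r (Suc M)"] by simp
qed

section \<open>Finite-dimensional complex subspaces\<close>

lemma scaleC_bilinear: "bounded_bilinear (scaleC :: complex \<Rightarrow> 'a \<Rightarrow> 'a::complex_normed_vector)"
proof (rule bounded_bilinear.intro)
  have of_real: "complex_of_real r *\<^sub>C b = r *\<^sub>R b" for r and b :: 'a by (rule scaleC_of_real)
  show "(a + a') *\<^sub>C b = a *\<^sub>C b + a' *\<^sub>C b" for a a' and b :: 'a by (rule scaleC_add_left)
  show "a *\<^sub>C (b + b') = a *\<^sub>C b + a *\<^sub>C b'" for a and b b' :: 'a by (rule scaleC_add_right)
  show "(r *\<^sub>R a) *\<^sub>C b = r *\<^sub>R (a *\<^sub>C b)" for r a and b :: 'a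
    unfolding of_real[symmetric] scaleC_scaleC by (simp add: scaleR_conv_of_real)
  show "a *\<^sub>C (r *\<^sub>R b) = r *\<^sub>R (a *\<^sub>C b)" for r a and b :: 'a
    unfolding of_real[symmetric] scaleC_scaleC by (simp add: mult.commute)
  show "\<exists>K. \<forall>a b. norm (a *\<^sub>C (b::'a)) \<le> norm a * norm b * K"
    by (rule exI[of _ 1]) (simp add: norm_scaleC)
qed

interpretation scaleC: bounded_bilinear "scaleC :: complex \<Rightarrow> 'a \<Rightarrow> 'a::complex_normed_vector"
  by (rule scaleC_bilinear)

lemma scaleC_one: "1 *\<^sub>C x = (x::'a::complex_normed_vector)"
  using scaleC_of_real[of 1 x] by simp

lemma cspan_scaleR: "x \<in> cspan B \<Longrightarrow> r *\<^sub>R x \<in> cspan B"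
  using complex_vector.span_scale[of x B "complex_of_real r"] by (simp add: scaleC_of_real)

lemma infdist_cspan_pos:
  assumes "closed (cspan B)" "x \<notin> cspan B"
  shows "infdist x (cspan B) > 0"
  using assms complex_vector.span_zero infdist_pos_not_in_closed by blast

text \<open>Induction on the spanning set. If \<open>b\<close> lies outside the closed span of \<open>B\<close>, its distance from
that span controls the coefficient of \<open>b\<close>, so the coefficients and the remainders stay bounded
separately.\<close>

lemma cspan_bounded_seq:
  fixes B :: "'a::complex_normed_vector set" and u :: "nat \<Rightarrow> 'a"
  assumes "finite B" and "\<And>n. u n \<in> cspan B" and "bounded (range u)"
  shows "\<exists>(r :: nat \<Rightarrow> nat) l. strict_mono r \<and> l \<in> cspan B \<and> (\<lambda>n. u (r n)) \<longlonglongrightarrow> l"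
  using assms
proof (induction B arbitrary: u rule: finite_induct)
  case empty
  then have "u = (\<lambda>_. 0)" by auto
  then have "strict_mono (id :: nat \<Rightarrow> nat) \<and> 0 \<in> cspan ({} :: 'a set) \<and> (\<lambda>n. u (id n)) \<longlonglongrightarrow> 0"
    by (simp add: strict_mono_def)
  then show ?case by blast
next
  case (insert b B)
  show ?case
  proof (cases "b \<in> cspan B")
    case True
    then have "cspan (insert b B) = cspan B" by (rule complex_vector.span_redundant)
    then show ?thesis using insert by metis
  next
    case False
    have "closed (cspan B)"
      unfolding closed_sequential_limits
    proof (intro allI impI, elim conjE)
      fix x l assume x: "\<forall>n. x n \<in> cspan B" "x \<longlonglongrightarrow> l"
      then have "bounded (range x)" using convergent_imp_bounded by blast
      with x(1) insert.IH obtain r l' where r: "strict_mono r" "l' \<in> cspan B" "(\<lambda>n. x (r n)) \<longlonglongrightarrow> l'"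
        by metis
      moreover have "(\<lambda>n. x (r n)) \<longlonglongrightarrow> l"
        using LIMSEQ_subseq_LIMSEQ[OF x(2) r(1)] by (simp add: o_def)
      ultimately show "l \<in> cspan B" using LIMSEQ_unique by blast
    qed
    then have d: "infdist b (cspan B) > 0" using False by (rule infdist_cspan_pos)
    define d where "d = infdist b (cspan B)"
    have "\<exists>k. u n - k *\<^sub>C b \<in> cspan B" for n
      using insert.prems(1) complex_vector.span_breakdown_eq by blast
    then obtain k where k: "\<And>n. u n - k n *\<^sub>C b \<in> cspan B" by metis
    define e where "e n = u n - k n *\<^sub>C b" for n
    obtain C where C: "\<And>n. norm (u n) \<le> C" using insert.prems(2) by (auto simp: bounded_iff)
    have kd: "cmod (k n) * d \<le> norm (u n)" for n
    proof (cases "k n = 0")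
      case False
      have "- (inverse (k n) *\<^sub>C e n) \<in> cspan B"
        using k by (auto simp: e_def intro!: complex_vector.span_neg complex_vector.span_scale)
      then have "d \<le> dist b (- (inverse (k n) *\<^sub>C e n))" unfolding d_def by (rule infdist_le)
      also have "\<dots> = norm (inverse (k n) *\<^sub>C (k n *\<^sub>C b + e n))"
        using False by (simp add: dist_norm scaleC_add_right scaleC_scaleC scaleC_one)
      also have "\<dots> = norm (u n) / cmod (k n)"
        by (simp add: norm_scaleC e_def norm_inverse divide_inverse mult.commute)
      finally show ?thesis using False by (simp add: field_simps)
    qed simp
    have dpos: "d > 0" using d by (simp add: d_def)
    have "cmod (k n) \<le> C / d" for n
      using kd[of n] C[of n] dpos by (simp add: field_simps)
    then have kb: "bounded (range k)" by (auto simp: bounded_iff)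
    then obtain r1 l1 where r1: "strict_mono r1" "(k \<circ> r1) \<longlonglongrightarrow> l1"
      using bounded_imp_convergent_subsequence by blast
    have "norm (e n) \<le> C + C / d * norm b" for n
    proof -
      have "norm (e n) \<le> norm (u n) + cmod (k n) * norm b"
        unfolding e_def by (metis norm_triangle_ineq4 norm_scaleC)
      also have "\<dots> \<le> C + C / d * norm b"
        using C[of n] \<open>cmod (k n) \<le> C / d\<close> by (intro add_mono mult_right_mono) auto
      finally show ?thesis .
    qed
    then have "bounded (range (\<lambda>n. e (r1 n)))" by (auto simp: bounded_iff)
    moreover have "\<And>n. e (r1 n) \<in> cspan B" using k by (simp add: e_def)
    ultimately obtain r2 l2 where r2: "strict_mono r2" "l2 \<in> cspan B" "(\<lambda>n. e (r1 (r2 n))) \<longlonglongrightarrow> l2"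
      using insert.IH[of "\<lambda>n. e (r1 n)"] by blast
    have "(\<lambda>n. k (r1 (r2 n))) \<longlonglongrightarrow> l1"
      using LIMSEQ_subseq_LIMSEQ[OF r1(2) r2(1)] by (simp add: o_def)
    then have "(\<lambda>n. k (r1 (r2 n)) *\<^sub>C b + e (r1 (r2 n))) \<longlonglongrightarrow> l1 *\<^sub>C b + l2"
      by (intro tendsto_add scaleC.tendsto r2(3) tendsto_const)
    then have "(\<lambda>n. u (r1 (r2 n))) \<longlonglongrightarrow> l1 *\<^sub>C b + l2" by (simp add: e_def)
    moreover have "l1 *\<^sub>C b + l2 \<in> cspan (insert b B)"
      by (intro complex_vector.span_add complex_vector.span_scale complex_vector.span_base
          subsetD[OF complex_vector.span_mono r2(2)]) auto
    moreover have "strict_mono (\<lambda>n. r1 (r2 n))"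
      using strict_mono_o[OF r1(1) r2(1)] by (simp add: o_def)
    ultimately show ?thesis by blast
  qed
qed

lemma closed_cspan:
  fixes B :: "'a::complex_normed_vector set"
  assumes "finite B"
  shows "closed (cspan B)"
  unfolding closed_sequential_limits
proof (intro allI impI, elim conjE)
  fix x l assume x: "\<forall>n. x n \<in> cspan B" "x \<longlonglongrightarrow> l"
  then have "bounded (range x)" using convergent_imp_bounded by blast
  with x(1) cspan_bounded_seq[OF assms] obtain r l'
    where r: "strict_mono r" "l' \<in> cspan B" "(\<lambda>n. x (r n)) \<longlonglongrightarrow> l'"
    by metis
  moreover have "(\<lambda>n. x (r n)) \<longlonglongrightarrow> l"
    using LIMSEQ_subseq_LIMSEQ[OF x(2) r(1)] by (simp add: o_def)
  ultimately show "l \<in> cspan B" using LIMSEQ_unique by blast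
qed

text \<open>Riesz's lemma, applied successively to the spans of a linearly independent sequence. The
coefficient \<open>r n\<close> records that only \<open>x n\<close> is new in \<open>y n\<close>.\<close>

lemma Riesz_sequence:
  fixes x :: "nat \<Rightarrow> 'a::complex_normed_vector"
  assumes indep: "\<And>n. x n \<notin> cspan (x ` {..<n})"
  shows "\<exists>y r. \<forall>n. norm (y n) = 1 \<and> y n - r n *\<^sub>R x n \<in> cspan (x ` {..<n}) \<and>
    (\<forall>g\<in>cspan (x ` {..<n}). 1/2 \<le> norm (y n - g))"
proof -
  have "\<exists>y r. norm y = 1 \<and> y - r *\<^sub>R x n \<in> cspan (x ` {..<n}) \<and>
    (\<forall>g\<in>cspan (x ` {..<n}). 1/2 \<le> norm (y - g))" for n
  proof -
    let ?E = "cspan (x ` {..<n})"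
    define d where "d = infdist (x n) ?E"
    have ne: "?E \<noteq> {}" using complex_vector.span_zero by blast
    have d: "d > 0"
      unfolding d_def by (intro infdist_cspan_pos closed_cspan indep) simp
    obtain f where f: "f \<in> ?E" "dist (x n) f < 2 * d"
      using cInf_lessD[of "dist (x n) ` ?E" "2 * d"] d ne
      by (auto simp: d_def infdist_notempty)
    define s where "s = norm (x n - f)"
    have s: "0 < s" "s < 2 * d"
      using f indep[of n] by (auto simp: s_def dist_norm)
    define y where "y = (1/s) *\<^sub>R (x n - f)"
    have "norm y = 1" using s by (simp add: y_def s_def)
    moreover have "y - (1/s) *\<^sub>R x n \<in> ?E"
    proof -
      have "y - (1/s) *\<^sub>R x n = (-(1/s)) *\<^sub>R f" by (simp add: y_def algebra_simps)
      then show ?thesis using f cspan_scaleR by metis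
    qed
    moreover have "1/2 \<le> norm (y - g)" if g: "g \<in> ?E" for g
    proof -
      have "f + s *\<^sub>R g \<in> ?E" using f g by (intro complex_vector.span_add cspan_scaleR)
      then have "d \<le> norm (x n - (f + s *\<^sub>R g))"
        unfolding d_def dist_norm[symmetric] by (rule infdist_le)
      also have "x n - (f + s *\<^sub>R g) = s *\<^sub>R (y - g)"
        using s by (simp add: y_def algebra_simps)
      also have "norm \<dots> = s * norm (y - g)" using s by simp
      finally have "s / 2 < s * norm (y - g)" using s by linarith
      then show ?thesis using s by (simp add: field_simps)
    qed
    ultimately show ?thesis by blast
  qed
  then show ?thesis by metis
qed

lemma cspan_image_base: "i < n \<Longrightarrow> x i \<in> cspan (x ` {..<n::nat})"
  by (intro complex_vector.span_base imageI) simp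

lemma Riesz_in_span:
  fixes x y :: "nat \<Rightarrow> 'a::complex_normed_vector"
  assumes "\<And>n. y n - r n *\<^sub>R x n \<in> cspan (x ` {..<n})" and "m < n"
  shows "y m \<in> cspan (x ` {..<n})"
proof -
  have "cspan (x ` {..<m}) \<subseteq> cspan (x ` {..<n})"
    using assms(2) by (intro complex_vector.span_mono image_mono) auto
  then have "(y m - r m *\<^sub>R x m) + r m *\<^sub>R x m \<in> cspan (x ` {..<n})"
    using assms by (intro complex_vector.span_add cspan_scaleR cspan_image_base) auto
  then show ?thesis by simp
qed

text \<open>Dependent choice where each new term may depend on all earlier ones. It is used for
independent sequences (\<open>H F = cspan F\<close>) and for sequences independent modulo a subspace.\<close>

lemma avoiding_sequence:
  assumes "\<And>F. finite F \<Longrightarrow> \<exists>x\<in>V. x \<notin> H F"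
  shows "\<exists>x. \<forall>n::nat. x n \<in> V \<and> x n \<notin> H (x ` {..<n})"
proof (rule dependent_wf_choice[OF wf_less_than,
      where P = "\<lambda>x n y. y \<in> V \<and> y \<notin> H (x ` {..<n})"])
  fix f g :: "nat \<Rightarrow> 'a" and n y
  assume "\<And>z. (z, n) \<in> less_than \<Longrightarrow> f z = g z"
  then have "f ` {..<n} = g ` {..<n}" by (intro image_cong) auto
  then show "(y \<in> V \<and> y \<notin> H (f ` {..<n})) = (y \<in> V \<and> y \<notin> H (g ` {..<n}))" by simp
next
  fix n and f :: "nat \<Rightarrow> 'a"
  show "\<exists>y. y \<in> V \<and> y \<notin> H (f ` {..<n})" using assms[of "f ` {..<n}"] by auto
qed

text \<open>The distance to a subspace behaves like the norm of the quotient space. The following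
estimates express this without forming quotients.\<close>

lemma infdist_cspan_approx:
  assumes "0 < e"
  obtains f where "f \<in> cspan B" "norm (x - f) < infdist x (cspan B) + e"
proof -
  have ne: "cspan B \<noteq> {}" using complex_vector.span_zero by blast
  then have "(INF a\<in>cspan B. dist x a) < infdist x (cspan B) + e"
    using assms by (simp add: infdist_notempty)
  then show thesis using cInf_lessD[of "dist x ` cspan B"] ne that
    by (auto simp: dist_norm)
qed

lemma infdist_cspan_le_norm: "infdist x (cspan B) \<le> norm x"
  using infdist_le[OF complex_vector.span_zero, of x B] by simp

lemma infdist_cspan_add:
  "infdist (x + y) (cspan B) \<le> infdist x (cspan B) + infdist y (cspan B)"
proof (rule field_le_epsilon)
  fix e :: real assume "e > 0"
  then have e: "e/2 > 0" by simp
  obtain f where f: "f \<in> cspan B" "norm (x - f) < infdist x (cspan B) + e/2"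
    by (rule infdist_cspan_approx[OF e])
  obtain g where g: "g \<in> cspan B" "norm (y - g) < infdist y (cspan B) + e/2"
    by (rule infdist_cspan_approx[OF e])
  have "infdist (x + y) (cspan B) \<le> dist (x + y) (f + g)"
    by (intro infdist_le complex_vector.span_add f g)
  also have "\<dots> \<le> norm (x - f) + norm (y - g)"
    by (metis dist_norm dist_triangle_add)
  finally show "infdist (x + y) (cspan B) \<le> infdist x (cspan B) + infdist y (cspan B) + e"
    using f g by linarith
qed

lemma infdist_cspan_scaleR:
  assumes "0 \<le> r"
  shows "infdist (r *\<^sub>R x) (cspan B) \<le> r * infdist x (cspan B)"
proof (cases "r = 0")
  case True
  then show ?thesis using infdist_cspan_le_norm[of "r *\<^sub>R x" B] by simp
next
  case False
  then have r: "r > 0" using assms by simp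
  show ?thesis
  proof (rule field_le_epsilon)
    fix e :: real assume "e > 0"
    then obtain f where f: "f \<in> cspan B" "norm (x - f) < infdist x (cspan B) + e/r"
      using infdist_cspan_approx[of "e/r"] r by (metis divide_pos_pos)
    have "infdist (r *\<^sub>R x) (cspan B) \<le> dist (r *\<^sub>R x) (r *\<^sub>R f)"
      by (intro infdist_le cspan_scaleR f)
    also have "\<dots> = r * norm (x - f)" using r by (simp add: dist_norm scaleR_diff_right[symmetric])
    also have "\<dots> \<le> r * (infdist x (cspan B) + e/r)" using f r by (intro mult_left_mono) auto
    finally show "infdist (r *\<^sub>R x) (cspan B) \<le> r * infdist x (cspan B) + e"
      using r by (simp add: distrib_left)
  qed
qed

lemma infdist_cspan_sum:
  "finite I \<Longrightarrow> infdist (sum x I) (cspan B) \<le> (\<Sum>i\<in>I. infdist (x i) (cspan B))"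
proof (induction I rule: finite_induct)
  case empty
  then show ?case using infdist_cspan_le_norm[of 0 B] by simp
next
  case (insert i I)
  then show ?case using infdist_cspan_add[of "x i" "sum x I" B] by simp
qed

lemma span_Int_range:
  fixes y :: "nat \<Rightarrow> 'a::complex_normed_vector"
  assumes R: "complex_vector.subspace R" and y: "\<And>n. y n \<notin> cspan (R \<union> y ` {..<n})"
  shows "v \<in> cspan (y ` {..<n}) \<Longrightarrow> v \<in> R \<Longrightarrow> v = 0"
proof (induction n)
  case 0
  then show ?case by simp
next
  case (Suc n)
  have "v \<in> cspan (insert (y n) (y ` {..<n}))" using Suc.prems(1) by (simp add: lessThan_Suc)
  then obtain k where k: "v - k *\<^sub>C y n \<in> cspan (y ` {..<n})" using complex_vector.span_breakdown_eq by blast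
  have "k = 0"
  proof (rule ccontr)
    assume "k \<noteq> 0"
    have "v - k *\<^sub>C y n \<in> cspan (R \<union> y ` {..<n})"
      by (rule subsetD[OF complex_vector.span_mono k]) simp
    moreover have "v \<in> cspan (R \<union> y ` {..<n})" using Suc.prems(2) by (intro complex_vector.span_base) simp
    ultimately have "v - (v - k *\<^sub>C y n) \<in> cspan (R \<union> y ` {..<n})" by (rule complex_vector.span_diff[rotated])
    then have "inverse k *\<^sub>C (v - (v - k *\<^sub>C y n)) \<in> cspan (R \<union> y ` {..<n})" by (rule complex_vector.span_scale)
    then show False using y[of n] \<open>k \<noteq> 0\<close> by (simp add: scaleC_scaleC scaleC_one)
  qed
  then show ?case using Suc k by (simp add: scaleC.zero_left)
qed

lemma LIMSEQ_norm_le_inverse: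
  fixes z :: "nat \<Rightarrow> 'a::real_normed_vector"
  assumes "\<And>n. norm (z n) \<le> 1 / real (Suc n)"
  shows "z \<longlonglongrightarrow> 0"
proof (rule Lim_null_comparison)
  show "\<forall>\<^sub>F n in sequentially. norm (z n) \<le> inverse (real (Suc n))"
    using assms by (simp add: inverse_eq_divide)
qed (rule LIMSEQ_inverse_real_of_nat)

text \<open>The unit sphere of the finite-dimensional span is compact, so a distance without positive
lower bound would vanish somewhere on it.\<close>

lemma span_away_from_closed_subspace:
  fixes F :: "'a::complex_normed_vector set"
  assumes F: "finite F" and R: "complex_vector.subspace R" "closed R"
    and int: "\<And>v. v \<in> cspan F \<Longrightarrow> v \<in> R \<Longrightarrow> v = 0"
  shows "\<exists>\<kappa>>0. \<forall>v\<in>cspan F. \<kappa> * norm v \<le> infdist v R"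
proof (rule ccontr)
  assume no: "\<not> ?thesis"
  have cR: "cspan R = R" using R(1) by (simp add: complex_vector.span_eq_iff)
  have "\<exists>u. u \<in> cspan F \<and> norm u = 1 \<and> infdist u R \<le> 1 / real (Suc n)" for n
  proof -
    have "0 < 1 / real (Suc n)" by simp
    then obtain v where v: "v \<in> cspan F" "infdist v R < 1 / real (Suc n) * norm v"
      using no by (meson not_le)
    then have v0: "v \<noteq> 0" using infdist_nonneg[of v R] by auto
    have "infdist ((1 / norm v) *\<^sub>R v) R \<le> 1 / norm v * infdist v R"
      using infdist_cspan_scaleR[of "1 / norm v" v R] by (simp add: cR)
    also have "\<dots> \<le> 1 / norm v * (1 / real (Suc n) * norm v)"
      using v(2) by (intro mult_left_mono) auto
    also have "\<dots> = 1 / real (Suc n)" using v0 by simp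
    finally show ?thesis using v(1) v0 by (intro exI[of _ "(1 / norm v) *\<^sub>R v"]) (simp add: cspan_scaleR)
  qed
  then have "\<exists>u. \<forall>n. u n \<in> cspan F \<and> norm (u n) = 1 \<and> infdist (u n) R \<le> 1 / real (Suc n)"
    by (intro choice allI)
  then obtain u where u: "\<And>n. u n \<in> cspan F" "\<And>n. norm (u n) = 1" "\<And>n. infdist (u n) R \<le> 1 / real (Suc n)"
    by blast
  have "bounded (range u)" unfolding bounded_iff using u(2) by (intro exI[of _ 1]) auto
  then obtain r :: "nat \<Rightarrow> nat" and l where r: "strict_mono r" "l \<in> cspan F" "(\<lambda>n. u (r n)) \<longlonglongrightarrow> l"
    using cspan_bounded_seq[where u = u, OF F u(1)] by blast
  have "(\<lambda>n. infdist (u n) R) \<longlonglongrightarrow> 0"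
    by (rule LIMSEQ_norm_le_inverse) (use u(3) in \<open>simp add: abs_of_nonneg infdist_nonneg\<close>)
  then have "(\<lambda>n. infdist (u (r n)) R) \<longlonglongrightarrow> 0"
    using LIMSEQ_subseq_LIMSEQ[OF _ r(1)] by (simp add: o_def)
  moreover have "(\<lambda>n. infdist (u (r n)) R) \<longlonglongrightarrow> infdist l R" by (rule tendsto_infdist[OF r(3)])
  ultimately have "infdist l R = 0" using LIMSEQ_unique by blast
  moreover have "R \<noteq> {}" using complex_vector.subspace_0[OF R(1)] by blast
  ultimately have "l \<in> R" using in_closed_iff_infdist_zero[OF R(2)] by blast
  then have "l = 0" using int r(2) by blast
  moreover have "norm l = 1"
    using LIMSEQ_unique[OF tendsto_norm[OF r(3)]] u(2) by simp
  ultimately show False by simp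
qed

section \<open>Uniform boundedness\<close>

text \<open>By Baire's theorem one of the closed sets of vectors on which the whole family is bounded by \<open>n\<close>
contains a ball, and differences of its vectors cover a neighbourhood of \<open>0\<close>.\<close>

lemma uniform_boundedness:
  fixes L :: "'i \<Rightarrow> 'a::banach \<Rightarrow> 'b::real_normed_vector"
  assumes bl: "\<And>i. i \<in> I \<Longrightarrow> bounded_linear (L i)"
    and pw: "\<And>x. \<exists>C. \<forall>i\<in>I. norm (L i x) \<le> C"
  obtains C where "C > 0" "\<And>i x. i \<in> I \<Longrightarrow> norm (L i x) \<le> C * norm x"
proof -
  define E where "E n = (\<Inter>i\<in>I. {x. norm (L i x) \<le> real n})" for n
  have "closed (E n)" for n
    unfolding E_def
    by (intro closed_INT ballI closed_Collect_le continuous_intros linear_continuous_on[OF bl])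
  have "\<Union>(range E) = UNIV"
  proof (intro equalityI subsetI UNIV_I)
    fix x
    obtain C where "\<forall>i\<in>I. norm (L i x) \<le> C" using pw by blast
    moreover obtain n where "C \<le> real n" using real_arch_simple by blast
    ultimately have "x \<in> E n" by (auto simp: E_def intro: order_trans)
    then show "x \<in> \<Union>(range E)" by blast
  qed
  then have "euclidean interior_of \<Union>(range E) \<noteq> {}" by simp
  then have "\<exists>n. interior (E n) \<noteq> {}"
    using Baire_category_alt[of "euclidean :: 'a topology" "range E"] completely_metrizable_space_euclidean
      \<open>\<And>n. closed (E n)\<close> by auto
  then obtain n x r where r: "0 < r" "cball x r \<subseteq> E n" by (auto simp: mem_interior_cball)
  show thesis
  proof (rule that[of "(2 * real n + 1) / r"])
    show "(2 * real n + 1) / r > 0" using r(1) by (simp add: add_nonneg_pos)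
    fix i y assume i: "i \<in> I"
    interpret bounded_linear "L i" by (rule bl[OF i])
    have ball: "norm (L i z) \<le> real n" if "z \<in> cball x r" for z using that r(2) i by (auto simp: E_def)
    show "norm (L i y) \<le> (2 * real n + 1) / r * norm y"
    proof (cases "y = 0")
      case False
      let ?z = "(r / norm y) *\<^sub>R y"
      have "r / norm y * norm (L i y) = norm (L i (x + ?z) - L i x)"
        using r(1) by (simp add: add scaleR)
      also have "\<dots> \<le> real n + real n"
        using norm_triangle_ineq4[of "L i (x + ?z)" "L i x"] ball[of "x + ?z"] ball[of x] r(1) False
        by (simp add: dist_norm)
      finally have "r * norm (L i y) \<le> 2 * real n * norm y" using False by (simp add: field_simps)
      also have "\<dots> \<le> (2 * real n + 1) * norm y" by (intro mult_right_mono) auto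
      finally show ?thesis using r(1) by (simp add: field_simps)
    qed (simp add: zero)
  qed
qed

lemma continuous_family_bound:
  fixes L :: "real \<Rightarrow> 'a::banach \<Rightarrow> 'b::real_normed_vector"
  assumes "\<And>t. t \<in> {a..b} \<Longrightarrow> bounded_linear (L t)"
    and "\<And>x. continuous_on {a..b} (\<lambda>t. L t x)"
  shows "\<exists>C\<ge>1. \<forall>t\<in>{a..b}. \<forall>x. norm (L t x) \<le> C * norm x"
proof -
  have "\<exists>C. \<forall>t\<in>{a..b}. norm (L t x) \<le> C" for x
  proof -
    have "bounded ((\<lambda>t. L t x) ` {a..b})"
      by (intro compact_imp_bounded compact_continuous_image assms(2) compact_Icc)
    then show ?thesis unfolding bounded_iff by auto
  qed
  then obtain C where C: "C > 0" "\<And>t x. t \<in> {a..b} \<Longrightarrow> norm (L t x) \<le> C * norm x"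
    using uniform_boundedness[of "{a..b}" L, OF assms(1)] by blast
  have "norm (L t x) \<le> max 1 C * norm x" if "t \<in> {a..b}" for t x
    using C(2)[OF that, of x] mult_right_mono[of C "max 1 C" "norm x"] by auto
  then show ?thesis by (intro exI[of _ "max 1 C"]) auto
qed

lemma continuous_on_apply_family:
  fixes L :: "real \<Rightarrow> 'a::banach \<Rightarrow> 'b::real_normed_vector"
  assumes bl: "\<And>s. s \<in> {a..b} \<Longrightarrow> bounded_linear (L s)"
    and L: "\<And>x. continuous_on {a..b} (\<lambda>s. L s x)" and v: "continuous_on {a..b} v"
  shows "continuous_on {a..b} (\<lambda>s. L s (v s))"
  unfolding continuous_on_def
proof
  fix s0 assume s0: "s0 \<in> {a..b}"
  obtain C where C: "C \<ge> 1" "\<forall>t\<in>{a..b}. \<forall>x. norm (L t x) \<le> C * norm x"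
    using continuous_family_bound[OF bl L] by blast
  let ?F = "at s0 within {a..b}"
  have "(v \<longlongrightarrow> v s0) ?F" using v s0 unfolding continuous_on_def by blast
  then have "((\<lambda>s. C * norm (v s - v s0)) \<longlongrightarrow> C * norm (v s0 - v s0)) ?F"
    by (intro tendsto_mult tendsto_norm tendsto_diff tendsto_const)
  then have "((\<lambda>s. C * norm (v s - v s0)) \<longlongrightarrow> 0) ?F" by simp
  moreover have "\<forall>\<^sub>F s in ?F. norm (L s (v s - v s0)) \<le> C * norm (v s - v s0)"
    unfolding eventually_at_filter using C(2) by simp
  ultimately have 1: "((\<lambda>s. L s (v s - v s0)) \<longlongrightarrow> 0) ?F" by (rule Lim_null_comparison[rotated])
  have 2: "((\<lambda>s. L s (v s0)) \<longlongrightarrow> L s0 (v s0)) ?F" using L s0 unfolding continuous_on_def by blast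
  have "((\<lambda>s. L s (v s - v s0) + L s (v s0)) \<longlongrightarrow> 0 + L s0 (v s0)) ?F" by (rule tendsto_add[OF 1 2])
  then have "((\<lambda>s. L s (v s - v s0) + L s (v s0)) \<longlongrightarrow> L s0 (v s0)) ?F" by simp
  moreover have "\<forall>\<^sub>F s in ?F. L s (v s - v s0) + L s (v s0) = L s (v s)"
    unfolding eventually_at_filter using bl
    by (simp add: linear_diff[OF bounded_linear.linear])
  ultimately show "((\<lambda>s. L s (v s)) \<longlongrightarrow> L s0 (v s0)) ?F" by (rule Lim_transform_eventually)
qed

section \<open>Integrals of compact families\<close>

text \<open>Passing to the quotient by the subspace is a contraction, so the usual norm estimate holds
there; here it is read off from Riemann sums.\<close>

lemma infdist_cspan_integral:
  fixes f :: "real \<Rightarrow> 'a::complex_banach"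
  assumes cont: "continuous_on {0..t} f"
  shows "infdist (integral {0..t} f) (cspan B) \<le> integral {0..t} (\<lambda>s. infdist (f s) (cspan B))"
proof (rule field_le_epsilon)
  fix e :: real assume "e > 0"
  then have e: "e/2 > 0" by simp
  let ?d = "\<lambda>s. infdist (f s) (cspan B)"
  have "(f has_integral integral {0..t} f) (cbox 0 t)"
    using integrable_integral[OF integrable_continuous_interval[OF cont]] by (simp only: box_real)
  from this[unfolded has_integral, rule_format, OF e]
  obtain \<gamma>1 where \<gamma>1: "gauge \<gamma>1" "\<forall>\<D>. \<D> tagged_division_of cbox 0 t \<and> \<gamma>1 fine \<D> \<longrightarrow>
      norm ((\<Sum>(x, k)\<in>\<D>. measure lborel k *\<^sub>R f x) - integral {0..t} f) < e/2" by (elim exE conjE)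
  have "(?d has_integral integral {0..t} ?d) (cbox 0 t)"
    using integrable_integral[OF integrable_continuous_interval[OF continuous_on_infdist[OF cont]]] by (simp only: box_real)
  from this[unfolded has_integral, rule_format, OF e]
  obtain \<gamma>2 where \<gamma>2: "gauge \<gamma>2" "\<forall>\<D>. \<D> tagged_division_of cbox 0 t \<and> \<gamma>2 fine \<D> \<longrightarrow>
      norm ((\<Sum>(x, k)\<in>\<D>. measure lborel k *\<^sub>R ?d x) - integral {0..t} ?d) < e/2" by (elim exE conjE)
  obtain \<D> where D: "\<D> tagged_division_of cbox 0 t" "(\<lambda>x. \<gamma>1 x \<inter> \<gamma>2 x) fine \<D>"
    using fine_division_exists[OF gauge_Int[OF \<gamma>1(1) \<gamma>2(1)]] by blast
  then have fine: "\<gamma>1 fine \<D>" "\<gamma>2 fine \<D>" by (auto simp: fine_Int)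
  let ?R = "\<Sum>(x, k)\<in>\<D>. measure lborel k *\<^sub>R f x" and ?r = "\<Sum>(x, k)\<in>\<D>. measure lborel k *\<^sub>R ?d x"
  have R: "dist (integral {0..t} f) ?R < e/2"
    using \<gamma>1(2)[rule_format, OF conjI, OF D(1) fine(1)] by (simp only: dist_norm norm_minus_commute)
  have r: "?r < integral {0..t} ?d + e/2"
    using \<gamma>2(2)[rule_format, OF conjI, OF D(1) fine(2)] unfolding real_norm_def by linarith
  have "infdist (integral {0..t} f) (cspan B) \<le> infdist ?R (cspan B) + dist (integral {0..t} f) ?R"
    by (rule infdist_triangle)
  also have "infdist ?R (cspan B) \<le> (\<Sum>z\<in>\<D>. infdist ((\<lambda>(x, k). measure lborel k *\<^sub>R f x) z) (cspan B))"
    by (rule infdist_cspan_sum) (use D in blast)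
  also have "\<dots> \<le> ?r"
    by (rule sum_mono) (auto intro!: infdist_cspan_scaleR)
  finally show "infdist (integral {0..t} f) (cspan B) \<le> integral {0..t} ?d + e"
    using R r by linarith
qed

lemma continuous_on_Max_atMost:
  fixes f :: "nat \<Rightarrow> real \<Rightarrow> real"
  assumes "\<And>n. continuous_on S (f n)"
  shows "continuous_on S (\<lambda>s. Max ((\<lambda>n. f n s) ` {..m}))"
proof (induction m)
  case 0
  then show ?case using assms by simp
next
  case (Suc m)
  have "(\<lambda>s. Max ((\<lambda>n. f n s) ` {..Suc m})) = (\<lambda>s. max (f (Suc m) s) (Max ((\<lambda>n. f n s) ` {..m})))"
    by (simp add: atMost_Suc)
  then show ?case using continuous_on_max[OF assms[of "Suc m"] Suc] by (simp only:)
qed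

text \<open>The supremum is the increasing limit of maxima of finitely many continuous functions.\<close>

lemma integral_cSUP:
  fixes f :: "nat \<Rightarrow> real \<Rightarrow> real"
  assumes cont: "\<And>n. continuous_on {0..t} (f n)"
    and bnd: "\<And>n s. s \<in> {0..t} \<Longrightarrow> \<bar>f n s\<bar> \<le> C"
  shows "(\<lambda>s. SUP n. f n s) integrable_on {0..t}"
proof -
  define \<phi> where "\<phi> m s = Max ((\<lambda>n. f n s) ` {..m})" for m s
  have int: "\<phi> m integrable_on {0..t}" for m
    unfolding \<phi>_def[abs_def]
    by (intro integrable_continuous_interval continuous_on_Max_atMost cont)
  have bd: "\<bar>\<phi> m s\<bar> \<le> C" if "s \<in> {0..t}" for m s
  proof -
    have "\<phi> m s \<in> (\<lambda>n. f n s) ` {..m}" unfolding \<phi>_def by (intro Max_in) auto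
    then show ?thesis using bnd[OF that] by auto
  qed
  have "(\<lambda>s. SUP n. f n s) integrable_on {0..t} \<and>
    (\<lambda>m. integral {0..t} (\<phi> m)) \<longlonglongrightarrow> integral {0..t} (\<lambda>s. SUP n. f n s)"
  proof (rule monotone_convergence_increasing[OF int])
    show "\<phi> m s \<le> \<phi> (Suc m) s" if "s \<in> {0..t}" for m s
      unfolding \<phi>_def by (intro Max_mono image_mono) auto
    show "(\<lambda>m. \<phi> m s) \<longlonglongrightarrow> (SUP n. f n s)" if s: "s \<in> {0..t}" for s
    proof -
      have bdd: "bdd_above (range (\<lambda>n. f n s))"
        using bnd[OF s] by (intro bdd_aboveI[of _ C]) (auto simp: abs_le_iff)
      have "bdd_above (range (\<lambda>m. \<phi> m s))"
        using bd[OF s] by (intro bdd_aboveI[of _ C]) (auto simp: abs_le_iff)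
      moreover have "incseq (\<lambda>m. \<phi> m s)"
        unfolding \<phi>_def by (intro monoI Max_mono image_mono) auto
      ultimately have "(\<lambda>m. \<phi> m s) \<longlonglongrightarrow> (SUP m. \<phi> m s)" by (rule LIMSEQ_incseq_SUP)
      moreover have "(SUP m. \<phi> m s) = (SUP n. f n s)"
      proof (rule antisym)
        show "(SUP m. \<phi> m s) \<le> (SUP n. f n s)"
          unfolding \<phi>_def using bdd
          by (intro cSUP_least Max.boundedI) (auto intro!: cSUP_upper)
        show "(SUP n. f n s) \<le> (SUP m. \<phi> m s)"
        proof (rule cSUP_least)
          fix n
          have "f n s \<le> \<phi> n s" unfolding \<phi>_def by (intro Max_ge) auto
          also have "\<dots> \<le> (SUP m. \<phi> m s)"
            using \<open>bdd_above (range (\<lambda>m. \<phi> m s))\<close> by (intro cSUP_upper) auto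
          finally show "f n s \<le> (SUP m. \<phi> m s)" .
        qed simp
      qed
      ultimately show ?thesis by simp
    qed
    show "bounded (range (\<lambda>m. integral {0..t} (\<phi> m)))"
    proof -
      have "norm (integral {0..t} (\<phi> m)) \<le> integral {0..t} (\<lambda>_. C)" for m
        using bd by (intro integral_norm_bound_integral int integrable_const_ivl) auto
      then show ?thesis unfolding bounded_iff by blast
    qed
  qed
  then show ?thesis by blast
qed

text \<open>The compact sets may vary wildly with \<open>s\<close>, so a single finite-dimensional approximation need
not work for all \<open>s\<close>. However, let \<open>F k\<close> be the spans of initial segments of a countable set that is dense
enough. The functions \<open>d k s = (SUP n. infdist (g n s) (F k))\<close> decrease to \<open>0\<close> for each \<open>s\<close> by
compactness, hence their integrals tend to \<open>0\<close> by monotone convergence. So all the integrals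
lie uniformly close to one finite-dimensional space.\<close>

lemma integral_of_compact_family:
  fixes g :: "nat \<Rightarrow> real \<Rightarrow> 'a::complex_banach"
  assumes cont: "\<And>n. continuous_on {0..t} (g n)"
    and bnd: "\<And>n s. s \<in> {0..t} \<Longrightarrow> norm (g n s) \<le> C"
    and cpt: "\<And>s. s \<in> {0..t} \<Longrightarrow> \<exists>S. compact S \<and> range (\<lambda>n. g n s) \<subseteq> S"
    and t: "0 \<le> t"
  shows "has_convergent_subseq (\<lambda>n. integral {0..t} (g n))"
proof (rule ccontr)
  assume nconv: "\<not> ?thesis"
  obtain Q where Q: "countable Q" "Q \<subseteq> {0..t}" "{0..t} \<subseteq> closure Q"
    using separable[of "{0..t}"] by blast
  have "Q \<noteq> {}" using Q(3) t by auto
  define q where "q = from_nat_into Q"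
  have q: "range q = Q" unfolding q_def by (rule range_from_nat_into[OF \<open>Q \<noteq> {}\<close> Q(1)])
  \<comment> \<open>the values of all \<open>g n\<close> at a countable dense set of times\<close>
  define p where "p j = (case prod_decode j of (n, m) \<Rightarrow> g n (q m))" for j
  define F where "F k = cspan (p ` {..<k})" for k :: nat
  have F_mono: "F k \<subseteq> F k'" if "k \<le> k'" for k k'
    unfolding F_def using that by (intro complex_vector.span_mono image_mono) auto
  have F_ne: "F k \<noteq> {}" for k unfolding F_def using complex_vector.span_zero by blast
  define f where "f k n s = infdist (g n s) (F k)" for k n s
  define d where "d k s = (SUP n. f k n s)" for k s
  have f_bnd: "0 \<le> f k n s" "f k n s \<le> C" if "s \<in> {0..t}" for k n s
    using infdist_cspan_le_norm[of "g n s"] bnd[OF that, of n]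
    by (auto simp: f_def F_def infdist_nonneg intro: order_trans)
  have f_cont: "continuous_on {0..t} (f k n)" for k n
    unfolding f_def[abs_def] by (intro continuous_on_infdist cont)
  have d_int: "d k integrable_on {0..t}" for k
    unfolding d_def[abs_def]
    by (rule integral_cSUP[where C = C]) (use f_cont f_bnd in \<open>auto simp: abs_le_iff intro: order_trans[of _ 0]\<close>)
  have bdd: "bdd_above (range (\<lambda>n. f k n s))" if "s \<in> {0..t}" for k s
    using f_bnd[OF that] by (intro bdd_aboveI[of _ C]) auto
  have f_le_d: "f k n s \<le> d k s" if "s \<in> {0..t}" for k n s
    unfolding d_def using bdd[OF that] by (intro cSUP_upper) auto
  have d_bnd: "0 \<le> d k s" "d k s \<le> C" if "s \<in> {0..t}" for k s
  proof -
    show "0 \<le> d k s" using f_bnd(1)[OF that, of k 0] f_le_d[OF that, of k 0] by linarith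
    show "d k s \<le> C" unfolding d_def using f_bnd(2)[OF that] by (intro cSUP_least) auto
  qed
  have d_dec: "d k' s \<le> d k s" if "s \<in> {0..t}" "k \<le> k'" for k k' s
    unfolding d_def
  proof (rule cSUP_least)
    fix n
    have "f k' n s \<le> f k n s" unfolding f_def by (intro infdist_mono F_mono that F_ne)
    then show "f k' n s \<le> (SUP n. f k n s)" using f_le_d[OF that(1), of k n] by (simp add: d_def)
  qed simp
  have d_lim: "(\<lambda>k. d k s) \<longlonglongrightarrow> 0" if s: "s \<in> {0..t}" for s
  proof (rule ccontr)
    assume "\<not> ?thesis"
    then obtain e where e: "e > 0" "\<forall>N. \<exists>k\<ge>N. e \<le> d k s"
      using d_bnd[OF s] by (auto simp: LIMSEQ_iff not_less)
    have "\<exists>n. e/2 < f k n s" for k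
    proof -
      obtain k' where "k' \<ge> k" "e \<le> d k' s" using e(2) by blast
      then have "e/2 < d k s" using d_dec[OF s] e(1) by (smt (verit) field_sum_of_halves)
      then show ?thesis unfolding d_def using less_cSUP_iff[OF UNIV_not_empty bdd[OF s]] by blast
    qed
    then obtain \<nu> where \<nu>: "\<And>k. e/2 < f k (\<nu> k) s" by metis
    obtain S where S: "compact S" "range (\<lambda>n. g n s) \<subseteq> S" using cpt[OF s] by blast
    have "\<forall>k. g (\<nu> k) s \<in> S" using S(2) by blast
    then obtain l r where lr: "strict_mono r" "((\<lambda>k. g (\<nu> k) s) \<circ> r) \<longlonglongrightarrow> l"
      using S(1) unfolding compact_eq_seq_compact_metric seq_compact_def by metis
    have e8: "e/8 > 0" using e by simp
    obtain N where N: "\<And>k. k \<ge> N \<Longrightarrow> norm (g (\<nu> (r k)) s - l) < e/8"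
      using lr(2) e8 unfolding LIMSEQ_iff o_def by meson
    obtain \<delta> where \<delta>: "\<delta> > 0" "\<And>s'. s' \<in> {0..t} \<Longrightarrow> dist s' s < \<delta> \<Longrightarrow>
        dist (g (\<nu> (r N)) s') (g (\<nu> (r N)) s) < e/8"
      using cont[of "\<nu> (r N)"] s e8 unfolding continuous_on_iff by meson
    obtain s' where s': "s' \<in> Q" "dist s' s < \<delta>"
      using closure_approachable[of s Q] Q(3) s \<delta>(1) by auto
    obtain m where m: "s' = q m" using s' q by blast
    define j where "j = prod_encode (\<nu> (r N), m)"
    have pj: "p j = g (\<nu> (r N)) s'" by (simp add: p_def j_def m)
    define k where "k = max N (Suc j)"
    have "p j \<in> F (r k)"
    proof -
      have "j < r k" using seq_suble[OF lr(1), of k] by (simp add: k_def)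
      then show ?thesis unfolding F_def by (intro complex_vector.span_base) auto
    qed
    then have "f (r k) (\<nu> (r k)) s \<le> dist (g (\<nu> (r k)) s) (p j)" unfolding f_def by (rule infdist_le)
    also have "\<dots> < e/2"
    proof -
      have "norm (g (\<nu> (r k)) s - l) < e/8" "norm (g (\<nu> (r N)) s - l) < e/8"
        using N by (auto simp: k_def)
      moreover have "dist (p j) (g (\<nu> (r N)) s) < e/8" using \<delta>(2)[of s'] s' Q(2) pj by auto
      ultimately have "dist (g (\<nu> (r k)) s) l < e/8" "dist l (g (\<nu> (r N)) s) < e/8"
        "dist (g (\<nu> (r N)) s) (p j) < e/8" by (auto simp: dist_norm norm_minus_commute)
      then show ?thesis
        using dist_triangle[of "g (\<nu> (r k)) s" "p j" l]
          dist_triangle[of l "p j" "g (\<nu> (r N)) s"] e(1) by linarith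
    qed
    finally show False using \<nu>[of "r k"] by simp
  qed
  have "(\<lambda>_::real. 0::real) integrable_on {0..t} \<and> (\<lambda>k. integral {0..t} (d k)) \<longlonglongrightarrow> integral {0..t} (\<lambda>_::real. 0::real)"
  proof (rule monotone_convergence_decreasing[OF d_int])
    show "bounded (range (\<lambda>m. integral {0..t} (d m)))"
    proof -
      have "norm (integral {0..t} (d m)) \<le> integral {0..t} (\<lambda>_. C)" for m
        using d_bnd by (intro integral_norm_bound_integral d_int integrable_const_ivl) auto
      then show ?thesis unfolding bounded_iff by blast
    qed
  qed (use d_dec d_lim in auto)
  then have I0: "(\<lambda>k. integral {0..t} (d k)) \<longlonglongrightarrow> 0" by simp
  define G where "G n = integral {0..t} (g n)" for n
  have near: "infdist (G n) (F k) \<le> integral {0..t} (d k)" for n k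
  proof -
    have "infdist (G n) (F k) \<le> integral {0..t} (f k n)"
      unfolding G_def F_def f_def by (rule infdist_cspan_integral[OF cont])
    also have "\<dots> \<le> integral {0..t} (d k)"
      by (intro integral_le integrable_continuous_interval f_cont d_int) (rule f_le_d)
    finally show ?thesis .
  qed
  have "\<not> has_convergent_subseq G" using nconv by (simp add: G_def[abs_def])
  then obtain e and r :: "nat \<Rightarrow> nat"
    where er: "e > 0" "strict_mono r" "\<And>j k. j < k \<Longrightarrow> e \<le> dist (G (r j)) (G (r k))"
    by (rule separated_subseq) blast
  have e4: "e/4 > 0" using er by simp
  obtain k where k: "integral {0..t} (d k) < e/4"
    using order_tendstoD(2)[OF I0 e4] by (auto simp: eventually_sequentially)
  have "\<exists>h\<in>F k. norm (G n - h) < e/4" for n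
  proof -
    have "0 < e/4 - integral {0..t} (d k)" using k by simp
    then obtain h where "h \<in> F k" "norm (G n - h) < infdist (G n) (F k) + (e/4 - integral {0..t} (d k))"
      unfolding F_def by (rule infdist_cspan_approx)
    then show ?thesis using near[of n k] by force
  qed
  then obtain h where h: "\<And>n. h n \<in> F k" "\<And>n. norm (G n - h n) < e/4" by metis
  have Gb: "norm (G n) \<le> integral {0..t} (\<lambda>_. C)" for n
    unfolding G_def using bnd
    by (intro integral_norm_bound_integral integrable_continuous_interval cont) auto
  have "norm (h (r n)) \<le> integral {0..t} (\<lambda>_. C) + e/4" for n
    using h(2)[of "r n"] Gb[of "r n"] norm_triangle_ineq2[of "h (r n)" "G (r n)"]
    by (simp add: norm_minus_commute)
  then have "bounded (range (\<lambda>n. h (r n)))" unfolding bounded_iff by blast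
  then obtain r' :: "nat \<Rightarrow> nat" and l where r': "strict_mono r'" "(\<lambda>n. h (r (r' n))) \<longlonglongrightarrow> l"
    using cspan_bounded_seq[of "p ` {..<k}" "\<lambda>n. h (r n)"] h(1) unfolding F_def by auto
  obtain N where N: "\<And>n. n \<ge> N \<Longrightarrow> norm (h (r (r' n)) - l) < e/4"
    using r'(2) e4 unfolding LIMSEQ_iff by meson
  have "r' N < r' (Suc N)" using r'(1) by (simp add: strict_mono_less)
  then have "e \<le> dist (G (r (r' N))) (G (r (r' (Suc N))))" by (rule er(3))
  moreover have "norm (h (r (r' N)) - l) < e/4" "norm (h (r (r' (Suc N))) - l) < e/4" using N by auto
  moreover have "dist (G (r (r' N))) (G (r (r' (Suc N)))) \<le>
     norm (G (r (r' N)) - h (r (r' N))) + norm (h (r (r' N)) - l)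
     + norm (h (r (r' (Suc N))) - l) + norm (G (r (r' (Suc N))) - h (r (r' (Suc N))))"
    using dist_triangle[of "G (r (r' N))" "G (r (r' (Suc N)))" l]
      dist_triangle[of "G (r (r' N))" l "h (r (r' N))"]
      dist_triangle2[of l "G (r (r' (Suc N)))" "h (r (r' (Suc N)))"]
    unfolding dist_norm by (simp add: norm_minus_commute)
  ultimately show False using h(2)[of "r (r' N)"] h(2)[of "r (r' (Suc N))"] by linarith
qed

section \<open>Gliding humps\<close>

lemma summable_steps_limit:
  fixes x :: "nat \<Rightarrow> 'a::banach"
  assumes step: "\<And>n. norm (x (Suc n) - x n) \<le> e n" and "summable e"
  obtains l where "x \<longlonglongrightarrow> l" "\<And>n. norm (l - x n) \<le> (\<Sum>k. e (k + n))"
proof -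
  define d where "d n = x (Suc n) - x n" for n
  have sn: "summable (\<lambda>n. norm (d n))"
    using step by (intro summable_comparison_test[OF _ \<open>summable e\<close>]) (auto simp: d_def)
  then have sd: "summable d" by (rule summable_norm_cancel)
  have xd: "x n = x 0 + sum d {..<n}" for n
    by (simp add: d_def sum_lessThan_telescope)
  have "(\<lambda>n. x 0 + sum d {..<n}) \<longlonglongrightarrow> x 0 + suminf d"
    by (rule tendsto_add[OF tendsto_const summable_LIMSEQ[OF sd]])
  then have lim: "x \<longlonglongrightarrow> x 0 + suminf d" by (simp only: xd[symmetric])
  moreover have "norm (x 0 + suminf d - x n) \<le> (\<Sum>k. e (k + n))" for n
  proof -
    have "x 0 + suminf d - x n = (\<Sum>k. d (k + n))"
      using suminf_split_initial_segment[OF sd, of n] xd[of n] by simp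
    also have "norm \<dots> \<le> (\<Sum>k. norm (d (k + n)))"
      by (rule summable_norm) (rule summable_ignore_initial_segment[OF sn])
    also have "\<dots> \<le> (\<Sum>k. e (k + n))"
      by (rule suminf_le[OF _ summable_ignore_initial_segment[OF sn]
            summable_ignore_initial_segment[OF \<open>summable e\<close>]]) (use step in \<open>simp add: d_def\<close>)
    finally show ?thesis .
  qed
  ultimately show thesis by (rule that)
qed

text \<open>Suppose every pair fails. By Ramsey's theorem there are a single reason and an increasing
sequence \<open>r\<close> all of whose pairs fail for it. The reason cannot be \<open>Q\<close>, which holds for large \<open>n\<close>. If it is
a drop of \<open>\<parallel>L i u\<parallel>\<close> by \<open>\<eta>\<close>, then averaging \<open>L i (u + \<epsilon> (v (r l) - v (r (l+1))))\<close> over \<open>l < p\<close> telescopes to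
\<open>L i u\<close> up to an error of order \<open>1/p\<close>, which is absurd for large \<open>p\<close>.\<close>

lemma perturbation_step:
  fixes L :: "'i \<Rightarrow> 'a::real_normed_vector \<Rightarrow> 'b::real_normed_vector" and v :: "nat \<Rightarrow> 'a"
  assumes fin: "finite I" and bl: "\<And>i. i \<in> I \<Longrightarrow> bounded_linear (L i)"
    and v: "\<And>n. norm (v n) \<le> 1"
    and Q: "\<And>m. \<forall>\<^sub>F n in sequentially. Q m n"
    and "\<eta> > 0" and "0 \<le> \<epsilon>"
  shows "\<exists>m n. Q m n \<and> (\<forall>i\<in>I. norm (L i u) - \<eta> \<le> norm (L i (u + \<epsilon> *\<^sub>R (v m - v n))))"
proof (rule ccontr)
  assume "\<not> ?thesis"
  then have no: "\<not> Q m n \<or> (\<exists>i\<in>I. norm (L i (u + \<epsilon> *\<^sub>R (v m - v n))) < norm (L i u) - \<eta>)" for m n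
    by (meson not_le)
  \<comment> \<open>\<open>None\<close> stands for the failure of \<open>Q\<close>, \<open>Some i\<close> for a drop of the norm at \<open>i\<close>\<close>
  define bad where "bad j m n = (case j of None \<Rightarrow> \<not> Q m n
    | Some i \<Rightarrow> norm (L i (u + \<epsilon> *\<^sub>R (v m - v n))) < norm (L i u) - \<eta>)" for j m n
  have f: "finite (insert None (Some ` I))" using fin by simp
  have cover: "\<exists>j\<in>insert None (Some ` I). bad j m n" for m n
    using no[of m n] by (auto simp: bad_def)
  have "\<exists>j (r :: nat \<Rightarrow> nat). j \<in> insert None (Some ` I) \<and> strict_mono r \<and> (\<forall>k l. k < l \<longrightarrow> bad j (r k) (r l))"
    by (rule Ramsey_cover[where R = bad, OF f cover]) blast
  then obtain j and r :: "nat \<Rightarrow> nat"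
    where j: "j \<in> insert None (Some ` I)" and r: "strict_mono r" "\<And>k l. k < l \<Longrightarrow> bad j (r k) (r l)"
    by auto
  show False
  proof (cases j)
    case None
    obtain N where N: "\<And>n. n \<ge> N \<Longrightarrow> Q (r 0) n"
      using Q[of "r 0"] by (auto simp: eventually_sequentially)
    have "Suc N \<le> r (Suc N)" by (rule seq_suble[OF r(1)])
    then have "Q (r 0) (r (Suc N))" using N by simp
    then show False using r(2)[of 0 "Suc N"] None by (simp add: bad_def)
  next
    case (Some i)
    then have "i \<in> I" using j by auto
    then interpret bounded_linear "L i" by (rule bl)
    obtain K where K: "\<And>x. norm (L i x) \<le> norm x * K" "K > 0" using pos_bounded by blast
    have "real p * \<eta> \<le> 2 * \<epsilon> * K" for p :: nat
    proof -
      let ?s = "\<lambda>l. L i (u + \<epsilon> *\<^sub>R (v (r l) - v (r (Suc l))))"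
      have "(\<Sum>l<p. L i (v (r l)) - L i (v (r (Suc l)))) = L i (v (r 0)) - L i (v (r p))"
        using sum_lessThan_telescope'[of "\<lambda>l. L i (v (r l))" p] by simp
      then have "real p *\<^sub>R L i u = (\<Sum>l<p. ?s l) - \<epsilon> *\<^sub>R (L i (v (r 0)) - L i (v (r p)))"
        by (simp add: add scaleR diff sum.distrib scaleR_sum_right[symmetric] sum_constant_scaleR)
      also have "\<dots> = (\<Sum>l<p. ?s l) - \<epsilon> *\<^sub>R L i (v (r 0) - v (r p))" by (simp add: diff)
      also have "norm \<dots> \<le> norm (\<Sum>l<p. ?s l) + norm (\<epsilon> *\<^sub>R L i (v (r 0) - v (r p)))"
        by (rule norm_triangle_ineq4)
      also have "norm (\<epsilon> *\<^sub>R L i (v (r 0) - v (r p))) = \<epsilon> * norm (L i (v (r 0) - v (r p)))"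
        using \<open>0 \<le> \<epsilon>\<close> by simp
      also have "norm (\<Sum>l<p. ?s l) \<le> (\<Sum>l<p. norm (?s l))" by (rule norm_sum)
      also have "(\<Sum>l<p. norm (?s l)) \<le> (\<Sum>l<p. norm (L i u) - \<eta>)"
        using r(2) Some by (intro sum_mono less_imp_le) (auto simp: bad_def)
      also have "\<epsilon> * norm (L i (v (r 0) - v (r p))) \<le> \<epsilon> * (2 * K)"
      proof (intro mult_left_mono \<open>0 \<le> \<epsilon>\<close>)
        have "norm (L i (v (r 0) - v (r p))) \<le> norm (v (r 0) - v (r p)) * K" by (rule K)
        also have "\<dots> \<le> 2 * K"
          using norm_triangle_ineq4[of "v (r 0)" "v (r p)"] v[of "r 0"] v[of "r p"] K(2)
          by (intro mult_right_mono) auto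
        finally show "norm (L i (v (r 0) - v (r p))) \<le> 2 * K" .
      qed
      finally show ?thesis by (simp add: algebra_simps)
    qed
    moreover obtain p :: nat where "2 * \<epsilon> * K < real p * \<eta>"
      using \<open>\<eta> > 0\<close> reals_Archimedean3 by blast
    ultimately show False by (meson not_le)
  qed
qed

lemma finite_pos_lower_bound:
  fixes S :: "real set"
  assumes "finite S" "\<And>x. x \<in> S \<Longrightarrow> 0 < x"
  shows "\<exists>\<eta>>0. \<forall>x\<in>S. \<eta> < x"
proof -
  define \<mu> where "\<mu> = Min (insert 1 S)"
  have "\<mu> \<in> insert 1 S" unfolding \<mu>_def using assms(1) by (intro Min_in) auto
  then have "\<mu> > 0" using assms(2) by auto
  moreover have "\<mu> / 2 < x" if "x \<in> S" for x
  proof -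
    have "\<mu> \<le> x" unfolding \<mu>_def using assms(1) that by (intro Min_le) auto
    then show ?thesis using \<open>\<mu> > 0\<close> by linarith
  qed
  ultimately show ?thesis by (intro exI[of _ "\<mu> / 2"]) auto
qed

text \<open>The partial sums keep the strict inequalities \<open>c/4 \<epsilon>\<^sub>j w\<^sub>i < \<parallel>L i u\<parallel>\<close> already achieved for
\<open>j < k\<close>: these are finitely many, so they leave room for a small loss \<open>\<eta>\<close> in the next step. The new
inequality holds because \<open>\<parallel>L i (u + z)\<parallel>\<close> is at least \<open>\<parallel>L i u\<parallel> - \<eta>\<close> and at least
\<open>\<parallel>L i z\<parallel> - \<parallel>L i u\<parallel>\<close>, hence at least half of \<open>\<parallel>L i z\<parallel> - \<eta>\<close>.\<close>

theorem gliding_hump: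
  fixes L :: "'i \<Rightarrow> 'a::banach \<Rightarrow> 'b::real_normed_vector" and G :: "nat \<Rightarrow> 'i set"
  assumes bl: "\<And>k i. i \<in> G k \<Longrightarrow> bounded_linear (L i)"
    and fin: "\<And>k. finite (G k)"
    and w: "\<And>k i. i \<in> G k \<Longrightarrow> 0 < w i" and c: "0 < c"
    and sep: "\<And>k. \<exists>v::nat \<Rightarrow> 'a. (\<forall>n. norm (v n) \<le> 1) \<and>
      (\<forall>m. \<forall>\<^sub>F n in sequentially. \<forall>i\<in>G k. c * w i \<le> norm (L i (v m - v n)))"
    and \<epsilon>: "\<And>k. 0 < \<epsilon> k" "summable \<epsilon>"
  obtains x where "norm (x - u\<^sub>0) \<le> 2 * suminf \<epsilon>"
    "\<And>k i. i \<in> G k \<Longrightarrow> c / 4 * \<epsilon> k * w i \<le> norm (L i x)"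
proof -
  define Inv where "Inv k u \<longleftrightarrow> (\<forall>j<k. \<forall>i\<in>G j. c / 4 * \<epsilon> j * w i < norm (L i u))" for k u
  have step: "\<exists>u'. Inv (Suc k) u' \<and> norm (u' - u) \<le> 2 * \<epsilon> k" if u: "Inv k u" for k u
  proof -
    define S where "S = (\<Union>j<k. (\<lambda>i. norm (L i u) - c / 4 * \<epsilon> j * w i) ` G j) \<union> (\<lambda>i. c * \<epsilon> k * w i / 4) ` G k"
    have "finite S" unfolding S_def using fin by auto
    moreover have "0 < s" if "s \<in> S" for s
      using that u \<epsilon>(1) w c unfolding S_def Inv_def by auto
    ultimately have "\<exists>\<eta>>0. \<forall>x\<in>S. \<eta> < x" by (rule finite_pos_lower_bound)
    then obtain \<eta> where \<eta>: "0 < \<eta>" "\<And>s. s \<in> S \<Longrightarrow> \<eta> < s" by blast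
    obtain v :: "nat \<Rightarrow> 'a" where v: "\<And>n. norm (v n) \<le> 1"
      "\<And>m. \<forall>\<^sub>F n in sequentially. \<forall>i\<in>G k. c * w i \<le> norm (L i (v m - v n))"
      using sep[of k] by blast
    have "finite (\<Union>j\<le>k. G j)" using fin by auto
    moreover have "bounded_linear (L i)" if "i \<in> (\<Union>j\<le>k. G j)" for i using that bl by auto
    ultimately have "\<exists>m n. (\<forall>i\<in>G k. c * w i \<le> norm (L i (v m - v n))) \<and>
      (\<forall>i\<in>\<Union>j\<le>k. G j. norm (L i u) - \<eta> \<le> norm (L i (u + \<epsilon> k *\<^sub>R (v m - v n))))"
      by (rule perturbation_step[OF _ _ v(1) v(2) \<eta>(1) less_imp_le[OF \<epsilon>(1)]])
    then obtain m n where mn: "\<forall>i\<in>G k. c * w i \<le> norm (L i (v m - v n))"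
      "\<And>i. i \<in> (\<Union>j\<le>k. G j) \<Longrightarrow> norm (L i u) - \<eta> \<le> norm (L i (u + \<epsilon> k *\<^sub>R (v m - v n)))"
      by blast
    define u' where "u' = u + \<epsilon> k *\<^sub>R (v m - v n)"
    have "norm (u' - u) \<le> 2 * \<epsilon> k"
    proof -
      have "norm (v m - v n) \<le> 2"
        using norm_triangle_ineq4[of "v m" "v n"] v(1)[of m] v(1)[of n] by linarith
      then show ?thesis using \<epsilon>(1)[of k] by (simp add: u'_def)
    qed
    moreover have "c / 4 * \<epsilon> j * w i < norm (L i u')" if "j < Suc k" "i \<in> G j" for i j
    proof (cases "j = k")
      case False
      then have "norm (L i u) - c / 4 * \<epsilon> j * w i \<in> S" using that unfolding S_def by auto
      then have "\<eta> < norm (L i u) - c / 4 * \<epsilon> j * w i" by (rule \<eta>(2))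
      moreover have "norm (L i u) - \<eta> \<le> norm (L i u')"
        using mn(2)[of i] that unfolding u'_def by fastforce
      ultimately show ?thesis by linarith
    next
      case True
      then have i: "i \<in> G k" using that by simp
      then interpret bounded_linear "L i" by (rule bl)
      have "\<eta> < c * \<epsilon> k * w i / 4" using i unfolding S_def by (intro \<eta>(2)[unfolded S_def]) blast
      moreover have "norm (L i u) - \<eta> \<le> norm (L i u')"
        using mn(2)[of i] i unfolding u'_def by fastforce
      moreover have "\<epsilon> k * (c * w i) \<le> \<epsilon> k * norm (L i (v m - v n))"
        using mn(1) i \<epsilon>(1)[of k] by (intro mult_left_mono) auto
      moreover have "\<epsilon> k * norm (L i (v m - v n)) \<le> norm (L i u') + norm (L i u)"
      proof -
        have "L i (\<epsilon> k *\<^sub>R (v m - v n)) = L i u' - L i u" by (simp add: u'_def add)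
        then have "\<epsilon> k *\<^sub>R L i (v m - v n) = L i u' - L i u" by (simp add: scaleR)
        then show ?thesis
          using norm_triangle_ineq4[of "L i u'" "L i u"] \<epsilon>(1)[of k]
          by (metis abs_of_pos norm_scaleR)
      qed
      moreover have "0 < c * \<epsilon> k * w i" using c \<epsilon>(1)[of k] w[OF i] by simp
      ultimately show ?thesis using True by (simp add: algebra_simps)
    qed
    ultimately show ?thesis unfolding Inv_def by blast
  qed
  have "\<exists>u. \<forall>n. (Inv n (u n) \<and> (n = 0 \<longrightarrow> u n = u\<^sub>0)) \<and> norm (u (Suc n) - u n) \<le> 2 * \<epsilon> n"
    by (rule dependent_nat_choice) (use step in \<open>auto simp: Inv_def\<close>)
  then obtain u where u: "\<And>n. Inv n (u n)" "u 0 = u\<^sub>0" "\<And>n. norm (u (Suc n) - u n) \<le> 2 * \<epsilon> n"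
    by blast
  obtain x where x: "u \<longlonglongrightarrow> x" "\<And>n. norm (x - u n) \<le> (\<Sum>k. 2 * \<epsilon> (k + n))"
    by (rule summable_steps_limit[where x = u and e = "\<lambda>n. 2 * \<epsilon> n", OF u(3)]) (use \<epsilon>(2) in \<open>auto intro: summable_mult\<close>)
  show thesis
  proof (rule that[of x])
    show "norm (x - u\<^sub>0) \<le> 2 * suminf \<epsilon>"
      using x(2)[of 0] suminf_mult[OF \<epsilon>(2), of 2] by (simp add: u(2))
    fix k i assume i: "i \<in> G k"
    then interpret bounded_linear "L i" by (rule bl)
    have "(\<lambda>n. norm (L i (u n))) \<longlonglongrightarrow> norm (L i x)" by (intro tendsto_norm tendsto x(1))
    moreover have "c / 4 * \<epsilon> k * w i \<le> norm (L i (u n))" if "n \<ge> Suc k" for n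
      using u(1)[of n] i that unfolding Inv_def by (simp add: less_imp_le)
    ultimately show "c / 4 * \<epsilon> k * w i \<le> norm (L i x)" by (intro Lim_bounded2) auto
  qed
qed

section \<open>Semigroups and their generators\<close>

lemma average_tendsto:
  fixes f :: "real \<Rightarrow> 'a::banach"
  assumes cont: "continuous_on {0..} f" and t: "0 \<le> t"
  shows "((\<lambda>h. (1/h) *\<^sub>R (integral {0..t + h} f - integral {0..t} f)) \<longlongrightarrow> f t) (at_right 0)"
proof (rule tendstoI)
  fix e :: real assume "e > 0"
  then have e: "e/2 > 0" by simp
  have "t \<in> {0..}" using t by simp
  then obtain \<delta> where \<delta>: "\<delta> > 0" "\<forall>s\<in>{0..}. dist s t < \<delta> \<longrightarrow> dist (f s) (f t) < e/2"
    using cont e unfolding continuous_on_iff by blast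
  have "dist ((1/h) *\<^sub>R (integral {0..t + h} f - integral {0..t} f)) (f t) < e" if h: "0 < h" "h < \<delta>" for h
  proof -
    have int: "f integrable_on {a..b}" if "0 \<le> a" for a b
      by (rule integrable_continuous_interval) (rule continuous_on_subset[OF cont], use that in auto)
    have "integral {0..t} f + integral {t..t + h} f = integral {0..t + h} f"
      by (rule Henstock_Kurzweil_Integration.integral_combine) (use t h int in auto)
    moreover have "integral {t..t + h} (\<lambda>s. f s - f t) = integral {t..t + h} f - h *\<^sub>R f t"
      using integral_diff[OF int[OF t, of "t + h"] integrable_const_ivl[of "f t" t "t + h"]] h by simp
    ultimately have "integral {0..t + h} f - integral {0..t} f - h *\<^sub>R f t = integral {t..t + h} (\<lambda>s. f s - f t)"
      by (metis add_diff_cancel_left')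
    also have "norm \<dots> \<le> e/2 * ((t + h) - t)"
    proof (rule integral_bound)
      show "continuous_on {t..t + h} (\<lambda>s. f s - f t)"
        by (intro continuous_on_diff continuous_on_const) (rule continuous_on_subset[OF cont], use t in auto)
      show "norm (f s - f t) \<le> e/2" if "s \<in> {t..t + h}" for s
      proof -
        have "dist (f s) (f t) < e/2" using \<delta>(2) that t h by (auto simp: dist_real_def)
        then show ?thesis by (simp add: dist_norm)
      qed
    qed (use h in auto)
    finally have b: "norm (integral {0..t + h} f - integral {0..t} f - h *\<^sub>R f t) \<le> e/2 * h" by simp
    have "(1/h) *\<^sub>R (integral {0..t + h} f - integral {0..t} f) - f t
        = (1/h) *\<^sub>R (integral {0..t + h} f - integral {0..t} f - h *\<^sub>R f t)"
      using h by (simp add: scaleR_diff_right)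
    then have "dist ((1/h) *\<^sub>R (integral {0..t + h} f - integral {0..t} f)) (f t)
        = (1/h) * norm (integral {0..t + h} f - integral {0..t} f - h *\<^sub>R f t)"
      using h by (simp add: dist_norm)
    also have "\<dots> \<le> (1/h) * (e/2 * h)" using b h by (intro mult_left_mono) auto
    also have "\<dots> < e" using h \<open>e > 0\<close> by simp
    finally show ?thesis .
  qed
  then show "\<forall>\<^sub>F h in at_right 0. dist ((1/h) *\<^sub>R (integral {0..t + h} f - integral {0..t} f)) (f t) < e"
    unfolding eventually_at_right_field using \<delta>(1) by blast
qed

text \<open>The rescaled semigroup is generated by \<open>A - \<mu>\<close>, so that statements about \<open>\<mu> - A\<close> reduce to \<open>\<mu> = 0\<close>.\<close>

definition rescale :: "complex \<Rightarrow> (real \<Rightarrow> 'a::complex_normed_vector \<Rightarrow> 'a) \<Rightarrow> real \<Rightarrow> 'a \<Rightarrow> 'a" where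
  "rescale \<mu> T t x = exp (- \<mu> * complex_of_real t) *\<^sub>C T t x"

lemma exp_quotient_tendsto:
  "((\<lambda>h. (exp (- \<mu> * complex_of_real h) - 1) / complex_of_real h) \<longlongrightarrow> - \<mu>) (at_right 0)"
proof -
  have "((\<lambda>z. exp (- \<mu> * z)) has_field_derivative - \<mu>) (at 0)"
    by (auto intro!: derivative_eq_intros)
  then have "((\<lambda>z. (exp (- \<mu> * z) - 1) / z) \<longlongrightarrow> - \<mu>) (at 0)"
    by (simp add: has_field_derivative_iff)
  moreover have "filterlim complex_of_real (at 0) (at_right 0)"
    unfolding filterlim_at by (auto intro!: tendsto_eq_intros simp: eventually_at_right_field intro: exI[of _ 1])
  ultimately show ?thesis by (rule filterlim_compose)
qed

lemma rescale_quotient_tendsto: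
  fixes T :: "real \<Rightarrow> 'a::complex_normed_vector \<Rightarrow> 'a"
  assumes "((\<lambda>h. (1/h) *\<^sub>R (T h x - x)) \<longlongrightarrow> y) (at_right 0)"
  shows "((\<lambda>h. (1/h) *\<^sub>R (rescale \<mu> T h x - x)) \<longlongrightarrow> y - \<mu> *\<^sub>C x) (at_right 0)"
proof -
  have "((\<lambda>h. exp (- \<mu> * complex_of_real h)) \<longlongrightarrow> exp (- \<mu> * complex_of_real 0)) (at_right 0)"
    by (intro tendsto_intros)
  then have e: "((\<lambda>h. exp (- \<mu> * complex_of_real h)) \<longlongrightarrow> 1) (at_right 0)" by simp
  have "((\<lambda>h. exp (- \<mu> * complex_of_real h) *\<^sub>C ((1/h) *\<^sub>R (T h x - x))
        + ((exp (- \<mu> * complex_of_real h) - 1) / complex_of_real h) *\<^sub>C x)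
      \<longlongrightarrow> 1 *\<^sub>C y + (- \<mu>) *\<^sub>C x) (at_right 0)"
    by (intro tendsto_add scaleC.tendsto tendsto_const e exp_quotient_tendsto assms)
  moreover have "exp (- \<mu> * complex_of_real h) *\<^sub>C ((1/h) *\<^sub>R (T h x - x))
        + ((exp (- \<mu> * complex_of_real h) - 1) / complex_of_real h) *\<^sub>C x
      = (1/h) *\<^sub>R (rescale \<mu> T h x - x)" for h
  proof -
    have "((exp (- \<mu> * complex_of_real h) - 1) / complex_of_real h) *\<^sub>C x
        = (1/h) *\<^sub>R ((exp (- \<mu> * complex_of_real h) - 1) *\<^sub>C x)"
      by (simp add: scaleC_of_real[symmetric] scaleC_scaleC del: scaleC_of_real)
    then show ?thesis
      by (simp add: rescale_def scaleC.scaleR_right scaleC.diff_right scaleC.diff_left scaleC_one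
          scaleR_diff_right)
  qed
  ultimately show ?thesis by (simp add: scaleC_one scaleC.minus_left)
qed

lemma rescale_inverse: "rescale (- \<mu>) (rescale \<mu> T) = T"
  by (rule ext)+ (simp add: rescale_def scaleC_scaleC exp_add[symmetric] scaleC_one)

lemma rescale_quotient_tendsto_iff:
  fixes T :: "real \<Rightarrow> 'a::complex_normed_vector \<Rightarrow> 'a"
  shows "((\<lambda>h. (1/h) *\<^sub>R (rescale \<mu> T h x - x)) \<longlongrightarrow> y) (at_right 0) \<longleftrightarrow>
    ((\<lambda>h. (1/h) *\<^sub>R (T h x - x)) \<longlongrightarrow> y + \<mu> *\<^sub>C x) (at_right 0)"
  using rescale_quotient_tendsto[of "rescale \<mu> T" x y "- \<mu>"]
    rescale_quotient_tendsto[of T x "y + \<mu> *\<^sub>C x" \<mu>]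
  by (auto simp: rescale_inverse scaleC.minus_left)

locale C0_generator =
  fixes T :: "real \<Rightarrow> 'a::complex_banach \<Rightarrow> 'a" and D :: "'a set" and A :: "'a \<Rightarrow> 'a"
  assumes semigroup: "C0_semigroup T" and generator: "is_generator D A T"
begin

lemma T_linear: "0 \<le> t \<Longrightarrow> bounded_linear (T t)"
  using semigroup by (simp add: C0_semigroup_def bounded_clinear_def)

lemmas T_plus = linear_add[OF bounded_linear.linear[OF T_linear]]
  and T_null = linear_0[OF bounded_linear.linear[OF T_linear]]
  and T_scaleR = linear_scale[OF bounded_linear.linear[OF T_linear]]

lemma T_scaleC: "0 \<le> t \<Longrightarrow> T t (c *\<^sub>C x) = c *\<^sub>C T t x"
  using semigroup by (simp add: C0_semigroup_def bounded_clinear_def)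

lemma T_zero: "T 0 x = x"
  using semigroup by (simp add: C0_semigroup_def)

lemma T_add: "0 \<le> s \<Longrightarrow> 0 \<le> t \<Longrightarrow> T (s + t) x = T s (T t x)"
  using semigroup by (simp add: C0_semigroup_def)

lemma T_continuous: "continuous_on {0..} (\<lambda>t. T t x)"
  using semigroup by (simp add: C0_semigroup_def)

lemma T_continuous_Icc: "0 \<le> a \<Longrightarrow> continuous_on {a..b} (\<lambda>t. T t x)"
  by (rule continuous_on_subset[OF T_continuous]) auto

lemma T_bound: "\<exists>C\<ge>1. \<forall>t\<in>{0..N}. \<forall>x. norm (T t x) \<le> C * norm x"
  by (rule continuous_family_bound) (auto intro: T_linear T_continuous_Icc)

lemma generator_tendsto: "x \<in> D \<Longrightarrow> ((\<lambda>h. (1/h) *\<^sub>R (T h x - x)) \<longlongrightarrow> A x) (at_right 0)"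
  using generator by (simp add: is_generator_def)

lemma generatorI:
  assumes "((\<lambda>h. (1/h) *\<^sub>R (T h x - x)) \<longlongrightarrow> y) (at_right 0)"
  shows "x \<in> D" "A x = y"
proof -
  show x: "x \<in> D" using generator assms by (auto simp: is_generator_def)
  show "A x = y" using tendsto_unique[OF _ generator_tendsto[OF x] assms] by simp
qed

lemma generator_add:
  assumes "x \<in> D" "y \<in> D"
  shows "x + y \<in> D" "A (x + y) = A x + A y"
proof -
  have "((\<lambda>h. (1/h) *\<^sub>R (T h x - x) + (1/h) *\<^sub>R (T h y - y)) \<longlongrightarrow> A x + A y) (at_right 0)"
    by (intro tendsto_add generator_tendsto assms)
  moreover have "\<forall>\<^sub>F h in at_right 0. (1/h) *\<^sub>R (T h x - x) + (1/h) *\<^sub>R (T h y - y)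
      = (1/h) *\<^sub>R (T h (x + y) - (x + y))"
    unfolding eventually_at_right_field
    by (intro exI[of _ 1]) (auto simp: T_plus algebra_simps)
  ultimately have "((\<lambda>h. (1/h) *\<^sub>R (T h (x + y) - (x + y))) \<longlongrightarrow> A x + A y) (at_right 0)"
    by (rule Lim_transform_eventually)
  then show "x + y \<in> D" "A (x + y) = A x + A y" by (auto dest: generatorI)
qed

lemma generator_scaleC:
  assumes "x \<in> D"
  shows "c *\<^sub>C x \<in> D" "A (c *\<^sub>C x) = c *\<^sub>C A x"
proof -
  have "((\<lambda>h. c *\<^sub>C ((1/h) *\<^sub>R (T h x - x))) \<longlongrightarrow> c *\<^sub>C A x) (at_right 0)"
    by (intro scaleC.tendsto tendsto_const generator_tendsto assms)
  moreover have "\<forall>\<^sub>F h in at_right 0. c *\<^sub>C ((1/h) *\<^sub>R (T h x - x))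
      = (1/h) *\<^sub>R (T h (c *\<^sub>C x) - c *\<^sub>C x)"
    unfolding eventually_at_right_field
    by (intro exI[of _ 1]) (auto simp: T_scaleC scaleC.scaleR_right scaleC.diff_right)
  ultimately have "((\<lambda>h. (1/h) *\<^sub>R (T h (c *\<^sub>C x) - c *\<^sub>C x)) \<longlongrightarrow> c *\<^sub>C A x) (at_right 0)"
    by (rule Lim_transform_eventually)
  then show "c *\<^sub>C x \<in> D" "A (c *\<^sub>C x) = c *\<^sub>C A x" by (auto dest: generatorI)
qed

lemma generator_zero: "0 \<in> D" "A 0 = 0"
proof -
  have lim: "((\<lambda>h. (1/h) *\<^sub>R (T h 0 - 0)) \<longlongrightarrow> 0) (at_right 0)"
  proof (rule Lim_transform_eventually[OF tendsto_const])
    show "\<forall>\<^sub>F h in at_right 0. 0 = (1/h) *\<^sub>R (T h 0 - 0)"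
      unfolding eventually_at_right_field
      by (intro exI[of _ 1]) (auto simp: T_null)
  qed
  show "0 \<in> D" "A 0 = 0" by (rule generatorI[OF lim])+
qed

lemma generator_scaleR:
  assumes "x \<in> D"
  shows "r *\<^sub>R x \<in> D" "A (r *\<^sub>R x) = r *\<^sub>R A x"
  using generator_scaleC[OF assms, of "complex_of_real r"] by (simp_all add: scaleC_of_real)

lemma generator_diff:
  assumes "x \<in> D" "y \<in> D"
  shows "x - y \<in> D" "A (x - y) = A x - A y"
  using generator_add[OF assms(1) generator_scaleR(1)[OF assms(2), of "-1"]]
    generator_scaleR(2)[OF assms(2), of "-1"] by simp_all

lemma generator_subspace: "complex_vector.subspace D"
  by (auto simp: complex_vector.subspace_def generator_zero generator_add generator_scaleC)

abbreviation B :: "complex \<Rightarrow> 'a \<Rightarrow> 'a" where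
  "B \<mu> x \<equiv> \<mu> *\<^sub>C x - A x"

lemma B_diff: "x \<in> D \<Longrightarrow> y \<in> D \<Longrightarrow> B \<mu> (x - y) = B \<mu> x - B \<mu> y"
  by (simp add: generator_diff scaleC.diff_right)

lemma B_add: "x \<in> D \<Longrightarrow> y \<in> D \<Longrightarrow> B \<mu> (x + y) = B \<mu> x + B \<mu> y"
  by (simp add: generator_add scaleC_add_right)

lemma B_scaleC: "x \<in> D \<Longrightarrow> B \<mu> (c *\<^sub>C x) = c *\<^sub>C B \<mu> x"
  by (simp add: generator_scaleC scaleC.diff_right scaleC_scaleC mult.commute)

lemma B_scaleR: "x \<in> D \<Longrightarrow> B \<mu> (r *\<^sub>R x) = r *\<^sub>R B \<mu> x"
  using B_scaleC[of x \<mu> "complex_of_real r"] by (simp add: scaleC_of_real)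

abbreviation kernel :: "complex \<Rightarrow> 'a set" where
  "kernel \<mu> \<equiv> {x \<in> D. B \<mu> x = 0}"

abbreviation bounded_below :: "complex \<Rightarrow> bool" where
  "bounded_below \<mu> \<equiv> \<exists>\<gamma>>0. \<forall>x\<in>D. \<gamma> * norm x \<le> norm (B \<mu> x)"

abbreviation surjective :: "complex \<Rightarrow> bool" where
  "surjective \<mu> \<equiv> \<forall>y. \<exists>x\<in>D. B \<mu> x = y"

lemma preimage_subspace:
  assumes V: "complex_vector.subspace V"
  shows "complex_vector.subspace {x \<in> D. B \<mu> x \<in> V}"
  unfolding complex_vector.subspace_def
proof (intro conjI ballI allI CollectI)
  show "0 \<in> D" "B \<mu> 0 \<in> V" using complex_vector.subspace_0[OF V] by (simp_all add: generator_zero)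
next
  fix x y assume "x \<in> {x \<in> D. B \<mu> x \<in> V}" "y \<in> {x \<in> D. B \<mu> x \<in> V}"
  then have xy: "x \<in> D" "y \<in> D" "B \<mu> x \<in> V" "B \<mu> y \<in> V" by auto
  show "x + y \<in> D" by (rule generator_add(1)[OF xy(1,2)])
  show "B \<mu> (x + y) \<in> V"
    unfolding B_add[OF xy(1,2)] by (rule complex_vector.subspace_add[OF V xy(3,4)])
next
  fix c x assume "x \<in> {x \<in> D. B \<mu> x \<in> V}"
  then have x: "x \<in> D" "B \<mu> x \<in> V" by auto
  show "c *\<^sub>C x \<in> D" by (rule generator_scaleC(1)[OF x(1)])
  show "B \<mu> (c *\<^sub>C x) \<in> V"
    unfolding B_scaleC[OF x(1)] by (rule complex_vector.subspace_scale[OF V x(2)])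
qed

lemma kernel_subspace: "complex_vector.subspace (kernel \<mu>)"
  using preimage_subspace[OF complex_vector.subspace_single_0] by simp

lemma range_subspace: "complex_vector.subspace (B \<mu> ` D)"
  unfolding complex_vector.subspace_def
proof (intro conjI ballI allI)
  show "0 \<in> B \<mu> ` D" using generator_zero by (intro image_eqI[of _ _ 0]) auto
next
  fix u v assume "u \<in> B \<mu> ` D" "v \<in> B \<mu> ` D"
  then obtain x y where xy: "x \<in> D" "y \<in> D" "u = B \<mu> x" "v = B \<mu> y" by blast
  show "u + v \<in> B \<mu> ` D"
    unfolding xy B_add[OF xy(1,2), symmetric] by (rule imageI[OF generator_add(1)[OF xy(1,2)]])
next
  fix c u assume "u \<in> B \<mu> ` D"
  then obtain x where x: "x \<in> D" "u = B \<mu> x" by blast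
  show "c *\<^sub>C u \<in> B \<mu> ` D"
    unfolding x(2) B_scaleC[OF x(1), symmetric] by (rule imageI[OF generator_scaleC(1)[OF x(1)]])
qed

definition J :: "real \<Rightarrow> 'a \<Rightarrow> 'a" where
  "J t x = integral {0..t} (\<lambda>s. T s x)"

lemma J_zero: "J 0 x = 0"
  by (simp add: J_def)

lemma J_linear: assumes t: "0 \<le> t" shows "bounded_linear (J t)"
proof -
  obtain C where C: "C \<ge> 1" "\<forall>s\<in>{0..t}. \<forall>x. norm (T s x) \<le> C * norm x" using T_bound by blast
  have int: "(\<lambda>s. T s x) integrable_on {0..t}" for x
    by (intro integrable_continuous_interval T_continuous_Icc) simp
  show ?thesis
  proof (rule bounded_linear_intro[where K = "C * t"])
    fix x y
    have "J t (x + y) = integral {0..t} (\<lambda>s. T s x + T s y)"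
      unfolding J_def by (rule integral_cong) (simp add: T_plus)
    then show "J t (x + y) = J t x + J t y" by (simp add: J_def integral_add int)
  next
    fix r x
    have "J t (r *\<^sub>R x) = integral {0..t} (\<lambda>s. r *\<^sub>R T s x)"
      unfolding J_def by (rule integral_cong) (simp add: T_scaleR)
    then show "J t (r *\<^sub>R x) = r *\<^sub>R J t x" by (simp add: J_def)
  next
    fix x
    have "norm (J t x) \<le> C * norm x * (t - 0)"
      unfolding J_def using C t by (intro integral_bound T_continuous_Icc) auto
    then show "norm (J t x) \<le> norm x * (C * t)" by (simp add: mult_ac)
  qed
qed

text \<open>Both expressions are the integral of the orbit over \<open>[h, t + h]\<close>. Comparing their difference
quotients yields the two halves of the fundamental theorem for the generator below.\<close>

lemma T_J:
  assumes t: "0 \<le> t" and h: "0 \<le> h"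
  shows "T h (J t x) = J (t + h) x - J h x" "J t (T h x) = J (t + h) x - J h x"
proof -
  have int: "(\<lambda>s. T s x) integrable_on {a..b}" if "0 \<le> a" for a b
    using that by (intro integrable_continuous_interval T_continuous_Icc)
  have "integral {0..t} (\<lambda>s. T (h + s) x) = integral {h..t + h} (\<lambda>s. T s x)"
    using integral_shift_Icc_real[of 0 t "\<lambda>s. T s x" h] by (simp add: o_def)
  also have "\<dots> = J (t + h) x - J h x"
    using Henstock_Kurzweil_Integration.integral_combine[of 0 h "t + h" "\<lambda>s. T s x"] t h int unfolding J_def
    by (simp add: algebra_simps)
  finally have *: "integral {0..t} (\<lambda>s. T (h + s) x) = J (t + h) x - J h x" .
  have "T h (J t x) = integral {0..t} (\<lambda>s. T h (T s x))"
    unfolding J_def using integral_linear[OF int[of 0 t] T_linear[OF h]] by (simp add: o_def)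
  also have "\<dots> = integral {0..t} (\<lambda>s. T (h + s) x)"
    by (rule integral_cong) (simp add: T_add h)
  finally show "T h (J t x) = J (t + h) x - J h x" using * by simp
  have "J t (T h x) = integral {0..t} (\<lambda>s. T (h + s) x)"
    unfolding J_def by (rule integral_cong) (simp add: T_add h add.commute[of h])
  then show "J t (T h x) = J (t + h) x - J h x" using * by simp
qed

lemma average_J: "0 \<le> t \<Longrightarrow> ((\<lambda>h. (1/h) *\<^sub>R (J (t + h) x - J t x)) \<longlongrightarrow> T t x) (at_right 0)"
  unfolding J_def by (rule average_tendsto[OF T_continuous])

lemma quotient_J:
  assumes t: "0 \<le> t"
  shows "((\<lambda>h. (1/h) *\<^sub>R ((J (t + h) x - J h x) - J t x)) \<longlongrightarrow> T t x - x) (at_right 0)"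
proof -
  have "((\<lambda>h. (1/h) *\<^sub>R (J (t + h) x - J t x) - (1/h) *\<^sub>R (J (0 + h) x - J 0 x)) \<longlongrightarrow> T t x - T 0 x) (at_right 0)"
    by (intro tendsto_diff average_J t order_refl)
  then show ?thesis by (simp add: J_zero T_zero algebra_simps)
qed

lemma J_in_domain:
  assumes t: "0 \<le> t"
  shows "J t x \<in> D" "A (J t x) = T t x - x"
proof -
  have "\<forall>\<^sub>F h in at_right 0. (1/h) *\<^sub>R ((J (t + h) x - J h x) - J t x) = (1/h) *\<^sub>R (T h (J t x) - J t x)"
    unfolding eventually_at_right_field using t by (intro exI[of _ 1]) (simp add: T_J)
  from Lim_transform_eventually[OF quotient_J[OF t] this]
  show "J t x \<in> D" "A (J t x) = T t x - x" by (auto dest: generatorI)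
qed

lemma T_diff_eq_J:
  assumes t: "0 \<le> t" and x: "x \<in> D"
  shows "T t x - x = J t (A x)"
proof -
  interpret Jt: bounded_linear "J t" by (rule J_linear[OF t])
  have "\<forall>\<^sub>F h in at_right 0. (1/h) *\<^sub>R ((J (t + h) x - J h x) - J t x) = J t ((1/h) *\<^sub>R (T h x - x))"
    unfolding eventually_at_right_field using t
    by (intro exI[of _ 1]) (simp add: T_J Jt.scaleR Jt.diff)
  from Lim_transform_eventually[OF quotient_J[OF t] this]
  have "((\<lambda>h. J t ((1/h) *\<^sub>R (T h x - x))) \<longlongrightarrow> T t x - x) (at_right 0)" .
  moreover have "((\<lambda>h. J t ((1/h) *\<^sub>R (T h x - x))) \<longlongrightarrow> J t (A x)) (at_right 0)"
    by (intro Jt.tendsto generator_tendsto x)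
  ultimately show ?thesis by (intro tendsto_unique) auto
qed

lemma generator_closed:
  assumes x: "\<And>n. x n \<in> D" "x \<longlonglongrightarrow> l" and y: "(\<lambda>n. A (x n)) \<longlonglongrightarrow> y"
  shows "l \<in> D" "A l = y"
proof -
  have "T t l - l = J t y" if t: "0 \<le> t" for t
  proof -
    interpret Jt: bounded_linear "J t" by (rule J_linear[OF t])
    interpret Tt: bounded_linear "T t" by (rule T_linear[OF t])
    have "(\<lambda>n. J t (A (x n))) \<longlonglongrightarrow> J t y" by (intro Jt.tendsto y)
    then have "(\<lambda>n. T t (x n) - x n) \<longlonglongrightarrow> J t y" by (simp add: T_diff_eq_J t x(1))
    moreover have "(\<lambda>n. T t (x n) - x n) \<longlonglongrightarrow> T t l - l" by (intro tendsto_diff Tt.tendsto x(2))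
    ultimately show ?thesis using LIMSEQ_unique by blast
  qed
  then have "\<forall>\<^sub>F h in at_right 0. (1/h) *\<^sub>R (J (0 + h) y - J 0 y) = (1/h) *\<^sub>R (T h l - l)"
    unfolding eventually_at_right_field by (intro exI[of _ 1]) (simp add: J_zero)
  from Lim_transform_eventually[OF average_J[OF order_refl] this]
  have "((\<lambda>h. (1/h) *\<^sub>R (T h l - l)) \<longlongrightarrow> y) (at_right 0)" by (simp add: T_zero)
  then show "l \<in> D" "A l = y" by (auto dest: generatorI)
qed

lemma rescaled: "C0_generator (rescale \<mu> T) D (\<lambda>x. A x - \<mu> *\<^sub>C x)"
proof
  show "C0_semigroup (rescale \<mu> T)"
    unfolding C0_semigroup_def bounded_clinear_def
  proof (intro conjI allI impI)
    fix t :: real assume t: "0 \<le> t"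
    show "bounded_linear (rescale \<mu> T t)"
      unfolding rescale_def[abs_def] by (rule bounded_linear_compose[OF scaleC.bounded_linear_right T_linear[OF t]])
    show "rescale \<mu> T t (c *\<^sub>C x) = c *\<^sub>C rescale \<mu> T t x" for c x
      by (simp add: rescale_def T_scaleC[OF t] scaleC_scaleC mult.commute)
    show "rescale \<mu> T (s + t) = rescale \<mu> T s \<circ> rescale \<mu> T t" if s: "0 \<le> s" for s
      by (rule ext) (simp add: rescale_def T_scaleC[OF s] T_add[OF s t] scaleC_scaleC
          exp_add[symmetric] algebra_simps)
  next
    show "rescale \<mu> T 0 = id" by (rule ext) (simp add: rescale_def T_zero scaleC_one)
    show "continuous_on {0..} (\<lambda>t. rescale \<mu> T t x)" for x
      unfolding rescale_def by (intro scaleC.continuous_on continuous_intros T_continuous)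
  qed
  show "is_generator D (\<lambda>x. A x - \<mu> *\<^sub>C x) (rescale \<mu> T)"
    unfolding is_generator_def rescale_quotient_tendsto_iff
  proof
    have "(\<exists>y. ((\<lambda>h. (1/h) *\<^sub>R (T h x - x)) \<longlongrightarrow> y + \<mu> *\<^sub>C x) (at_right 0)) \<longleftrightarrow> x \<in> D" for x
    proof
      assume "x \<in> D"
      then show "\<exists>y. ((\<lambda>h. (1/h) *\<^sub>R (T h x - x)) \<longlongrightarrow> y + \<mu> *\<^sub>C x) (at_right 0)"
        using generator_tendsto[of x] by (intro exI[of _ "A x - \<mu> *\<^sub>C x"]) simp
    qed (auto dest: generatorI)
    then show "D = {x. \<exists>y. ((\<lambda>h. (1/h) *\<^sub>R (T h x - x)) \<longlongrightarrow> y + \<mu> *\<^sub>C x) (at_right 0)}" by blast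
    show "\<forall>x\<in>D. ((\<lambda>h. (1/h) *\<^sub>R (T h x - x)) \<longlongrightarrow> A x - \<mu> *\<^sub>C x + \<mu> *\<^sub>C x) (at_right 0)"
      using generator_tendsto by simp
  qed
qed

text \<open>For the rescaled semigroup \<open>S\<close> this is the formula for \<open>S(t)x - x\<close> as an integral of
\<open>S(s)(A - \<mu>)x\<close>. The constant is uniform over the half-plane \<open>Re \<mu> \<ge> a\<close>, since the rescaling factor is
at most \<open>e\<^sup>|\<^sup>a\<^sup>|\<^sup>N\<close> there.\<close>

lemma approximate_eigenvector:
  assumes N: "0 \<le> N"
  obtains \<kappa> where "0 < \<kappa>" "\<And>\<mu> x t. a \<le> Re \<mu> \<Longrightarrow> x \<in> D \<Longrightarrow> 0 \<le> t \<Longrightarrow> t \<le> N \<Longrightarrow>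
    norm (T t x - exp (\<mu> * of_real t) *\<^sub>C x) \<le> \<kappa> * exp (Re \<mu> * t) * norm (B \<mu> x)"
proof -
  obtain C where C: "C \<ge> 1" "\<forall>s\<in>{0..N}. \<forall>x. norm (T s x) \<le> C * norm x" using T_bound by blast
  define \<kappa> where "\<kappa> = exp (\<bar>a\<bar> * N) * C * N + 1"
  have "0 < \<kappa>" unfolding \<kappa>_def using C(1) N by (intro add_nonneg_pos mult_nonneg_nonneg) auto
  moreover have "norm (T t x - exp (\<mu> * of_real t) *\<^sub>C x) \<le> \<kappa> * exp (Re \<mu> * t) * norm (B \<mu> x)"
    if \<mu>: "a \<le> Re \<mu>" and x: "x \<in> D" and t: "0 \<le> t" "t \<le> N" for \<mu> x t
  proof -
    interpret S: C0_generator "rescale \<mu> T" D "\<lambda>x. A x - \<mu> *\<^sub>C x" by (rule rescaled)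
    let ?z = "A x - \<mu> *\<^sub>C x"
    have "norm (rescale \<mu> T s ?z) \<le> exp (\<bar>a\<bar> * N) * C * norm ?z" if s: "s \<in> {0..t}" for s
    proof -
      have "- Re \<mu> * s \<le> \<bar>a\<bar> * N"
      proof -
        have "- Re \<mu> * s \<le> - a * s" using \<mu> s by (intro mult_right_mono) auto
        also have "\<dots> \<le> \<bar>a\<bar> * s" using s by (intro mult_right_mono) auto
        also have "\<dots> \<le> \<bar>a\<bar> * N" using s t by (intro mult_left_mono) auto
        finally show ?thesis .
      qed
      then have "exp (- Re \<mu> * s) * norm (T s ?z) \<le> exp (\<bar>a\<bar> * N) * (C * norm ?z)"
        using C s t by (intro mult_mono) auto
      then show ?thesis by (simp add: rescale_def norm_scaleC norm_exp_eq_Re mult.assoc)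
    qed
    then have "norm (S.J t ?z) \<le> exp (\<bar>a\<bar> * N) * C * norm ?z * (t - 0)"
      unfolding S.J_def using t by (intro integral_bound S.T_continuous_Icc) auto
    also have "\<dots> \<le> exp (\<bar>a\<bar> * N) * C * norm ?z * N" using t C(1) by (intro mult_left_mono) auto
    also have "\<dots> \<le> \<kappa> * norm ?z" by (simp add: \<kappa>_def algebra_simps)
    finally have J: "norm (rescale \<mu> T t x - x) \<le> \<kappa> * norm ?z" using S.T_diff_eq_J[OF t(1) x] by simp
    have "T t x - exp (\<mu> * of_real t) *\<^sub>C x = exp (\<mu> * of_real t) *\<^sub>C (rescale \<mu> T t x - x)"
      by (simp add: rescale_def scaleC.diff_right scaleC_scaleC exp_add[symmetric] scaleC_one)
    then have "norm (T t x - exp (\<mu> * of_real t) *\<^sub>C x) = exp (Re \<mu> * t) * norm (rescale \<mu> T t x - x)"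
      by (simp add: norm_scaleC norm_exp_eq_Re)
    also have "\<dots> \<le> exp (Re \<mu> * t) * (\<kappa> * norm ?z)" using J by (intro mult_left_mono) auto
    finally show ?thesis by (simp add: norm_minus_commute mult_ac)
  qed
  ultimately show thesis by (rule that)
qed

lemma resolvent_setI:
  assumes \<gamma>: "0 < \<gamma>" "\<And>x. x \<in> D \<Longrightarrow> \<gamma> * norm x \<le> norm (B \<mu> x)"
    and surj: "\<And>y. \<exists>x\<in>D. B \<mu> x = y"
  shows "\<mu> \<in> resolvent_set D A" "onorm (resolvent D A \<mu>) \<le> 1 / \<gamma>"
proof -
  let ?R = "resolvent D A \<mu>"
  have inj: "inj_on (B \<mu>) D"
  proof (rule inj_onI)
    fix x y assume xy: "x \<in> D" "y \<in> D" "B \<mu> x = B \<mu> y"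
    have "B \<mu> (x - y) = 0" unfolding B_diff[OF xy(1,2)] using xy(3) by simp
    then have "\<gamma> * norm (x - y) \<le> 0" using \<gamma>(2)[OF generator_diff(1)[OF xy(1,2)]] by simp
    then show "x = y" using \<gamma>(1) by (simp add: mult_le_0_iff)
  qed
  have im: "B \<mu> ` D = UNIV" using surj by (metis (no_types, lifting) UNIV_eq_I imageI)
  have R: "?R y \<in> D" "B \<mu> (?R y) = y" for y
    using the_inv_into_into[OF inj, of y D] f_the_inv_into_f[OF inj, of y] im
    by (auto simp: resolvent_def)
  have RB: "?R (B \<mu> x) = x" if "x \<in> D" for x
    unfolding resolvent_def by (rule the_inv_into_f_f[OF inj that])
  have R_add: "?R (y + z) = ?R y + ?R z" for y z
    using RB[OF generator_add(1)[OF R(1)[of y] R(1)[of z]]] unfolding B_add[OF R(1) R(1)] R(2) .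
  have R_scale: "?R (c *\<^sub>C y) = c *\<^sub>C ?R y" for c y
    using RB[OF generator_scaleC(1)[OF R(1)[of y]], of c] unfolding B_scaleC[OF R(1)] R(2) .
  have R_norm: "norm (?R y) \<le> 1 / \<gamma> * norm y" for y
    using \<gamma>(2)[OF R(1)[of y]] \<gamma>(1) by (simp add: R(2) field_simps)
  have "bounded_linear ?R"
  proof (rule bounded_linear_intro[where K = "1 / \<gamma>"])
    show "?R (r *\<^sub>R y) = r *\<^sub>R ?R y" for r y
      using R_scale[of "complex_of_real r" y] by (simp add: scaleC_of_real)
    show "norm (?R y) \<le> norm y * (1 / \<gamma>)" for y using R_norm[of y] by (simp add: mult.commute)
  qed (rule R_add)
  then show "\<mu> \<in> resolvent_set D A"
    using inj im R_scale by (auto simp: resolvent_set_def bij_betw_def bounded_clinear_def)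
  show "onorm ?R \<le> 1 / \<gamma>" using \<gamma>(1) R_norm by (intro onorm_bound) auto
qed

text \<open>The equation at \<open>\<mu>'\<close> is a fixed point equation for a contraction built from the inverse at \<open>\<mu>\<close>.\<close>

lemma surjective_stable:
  assumes \<gamma>: "0 < \<gamma>" "\<And>x. x \<in> D \<Longrightarrow> \<gamma> * norm x \<le> norm (B \<mu> x)"
    and surj: "\<And>y. \<exists>x\<in>D. B \<mu> x = y"
    and near: "cmod (\<mu>' - \<mu>) < \<gamma>"
  shows "\<exists>x\<in>D. B \<mu>' x = y"
proof -
  obtain R where R: "\<And>y. R y \<in> D" "\<And>y. B \<mu> (R y) = y" using surj by metis
  have R_lip: "norm (R u - R v) \<le> norm (u - v) / \<gamma>" for u v
  proof -
    have "B \<mu> (R u - R v) = u - v" unfolding B_diff[OF R(1) R(1)] R(2) ..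
    then have "\<gamma> * norm (R u - R v) \<le> norm (u - v)"
      using \<gamma>(2)[OF generator_diff(1)[OF R(1)[of u] R(1)[of v]]] by (simp only:)
    then show ?thesis using \<gamma>(1) by (simp add: field_simps)
  qed
  define f where "f x = R (y - (\<mu>' - \<mu>) *\<^sub>C x)" for x
  have "\<exists>!x. f x = x"
  proof (rule banach_fix_type[where c = "cmod (\<mu>' - \<mu>) / \<gamma>"])
    show "0 \<le> cmod (\<mu>' - \<mu>) / \<gamma>" "cmod (\<mu>' - \<mu>) / \<gamma> < 1" using \<gamma>(1) near by auto
    show "\<forall>x z. dist (f x) (f z) \<le> cmod (\<mu>' - \<mu>) / \<gamma> * dist x z"
    proof (intro allI)
      fix x z
      have "dist (f x) (f z) \<le> norm ((\<mu>' - \<mu>) *\<^sub>C z - (\<mu>' - \<mu>) *\<^sub>C x) / \<gamma>"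
        using R_lip[of "y - (\<mu>' - \<mu>) *\<^sub>C x" "y - (\<mu>' - \<mu>) *\<^sub>C z"] by (simp add: f_def dist_norm)
      also have "\<dots> = cmod (\<mu>' - \<mu>) / \<gamma> * dist x z"
        by (simp add: scaleC.diff_right[symmetric] norm_scaleC dist_norm norm_minus_commute)
      finally show "dist (f x) (f z) \<le> cmod (\<mu>' - \<mu>) / \<gamma> * dist x z" .
    qed
  qed
  then obtain x where x: "f x = x" by blast
  have "x \<in> D" using R(1) x unfolding f_def by metis
  moreover have "\<mu> *\<^sub>C x - A x = y - (\<mu>' - \<mu>) *\<^sub>C x" using R(2) x unfolding f_def by metis
  then have "\<mu>' *\<^sub>C x - A x = y" by (simp add: scaleC.diff_left algebra_simps)
  ultimately show ?thesis by blast
qed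

text \<open>When the rescaled semigroup has norm at most \<open>1/2\<close> at time \<open>1\<close>, the operator \<open>S(1) - I\<close> is
invertible by Banach's fixed point theorem, and it factors through \<open>A - \<mu>\<close> and the integral of \<open>S\<close> over \<open>[0,1]\<close>.\<close>

lemma right_half_plane:
  obtains \<omega> where "\<And>\<mu>. \<omega> < Re \<mu> \<Longrightarrow> bounded_below \<mu> \<and> surjective \<mu>"
proof -
  obtain C where C: "C \<ge> 1" "\<forall>s\<in>{0..1}. \<forall>x. norm (T s x) \<le> C * norm x" using T_bound by blast
  show thesis
  proof (rule that)
    fix \<mu> :: complex assume \<mu>: "ln (2 * C) < Re \<mu>"
    interpret S: C0_generator "rescale \<mu> T" D "\<lambda>x. A x - \<mu> *\<^sub>C x" by (rule rescaled)
    interpret S1: bounded_linear "rescale \<mu> T 1" by (rule S.T_linear) simp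
    interpret J1: bounded_linear "S.J 1" by (rule S.J_linear) simp
    have contr: "norm (rescale \<mu> T 1 x) \<le> 1/2 * norm x" for x
    proof -
      have "2 * C = exp (ln (2 * C))" using C(1) by simp
      also have "\<dots> \<le> exp (Re \<mu>)" using \<mu> by simp
      finally have "exp (- Re \<mu>) * C \<le> 1/2" using C(1) by (simp add: exp_minus field_simps)
      then have "exp (- Re \<mu>) * C * norm x \<le> 1/2 * norm x" by (rule mult_right_mono) simp
      moreover have "norm (rescale \<mu> T 1 x) \<le> exp (- Re \<mu>) * (C * norm x)"
        using C(2) by (simp add: rescale_def norm_scaleC norm_exp_eq_Re)
      ultimately show ?thesis by (simp add: mult.assoc)
    qed
    obtain K where K: "K > 0" "\<And>x. norm (S.J 1 x) \<le> norm x * K" using J1.pos_bounded by blast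
    have "1 / (2 * K) * norm x \<le> norm (B \<mu> x)" if x: "x \<in> D" for x
    proof -
      have "norm x - 1/2 * norm x \<le> norm (rescale \<mu> T 1 x - x)"
        using contr[of x] norm_triangle_ineq2[of x "rescale \<mu> T 1 x"] by (simp add: norm_minus_commute)
      also have "\<dots> \<le> norm (A x - \<mu> *\<^sub>C x) * K" using S.T_diff_eq_J[OF _ x, of 1] K(2) by simp
      finally show ?thesis using K(1) by (simp add: norm_minus_commute field_simps)
    qed
    moreover have "1 / (2 * K) > 0" using K(1) by simp
    moreover have "\<exists>x\<in>D. B \<mu> x = y" for y
    proof -
      have "\<exists>!w. rescale \<mu> T 1 w + y = w"
      proof (rule banach_fix_type[where c = "1/2"])
        show "\<forall>x z. dist (rescale \<mu> T 1 x + y) (rescale \<mu> T 1 z + y) \<le> 1/2 * dist x z"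
          using contr by (simp add: dist_norm S1.diff[symmetric])
      qed auto
      then obtain w where w: "rescale \<mu> T 1 w + y = w" by blast
      have "S.J 1 w \<in> D" "A (S.J 1 w) - \<mu> *\<^sub>C S.J 1 w = rescale \<mu> T 1 w - w"
        using S.J_in_domain[of 1 w] by auto
      moreover have "rescale \<mu> T 1 w - w = - y" using w by (metis add_diff_cancel_left' minus_diff_eq)
      ultimately show ?thesis by (intro bexI[of _ "S.J 1 w"]) (auto simp: algebra_simps)
    qed
    ultimately show "bounded_below \<mu> \<and> surjective \<mu>" by blast
  qed
qed

section \<open>Separating sequences\<close>

text \<open>The quantifier over \<open>n\<close> is only eventual in order to cover sequences with increasing
frequencies, where how far one has to go depends on \<open>m\<close>.\<close>

definition separating :: "real \<Rightarrow> real \<Rightarrow> real \<Rightarrow> bool" where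
  "separating c a N \<longleftrightarrow> (\<exists>v::nat \<Rightarrow> 'a. (\<forall>n. norm (v n) \<le> 1) \<and>
    (\<forall>m. \<forall>\<^sub>F n in sequentially. \<forall>t\<in>{0..N}. c * exp (a * t) \<le> norm (T t (v m - v n))))"

lemma separating_mono:
  assumes "separating c a N" "0 \<le> c'" "c' \<le> c" "a' \<le> a"
  shows "separating c' a' N"
proof -
  obtain v :: "nat \<Rightarrow> 'a" where v: "\<forall>n. norm (v n) \<le> 1"
    "\<forall>m. \<forall>\<^sub>F n in sequentially. \<forall>t\<in>{0..N}. c * exp (a * t) \<le> norm (T t (v m - v n))"
    using assms(1) unfolding separating_def by blast
  have le: "c' * exp (a' * t) \<le> c * exp (a * t)" if "0 \<le> t" for t
    using assms(2-4) that by (intro mult_mono) (auto intro: mult_right_mono)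
  have "\<forall>\<^sub>F n in sequentially. \<forall>t\<in>{0..N}. c' * exp (a' * t) \<le> norm (T t (v m - v n))" for m
    using v(2)[rule_format, of m]
    by (rule eventually_mono) (meson atLeastAtMost_iff le order_trans)
  then show ?thesis using v(1) unfolding separating_def by blast
qed

lemma B_closed:
  assumes x: "\<And>n. x n \<in> D" "x \<longlonglongrightarrow> l" and y: "(\<lambda>n. B \<mu> (x n)) \<longlonglongrightarrow> y"
  shows "l \<in> D" "B \<mu> l = y"
proof -
  have "(\<lambda>n. \<mu> *\<^sub>C x n - B \<mu> (x n)) \<longlonglongrightarrow> \<mu> *\<^sub>C l - y"
    by (intro tendsto_diff scaleC.tendsto tendsto_const x y)
  then have Ax: "(\<lambda>n. A (x n)) \<longlonglongrightarrow> \<mu> *\<^sub>C l - y" by simp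
  show "l \<in> D" by (rule generator_closed(1)[OF x Ax])
  show "B \<mu> l = y" using generator_closed(2)[OF x Ax] by simp
qed

text \<open>A separated subsequence exists, but its separation may be small compared with its
diameter. By Ramsey's theorem one may assume that all its mutual distances lie in one bracket
\<open>[d, 2d]\<close>. Subtracting one term and dividing by \<open>2d\<close> then gives vectors of the unit ball with mutual
distance at least \<open>1/2\<close>, while the images of the differences under \<open>\<mu> - A\<close> become negligible when
the subtracted term is taken far out.\<close>

lemma separating_of_approximate_kernel:
  assumes N: "0 \<le> N" and \<mu>: "a \<le> Re \<mu>"
    and u: "\<And>n. u n \<in> D" "\<And>n. norm (u n) \<le> M" and conv: "(\<lambda>n. B \<mu> (u n)) \<longlonglongrightarrow> y"
    and nconv: "\<not> has_convergent_subseq u"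
  shows "separating (1/4) a N"
proof -
  obtain e and r :: "nat \<Rightarrow> nat" where er: "e > 0" "strict_mono r"
    "\<And>j k. j < k \<Longrightarrow> e \<le> dist (u (r j)) (u (r k))"
    using separated_subseq[OF nconv] by metis
  obtain Q where Q: "2 * M / e < 2 ^ Q" using real_arch_pow[of 2 "2 * M / e"] by auto
  define bracket where
    "bracket q j k \<longleftrightarrow> e * 2 ^ q \<le> dist (u (r j)) (u (r k)) \<and> dist (u (r j)) (u (r k)) \<le> 2 * (e * 2 ^ q)" for q j k
  have "\<exists>q\<in>{..Q}. bracket q j k" if jk: "j < k" for j k
  proof -
    define \<delta> where "\<delta> = dist (u (r j)) (u (r k))"
    \<comment> \<open>the dyadic bracket containing the distance \<open>\<delta>\<close>\<close>
    define q where "q = (LEAST q. \<delta> \<le> 2 * (e * 2 ^ q))"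
    have "\<delta> \<le> 2 * M"
      unfolding \<delta>_def dist_norm using norm_triangle_ineq4[of "u (r j)" "u (r k)"] u(2)[of "r j"] u(2)[of "r k"]
      by linarith
    also have "\<dots> \<le> 2 * (e * 2 ^ Q)"
    proof -
      have "2 * M < e * 2 ^ Q" using Q er(1) by (simp add: field_simps)
      moreover have "0 \<le> e * 2 ^ Q" using er(1) by simp
      ultimately show ?thesis by linarith
    qed
    finally have Q': "\<delta> \<le> 2 * (e * 2 ^ Q)" .
    then have q: "\<delta> \<le> 2 * (e * 2 ^ q)" unfolding q_def by (rule LeastI)
    have "q \<le> Q" unfolding q_def using Q' by (rule Least_le)
    moreover have "e * 2 ^ q \<le> \<delta>"
    proof (cases q)
      case 0
      then show ?thesis using er(3)[OF jk] by (simp add: \<delta>_def)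
    next
      case (Suc p)
      then have "\<not> \<delta> \<le> 2 * (e * 2 ^ p)" using not_less_Least[of p "\<lambda>q. \<delta> \<le> 2 * (e * 2 ^ q)"] unfolding q_def by simp
      then show ?thesis using Suc by simp
    qed
    ultimately show ?thesis using q unfolding bracket_def \<delta>_def by auto
  qed
  then have "\<exists>q (r' :: nat \<Rightarrow> nat). strict_mono r' \<and> (\<forall>j k. j < k \<longrightarrow> bracket q (r' j) (r' k))"
  proof (rule Ramsey_cover[where R = bracket, OF finite_atMost])
    fix q and r' :: "nat \<Rightarrow> nat"
    assume "strict_mono r'" "\<And>j k. j < k \<Longrightarrow> bracket q (r' j) (r' k)"
    then show "\<exists>q (r' :: nat \<Rightarrow> nat). strict_mono r' \<and> (\<forall>j k. j < k \<longrightarrow> bracket q (r' j) (r' k))"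
      by (intro exI[of _ q] exI[of _ r']) auto
  qed
  then obtain q and r' :: "nat \<Rightarrow> nat" where r': "strict_mono r'" "\<And>j k. j < k \<Longrightarrow> bracket q (r' j) (r' k)"
    by auto
  define d where "d = e * 2 ^ q"
  have d: "d > 0" using er(1) by (simp add: d_def)
  define x where "x n = u (r (r' n))" for n
  have xD: "x n \<in> D" for n by (simp add: x_def u)
  have x_sep: "d \<le> norm (x j - x k)" "norm (x j - x k) \<le> 2 * d" if "j < k" for j k
    using r'(2)[OF that] by (auto simp: bracket_def d_def x_def dist_norm)
  obtain \<kappa> where \<kappa>: "0 < \<kappa>" "\<And>\<mu> x t. a \<le> Re \<mu> \<Longrightarrow> x \<in> D \<Longrightarrow> 0 \<le> t \<Longrightarrow> t \<le> N \<Longrightarrow>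
    norm (T t x - exp (\<mu> * of_real t) *\<^sub>C x) \<le> \<kappa> * exp (Re \<mu> * t) * norm (B \<mu> x)"
    using approximate_eigenvector[OF N, of a] by metis
  have "(\<lambda>n. B \<mu> (x n)) \<longlonglongrightarrow> y"
    using LIMSEQ_subseq_LIMSEQ[OF conv strict_mono_o[OF er(2) r'(1)]] by (simp add: x_def o_def)
  then have "Cauchy (\<lambda>n. B \<mu> (x n))" by (rule LIMSEQ_imp_Cauchy)
  moreover have "d / (2 * \<kappa>) > 0" using d \<kappa>(1) by simp
  ultimately obtain n0 where n0: "\<forall>m\<ge>n0. \<forall>n\<ge>n0. norm (B \<mu> (x m) - B \<mu> (x n)) < d / (2 * \<kappa>)"
    unfolding Cauchy_iff by blast
  \<comment> \<open>the factor \<open>1/(2d)\<close> puts the vectors into the unit ball by the upper end of the bracket\<close>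
  define w where "w n = (1 / (2 * d)) *\<^sub>R (x (Suc (n0 + n)) - x n0)" for n
  have w_norm: "norm (w n) \<le> 1" for n
    using x_sep(2)[of n0 "Suc (n0 + n)"] d by (simp add: w_def norm_minus_commute)
  have w_diff: "w m - w n = (1 / (2 * d)) *\<^sub>R (x (Suc (n0 + m)) - x (Suc (n0 + n)))" for m n
    by (simp add: w_def scaleR_diff_right)
  have sep: "1/4 * exp (a * t) \<le> norm (T t (w m - w n))" if mn: "m < n" and t: "t \<in> {0..N}" for m n t
  proof -
    let ?z = "w m - w n"
    have zD: "?z \<in> D" unfolding w_diff by (intro generator_scaleR generator_diff xD)
    have z: "1/2 \<le> norm ?z"
    proof -
      have "norm ?z = norm (x (Suc (n0 + m)) - x (Suc (n0 + n))) / (2 * d)"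
        unfolding w_diff norm_scaleR using d by simp
      moreover have "d / (2 * d) \<le> norm (x (Suc (n0 + m)) - x (Suc (n0 + n))) / (2 * d)"
        using x_sep(1)[of "Suc (n0 + m)" "Suc (n0 + n)"] mn d by (intro divide_right_mono) auto
      ultimately show ?thesis using d by simp
    qed
    have "B \<mu> ?z = (1 / (2 * d)) *\<^sub>R (B \<mu> (x (Suc (n0 + m))) - B \<mu> (x (Suc (n0 + n))))"
      unfolding w_diff B_scaleR[OF generator_diff(1)[OF xD xD]] B_diff[OF xD xD] ..
    then have "norm (B \<mu> ?z) = 1 / (2 * d) * norm (B \<mu> (x (Suc (n0 + m))) - B \<mu> (x (Suc (n0 + n))))"
      using d by simp
    also have "\<dots> \<le> 1 / (2 * d) * (d / (2 * \<kappa>))"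
      using n0 d by (intro mult_left_mono less_imp_le) auto
    finally have Bz: "\<kappa> * norm (B \<mu> ?z) \<le> 1/4" using d \<kappa>(1) by (simp add: field_simps)
    have tN: "0 \<le> t" "t \<le> N" using t by auto
    have "exp (Re \<mu> * t) * norm ?z = norm (exp (\<mu> * of_real t) *\<^sub>C ?z)"
      by (simp add: norm_scaleC norm_exp_eq_Re)
    also have "\<dots> \<le> norm (T t ?z) + norm (T t ?z - exp (\<mu> * of_real t) *\<^sub>C ?z)"
      using norm_triangle_sub[of "exp (\<mu> * of_real t) *\<^sub>C ?z" "T t ?z"]
      by (simp add: norm_minus_commute)
    also have "norm (T t ?z - exp (\<mu> * of_real t) *\<^sub>C ?z) \<le> \<kappa> * exp (Re \<mu> * t) * norm (B \<mu> ?z)"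
      by (rule \<kappa>(2)[OF \<mu> zD tN])
    also have "\<dots> = exp (Re \<mu> * t) * (\<kappa> * norm (B \<mu> ?z))" by simp
    also have "\<dots> \<le> exp (Re \<mu> * t) * (1/4)" using Bz by (intro mult_left_mono) auto
    finally have "exp (Re \<mu> * t) * norm ?z - exp (Re \<mu> * t) * (1/4) \<le> norm (T t ?z)" by simp
    moreover have "exp (Re \<mu> * t) * (1/2) \<le> exp (Re \<mu> * t) * norm ?z" using z by (intro mult_left_mono) auto
    moreover have "exp (a * t) \<le> exp (Re \<mu> * t)" using \<mu> tN by (simp add: mult_right_mono)
    ultimately show ?thesis by linarith
  qed
  have "\<forall>\<^sub>F n in sequentially. \<forall>t\<in>{0..N}. 1/4 * exp (a * t) \<le> norm (T t (w m - w n))" for m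
    unfolding eventually_sequentially using sep by (intro exI[of _ "Suc m"]) auto
  then show ?thesis using w_norm unfolding separating_def by blast
qed

text \<open>Eigenvectors for distinct eigenvalues are linearly independent: the top coefficient of \<open>v\<close>
must vanish, since otherwise the last vector would itself be an eigenvector in the preceding span.\<close>

lemma eigenvector_in_span_eq_0:
  fixes x :: "nat \<Rightarrow> 'a"
  assumes x: "\<And>n. x n \<in> D" "\<And>n. x n \<noteq> 0" "\<And>n. A (x n) = \<mu> n *\<^sub>C x n" and inj: "inj \<mu>"
  shows "v \<in> cspan (x ` {..<n}) \<Longrightarrow> A v = \<nu> *\<^sub>C v \<Longrightarrow> \<nu> \<notin> \<mu> ` {..<n} \<Longrightarrow> v = 0"
proof (induction n arbitrary: v \<nu>)
  case 0
  then show ?case by simp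
next
  case (Suc n)
  let ?E = "cspan (x ` {..<n})"
  have E_D: "?E \<subseteq> D" by (rule complex_vector.span_minimal[OF _ generator_subspace]) (use x(1) in auto)
  have A_E: "A w \<in> ?E" if "w \<in> ?E" for w
  proof -
    have "?E \<subseteq> {w \<in> D. A w \<in> ?E}"
    proof (rule complex_vector.span_minimal)
      show "x ` {..<n} \<subseteq> {w \<in> D. A w \<in> ?E}"
        using x by (auto intro!: complex_vector.span_scale cspan_image_base)
      show "complex_vector.subspace {w \<in> D. A w \<in> ?E}"
        unfolding complex_vector.subspace_def
        by (auto simp: generator_zero generator_add generator_scaleC complex_vector.span_zero
            intro: complex_vector.span_add complex_vector.span_scale)
    qed
    then show ?thesis using that by blast
  qed
  have "v \<in> cspan (insert (x n) (x ` {..<n}))" using Suc.prems(1) by (simp add: lessThan_Suc)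
  then obtain k where k: "v - k *\<^sub>C x n \<in> ?E" using complex_vector.span_breakdown_eq by blast
  define w where "w = v - k *\<^sub>C x n"
  have w: "w \<in> ?E" "w \<in> D" using k E_D by (auto simp: w_def)
  have v: "v = k *\<^sub>C x n + w" by (simp add: w_def)
  have "k = 0"
  proof (rule ccontr)
    assume "k \<noteq> 0"
    have ne: "\<nu> - \<mu> n \<noteq> 0" using Suc.prems(3) by auto
    have "k *\<^sub>C \<mu> n *\<^sub>C x n + A w = \<nu> *\<^sub>C (k *\<^sub>C x n + w)"
      using Suc.prems(2) w x unfolding v by (simp add: generator_add generator_scaleC)
    then have "((\<nu> - \<mu> n) * k) *\<^sub>C x n = A w - \<nu> *\<^sub>C w"
      by (simp add: scaleC_scaleC scaleC_add_right scaleC.diff_left left_diff_distrib algebra_simps)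
    moreover have "A w - \<nu> *\<^sub>C w \<in> ?E"
      using w A_E by (intro complex_vector.span_diff complex_vector.span_scale) auto
    moreover have "inverse q *\<^sub>C (q *\<^sub>C x n) = x n" if "q \<noteq> 0" for q
      using that by (simp add: scaleC_scaleC scaleC_one)
    ultimately have "x n \<in> ?E"
      using ne \<open>k \<noteq> 0\<close> by (metis complex_vector.span_scale mult_eq_0_iff)
    moreover have "\<mu> n \<notin> \<mu> ` {..<n}" using inj by (auto simp: inj_def)
    ultimately show False using Suc.IH[of "x n" "\<mu> n"] x by auto
  qed
  then have "v \<in> ?E" using w v by (simp add: scaleC.zero_left)
  then show ?case using Suc.IH[OF _ Suc.prems(2)] Suc.prems(3) by (simp add: lessThan_Suc)
qed

text \<open>On the quotient of the span of \<open>x\<^sub>0, \<dots>, x\<^sub>n\<close> by that of \<open>x\<^sub>0, \<dots>, x\<^sub>n\<^sub>-\<^sub>1\<close> the operator \<open>T(t)\<close>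
is multiplication by \<open>e\<close> to the power \<open>\<mu>\<^sub>n t\<close>, and Riesz's lemma gives \<open>y\<^sub>n\<close> norm at least \<open>1/2\<close> there.\<close>

lemma separating_of_infinite_point_spectrum:
  assumes N: "0 \<le> N" and inf: "infinite {\<mu> \<in> point_spectrum D A. a \<le> Re \<mu>}"
  shows "separating (1/2) a N"
proof -
  obtain \<mu> :: "nat \<Rightarrow> complex" where \<mu>: "inj \<mu>" "range \<mu> \<subseteq> {\<mu> \<in> point_spectrum D A. a \<le> Re \<mu>}"
    using infinite_countable_subset[OF inf] by blast
  have "\<forall>n. \<exists>x. x \<in> D \<and> x \<noteq> 0 \<and> A x = \<mu> n *\<^sub>C x"
    using \<mu>(2) unfolding point_spectrum_def by blast
  from choice[OF this] obtain x where x: "\<And>n. x n \<in> D" "\<And>n. x n \<noteq> 0" "\<And>n. A (x n) = \<mu> n *\<^sub>C x n"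
    by blast
  let ?E = "\<lambda>n. cspan (x ` {..<n})"
  have indep: "x n \<notin> ?E n" for n
  proof
    assume "x n \<in> ?E n"
    moreover have "\<mu> n \<notin> \<mu> ` {..<n}" using \<mu>(1) by (auto simp: inj_def)
    ultimately have "x n = 0" using eigenvector_in_span_eq_0[OF x \<mu>(1), of "x n" n "\<mu> n"] x(3) by blast
    then show False using x(2) by blast
  qed
  obtain y r where y: "\<And>n. norm (y n) = 1" "\<And>n. y n - r n *\<^sub>R x n \<in> ?E n"
    "\<And>n g. g \<in> ?E n \<Longrightarrow> 1/2 \<le> norm (y n - g)"
    using Riesz_sequence[OF indep] by blast
  have Tx: "T t (x n) = exp (\<mu> n * of_real t) *\<^sub>C x n" if t: "0 \<le> t" for t n
  proof -
    obtain \<kappa> where \<kappa>: "0 < \<kappa>" "\<And>\<mu>' x t'. Re (\<mu> n) \<le> Re \<mu>' \<Longrightarrow> x \<in> D \<Longrightarrow> 0 \<le> t' \<Longrightarrow> t' \<le> t \<Longrightarrow>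
        norm (T t' x - exp (\<mu>' * complex_of_real t') *\<^sub>C x) \<le> \<kappa> * exp (Re \<mu>' * t') * norm (\<mu>' *\<^sub>C x - A x)"
      using approximate_eigenvector[OF t, of "Re (\<mu> n)"] by metis
    have "norm (T t (x n) - exp (\<mu> n * of_real t) *\<^sub>C x n) \<le> 0"
      using \<kappa>(2)[OF order_refl x(1)[of n] t order_refl] by (simp add: x(3))
    then show ?thesis by simp
  qed
  have T_E: "T t g \<in> ?E n" if t: "0 \<le> t" and g: "g \<in> ?E n" for t g n
  proof -
    have "?E n \<subseteq> {g. T t g \<in> ?E n}"
    proof (rule complex_vector.span_minimal)
      show "x ` {..<n} \<subseteq> {g. T t g \<in> ?E n}"
        by (auto simp: Tx t intro!: complex_vector.span_scale cspan_image_base)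
      show "complex_vector.subspace {g. T t g \<in> ?E n}"
        unfolding complex_vector.subspace_def using t
        by (auto simp: T_scaleC T_null
            T_plus complex_vector.span_zero
            intro: complex_vector.span_add complex_vector.span_scale)
    qed
    then show ?thesis using g by blast
  qed
  have y_E: "y m \<in> ?E n" if "m < n" for m n by (rule Riesz_in_span[OF y(2) that])
  have sep: "1/2 * exp (a * t) \<le> norm (T t (y m - y n))" if mn: "m < n" and t: "t \<in> {0..N}" for m n t
  proof -
    have t0: "0 \<le> t" using t by simp
    interpret Tt: bounded_linear "T t" by (rule T_linear[OF t0])
    define c where "c = exp (\<mu> n * of_real t)"
    have c: "c \<noteq> 0" "cmod c = exp (Re (\<mu> n) * t)" by (auto simp: c_def norm_exp_eq_Re)
    define f where "f = y n - r n *\<^sub>R x n"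
    have f: "f \<in> ?E n" using y(2) by (simp add: f_def)
    have yn: "y n = r n *\<^sub>R x n + f" by (simp add: f_def)
    have "T t (y n) = r n *\<^sub>R (c *\<^sub>C x n) + T t f"
      unfolding yn by (simp add: Tt.add Tt.scaleR Tx[OF t0] c_def)
    also have "\<dots> = c *\<^sub>C y n - (c *\<^sub>C f - T t f)"
      unfolding yn by (simp add: scaleC_add_right scaleC.scaleR_right)
    finally have Ty: "T t (y n) = c *\<^sub>C y n - (c *\<^sub>C f - T t f)" .
    define g where "g = inverse c *\<^sub>C ((c *\<^sub>C f - T t f) + T t (y m))"
    have "g \<in> ?E n" unfolding g_def
      by (intro complex_vector.span_scale complex_vector.span_add complex_vector.span_diff T_E t0 f y_E mn)
    have "c *\<^sub>C g = (c *\<^sub>C f - T t f) + T t (y m)"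
      using c(1) by (simp add: g_def scaleC_scaleC scaleC_one)
    then have "T t (y m - y n) = - (c *\<^sub>C (y n - g))"
      by (simp add: Tt.diff Ty scaleC.diff_right)
    then have "norm (T t (y m - y n)) = exp (Re (\<mu> n) * t) * norm (y n - g)" by (simp add: norm_scaleC c)
    moreover have "exp (Re (\<mu> n) * t) * (1/2) \<le> exp (Re (\<mu> n) * t) * norm (y n - g)"
      using y(3)[OF \<open>g \<in> ?E n\<close>] by (intro mult_left_mono) auto
    moreover have "exp (a * t) \<le> exp (Re (\<mu> n) * t)" using \<mu>(2) t0 by (auto intro: mult_right_mono)
    ultimately show ?thesis by linarith
  qed
  have "\<forall>\<^sub>F n in sequentially. \<forall>t\<in>{0..N}. 1/2 * exp (a * t) \<le> norm (T t (y m - y n))" for m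
    unfolding eventually_sequentially using sep by (intro exI[of _ "Suc m"]) auto
  then show ?thesis using y(1) unfolding separating_def by (intro exI[of _ y]) auto
qed

lemma J_scaleC: "0 \<le> t \<Longrightarrow> J t (c *\<^sub>C x) = c *\<^sub>C J t x"
proof -
  assume t: "0 \<le> t"
  have int: "(\<lambda>s. T s x) integrable_on {0..t}"
    by (intro integrable_continuous_interval T_continuous_Icc) simp
  have "J t (c *\<^sub>C x) = integral {0..t} (\<lambda>s. c *\<^sub>C T s x)"
    unfolding J_def by (rule integral_cong) (simp add: T_scaleC)
  also have "\<dots> = c *\<^sub>C J t x"
    unfolding J_def using integral_linear[OF int scaleC.bounded_linear_right[of c]] by (simp add: o_def)
  finally show ?thesis .
qed

text \<open>Since \<open>T(h)x\<^sub>n - x\<^sub>n = J h (A x\<^sub>n)\<close> and \<open>A x\<^sub>n\<close> is nearly \<open>\<mu>\<^sub>n x\<^sub>n\<close>, the vectors \<open>J h x\<^sub>n\<close> tend to \<open>0\<close>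
for fixed \<open>h\<close>. On the other hand \<open>J h x\<^sub>m\<close> is close to \<open>h x\<^sub>m\<close> for small \<open>h\<close>. As \<open>\<parallel>J h\<parallel> \<le> C h\<close>, this keeps \<open>x\<^sub>m\<close>
at distance at least \<open>1/(4C)\<close> from every unimodular multiple of \<open>x\<^sub>n\<close>, for all large \<open>n\<close>.\<close>

lemma separating_of_unbounded_frequencies:
  assumes N: "0 \<le> N" and C: "1 \<le> C" "\<And>s x. s \<in> {0..1} \<Longrightarrow> norm (T s x) \<le> C * norm x"
    and x: "\<And>n. x n \<in> D" "\<And>n. norm (x n) = 1"
    and \<mu>: "\<And>n. Re (\<mu> n) = a" "filterlim (\<lambda>n. cmod (\<mu> n)) at_top sequentially"
    and lim: "(\<lambda>n. B (\<mu> n) (x n)) \<longlonglongrightarrow> 0"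
  shows "separating (1 / (8 * C)) a N"
proof -
  have J_norm: "norm (J h z) \<le> C * h * norm z" if "0 < h" "h \<le> 1" for h z
  proof -
    have "norm (J h z) \<le> C * norm z * (h - 0)"
      unfolding J_def using C that by (intro integral_bound T_continuous_Icc) auto
    then show ?thesis by (simp add: mult_ac)
  qed
  have J_lim: "(\<lambda>n. J h (x n)) \<longlonglongrightarrow> 0" if h: "0 < h" "h \<le> 1" for h
  proof -
    interpret Jh: bounded_linear "J h" using J_linear h by simp
    have eq: "\<mu> n *\<^sub>C J h (x n) = T h (x n) - x n + J h (B (\<mu> n) (x n))" for n
      using T_diff_eq_J[OF less_imp_le[OF h(1)] x(1)[of n]] h
      by (simp add: Jh.diff J_scaleC)
    have bound: "norm (J h (x n)) \<le> (C + 1 + C * norm (B (\<mu> n) (x n))) * inverse (cmod (\<mu> n))" if "\<mu> n \<noteq> 0" for n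
    proof -
      have "cmod (\<mu> n) * norm (J h (x n)) = norm (T h (x n) - x n + J h (B (\<mu> n) (x n)))"
        using eq[of n] by (metis norm_scaleC)
      also have "\<dots> \<le> norm (T h (x n)) + norm (x n) + norm (J h (B (\<mu> n) (x n)))"
        using norm_triangle_ineq[of "T h (x n) - x n" "J h (B (\<mu> n) (x n))"]
          norm_triangle_ineq4[of "T h (x n)" "x n"] by linarith
      also have "norm (T h (x n)) \<le> C" using C(2)[of h "x n"] h x(2) by simp
      also have "norm (J h (B (\<mu> n) (x n))) \<le> C * norm (B (\<mu> n) (x n))"
      proof -
        have "C * h * norm (B (\<mu> n) (x n)) \<le> C * 1 * norm (B (\<mu> n) (x n))"
          using h C(1) by (intro mult_right_mono mult_left_mono) auto
        then show ?thesis using J_norm[OF h, of "B (\<mu> n) (x n)"] by linarith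
      qed
      finally show ?thesis using that x(2)[of n] by (simp add: field_simps)
    qed
    have "(\<lambda>n. (C + 1 + C * norm (B (\<mu> n) (x n))) * inverse (cmod (\<mu> n))) \<longlonglongrightarrow> (C + 1 + C * norm (0::'a)) * 0"
      by (intro tendsto_mult tendsto_add tendsto_const tendsto_norm lim tendsto_inverse_0_at_top \<mu>(2))
    then have "(\<lambda>n. (C + 1 + C * norm (B (\<mu> n) (x n))) * inverse (cmod (\<mu> n))) \<longlonglongrightarrow> 0" by simp
    moreover have "\<forall>\<^sub>F n in sequentially. norm (J h (x n)) \<le> (C + 1 + C * norm (B (\<mu> n) (x n))) * inverse (cmod (\<mu> n))"
    proof -
      have "\<forall>\<^sub>F n in sequentially. 1 \<le> cmod (\<mu> n)" using \<mu>(2) unfolding filterlim_at_top by blast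
      then show ?thesis by (rule eventually_mono) (use bound in force)
    qed
    ultimately show ?thesis by (rule Lim_null_comparison[rotated])
  qed
  obtain \<kappa> where \<kappa>: "0 < \<kappa>" "\<And>\<mu> x t. a \<le> Re \<mu> \<Longrightarrow> x \<in> D \<Longrightarrow> 0 \<le> t \<Longrightarrow> t \<le> N \<Longrightarrow>
    norm (T t x - exp (\<mu> * of_real t) *\<^sub>C x) \<le> \<kappa> * exp (Re \<mu> * t) * norm (B \<mu> x)"
    using approximate_eigenvector[OF N, of a] by metis
  have "0 < 1 / (16 * C * \<kappa>)" using C(1) \<kappa>(1) by simp
  then obtain n0 where n0: "\<forall>n\<ge>n0. norm (B (\<mu> n) (x n) - 0) < 1 / (16 * C * \<kappa>)"
    using lim unfolding LIMSEQ_iff by blast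
  \<comment> \<open>discarding finitely many terms makes the defects negligible on \<open>[0,N]\<close>\<close>
  define v where "v n = x (n + n0)" for n
  define \<nu> where "\<nu> n = \<mu> (n + n0)" for n
  have v: "v n \<in> D" "norm (v n) = 1" "Re (\<nu> n) = a" for n by (auto simp: v_def \<nu>_def x \<mu>)
  have Tv: "norm (T t (v n) - exp (\<nu> n * of_real t) *\<^sub>C v n) \<le> exp (a * t) * (1 / (16 * C))"
    if "0 \<le> t" "t \<le> N" for t n
  proof -
    have "norm (T t (v n) - exp (\<nu> n * of_real t) *\<^sub>C v n) \<le> \<kappa> * exp (a * t) * norm (B (\<nu> n) (v n))"
      using \<kappa>(2)[of "\<nu> n" "v n" t] v that by simp
    also have "\<dots> \<le> \<kappa> * exp (a * t) * (1 / (16 * C * \<kappa>))"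
      using n0[rule_format, of "n + n0"] \<kappa>(1) by (intro mult_left_mono) (auto simp: v_def \<nu>_def)
    also have "\<dots> = exp (a * t) * (1 / (16 * C))" using \<kappa>(1) by simp
    finally show ?thesis .
  qed
  have "\<forall>\<^sub>F n in sequentially. \<forall>t\<in>{0..N}. 1 / (8 * C) * exp (a * t) \<le> norm (T t (v m - v n))" for m
  proof -
    have "((\<lambda>h. (1/h) *\<^sub>R (J (0 + h) (v m) - J 0 (v m))) \<longlongrightarrow> T 0 (v m)) (at_right 0)"
      by (rule average_J) simp
    then have "((\<lambda>h. norm ((1/h) *\<^sub>R J h (v m))) \<longlongrightarrow> 1) (at_right 0)"
      using tendsto_norm v(2)[of m] by (fastforce simp: J_zero T_zero)
    then have "\<forall>\<^sub>F h in at_right 0. 1/2 < norm ((1/h) *\<^sub>R J h (v m))" by (rule order_tendstoD) simp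
    moreover have "\<forall>\<^sub>F h in at_right (0::real). 0 < h \<and> h < 1"
      unfolding eventually_at_right_field by (intro exI[of _ 1]) auto
    ultimately have "\<forall>\<^sub>F h in at_right 0. 1/2 < norm ((1/h) *\<^sub>R J h (v m)) \<and> 0 < h \<and> h < 1"
      by (rule eventually_conj)
    then obtain h where "1/2 < norm ((1/h) *\<^sub>R J h (v m)) \<and> 0 < h \<and> h < 1"
      using eventually_happens[of _ "at_right (0::real)"] by force
    then have h: "0 < h" "h \<le> 1" "h / 2 < norm (J h (v m))" by (auto simp: field_simps)
    interpret Jh: bounded_linear "J h" using J_linear h by simp
    have "(\<lambda>n. J h (v n)) \<longlonglongrightarrow> 0"
      unfolding v_def using LIMSEQ_ignore_initial_segment[OF J_lim[OF h(1,2)]] .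
    then have "\<forall>\<^sub>F n in sequentially. norm (J h (v n)) < h / 4"
      using h(1) tendsto_norm_zero order_tendstoD(2)[of "\<lambda>n. norm (J h (v n))" 0 sequentially "h / 4"] by auto
    then show ?thesis
    proof (rule eventually_mono, intro ballI)
      fix n t assume n: "norm (J h (v n)) < h / 4" and t: "t \<in> {0..N}"
      have tN: "0 \<le> t" "t \<le> N" using t by auto
      interpret Tt: bounded_linear "T t" by (rule T_linear[OF tN(1)])
      define c where "c = exp (\<nu> m * of_real t)"
      define c' where "c' = exp (\<nu> n * of_real t)"
      have cc: "cmod c = exp (a * t)" "cmod c' = exp (a * t)" by (auto simp: c_def c'_def norm_exp_eq_Re v)
      have "c \<noteq> 0" by (simp add: c_def)
      define \<theta> where "\<theta> = c' / c"
      have \<theta>: "cmod \<theta> = 1" using cc by (simp add: \<theta>_def norm_divide)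
      have "h / 4 \<le> norm (J h (v m)) - norm (J h (v n))" using h(3) n by simp
      also have "\<dots> = norm (J h (v m)) - norm (\<theta> *\<^sub>C J h (v n))" by (simp add: norm_scaleC \<theta>)
      also have "\<dots> \<le> norm (J h (v m) - \<theta> *\<^sub>C J h (v n))" by (rule norm_triangle_ineq2)
      also have "J h (v m) - \<theta> *\<^sub>C J h (v n) = J h (v m - \<theta> *\<^sub>C v n)"
        using h(1) by (simp add: Jh.diff J_scaleC)
      also have "norm \<dots> \<le> C * h * norm (v m - \<theta> *\<^sub>C v n)" by (rule J_norm[OF h(1,2)])
      finally have main: "1 / (4 * C) \<le> norm (v m - \<theta> *\<^sub>C v n)" using h(1) C(1) by (simp add: field_simps)
      have "exp (a * t) * (1 / (4 * C)) \<le> exp (a * t) * norm (v m - \<theta> *\<^sub>C v n)"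
        using main by (intro mult_left_mono) auto
      also have "\<dots> = norm (c *\<^sub>C (v m - \<theta> *\<^sub>C v n))" by (simp add: norm_scaleC cc)
      also have "c *\<^sub>C (v m - \<theta> *\<^sub>C v n) = c *\<^sub>C v m - c' *\<^sub>C v n"
        using \<open>c \<noteq> 0\<close> by (simp add: scaleC.diff_right scaleC_scaleC \<theta>_def)
      also have "\<dots> = T t (v m - v n) - ((T t (v m) - c *\<^sub>C v m) - (T t (v n) - c' *\<^sub>C v n))"
        by (simp add: Tt.diff)
      also have "norm \<dots> \<le> norm (T t (v m - v n)) + (norm (T t (v m) - c *\<^sub>C v m) + norm (T t (v n) - c' *\<^sub>C v n))"
        by (meson add_left_mono norm_triangle_ineq4 order_trans)
      also have "\<dots> \<le> norm (T t (v m - v n)) + (exp (a * t) * (1 / (16 * C)) + exp (a * t) * (1 / (16 * C)))"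
        unfolding c_def c'_def by (intro add_left_mono add_mono Tv tN)
      finally show "1 / (8 * C) * exp (a * t) \<le> norm (T t (v m - v n))" by (simp add: field_simps)
    qed
  qed
  then show ?thesis using v(2) unfolding separating_def by (intro exI[of _ v]) auto
qed

section \<open>Fredholm properties and the resolvent bound\<close>

text \<open>This compactness property of \<open>\<mu> - A\<close> is equivalent to having finite-dimensional kernel and closed
range, and it is the form in which the absence of separating sequences is used.\<close>

definition tame :: "complex \<Rightarrow> bool" where
  "tame \<mu> \<longleftrightarrow> (\<forall>u M y. (\<forall>n::nat. u n \<in> D \<and> norm (u n) \<le> M) \<longrightarrow> (\<lambda>n. B \<mu> (u n)) \<longlonglongrightarrow> y \<longrightarrow>
    (\<exists>r l. strict_mono r \<and> (\<lambda>n. u (r n)) \<longlonglongrightarrow> l \<and> l \<in> D \<and> B \<mu> l = y))"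

lemma tameI:
  assumes "0 \<le> N" "a \<le> Re \<mu>" "\<not> separating (1/4) a N"
  shows "tame \<mu>"
  unfolding tame_def
proof (intro allI impI)
  fix u :: "nat \<Rightarrow> 'a" and M y
  assume u: "\<forall>n. u n \<in> D \<and> norm (u n) \<le> M" and y: "(\<lambda>n. B \<mu> (u n)) \<longlonglongrightarrow> y"
  have "has_convergent_subseq u"
    using separating_of_approximate_kernel[OF assms(1,2) _ _ y] u assms(3) by blast
  then obtain r :: "nat \<Rightarrow> nat" and l where r: "strict_mono r" "(\<lambda>n. u (r n)) \<longlonglongrightarrow> l"
    unfolding has_convergent_subseq_def by blast
  have "(\<lambda>n. B \<mu> (u (r n))) \<longlonglongrightarrow> y"
    using LIMSEQ_subseq_LIMSEQ[OF y r(1)] by (simp add: o_def)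
  then have "l \<in> D" "B \<mu> l = y" using B_closed[of "\<lambda>n. u (r n)"] u r(2) by auto
  then show "\<exists>r l. strict_mono r \<and> (\<lambda>n. u (r n)) \<longlonglongrightarrow> l \<and> l \<in> D \<and> B \<mu> l = y" using r by blast
qed

lemma tameD:
  fixes u :: "nat \<Rightarrow> 'a"
  assumes "tame \<mu>" "\<And>n. u n \<in> D" "\<And>n. norm (u n) \<le> M" "(\<lambda>n. B \<mu> (u n)) \<longlonglongrightarrow> y"
  shows "\<exists>(r :: nat \<Rightarrow> nat) l. strict_mono r \<and> (\<lambda>n. u (r n)) \<longlonglongrightarrow> l \<and> l \<in> D \<and> B \<mu> l = y"
  using assms unfolding tame_def by blast

lemma tame_unit_limit:
  fixes u :: "nat \<Rightarrow> 'a"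
  assumes "tame \<mu>" "\<And>n. u n \<in> D" "\<And>n. norm (u n) = 1" "(\<lambda>n. B \<mu> (u n)) \<longlonglongrightarrow> 0"
  shows "\<exists>(r :: nat \<Rightarrow> nat) l. strict_mono r \<and> (\<lambda>n. u (r n)) \<longlonglongrightarrow> l \<and> l \<in> kernel \<mu> \<and> norm l = 1"
proof -
  obtain r :: "nat \<Rightarrow> nat" and l where r: "strict_mono r" "(\<lambda>n. u (r n)) \<longlonglongrightarrow> l" "l \<in> D" "B \<mu> l = 0"
    using tameD[OF assms(1,2) _ assms(4), of 1] assms(3) by auto
  have "(\<lambda>n. norm (u (r n))) \<longlonglongrightarrow> norm l" by (rule tendsto_norm[OF r(2)])
  then have "norm l = 1" using assms(3) LIMSEQ_unique[OF _ tendsto_const[of 1]] by auto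
  then show ?thesis using r by blast
qed

lemma approximate_kernel_near_kernel:
  assumes tame: "tame \<mu>" and e: "0 < e"
  shows "\<exists>\<epsilon>>0. \<forall>x\<in>D. norm x = 1 \<longrightarrow> norm (B \<mu> x) \<le> \<epsilon> \<longrightarrow> (\<exists>z\<in>kernel \<mu>. norm z = 1 \<and> norm (x - z) < e)"
proof (rule ccontr)
  assume no: "\<not> ?thesis"
  have "\<exists>x. x \<in> D \<and> norm x = 1 \<and> norm (B \<mu> x) \<le> 1 / real (Suc n) \<and> (\<forall>z\<in>kernel \<mu>. norm z = 1 \<longrightarrow> e \<le> norm (x - z))"
    (is "\<exists>x. ?P n x") for n :: nat
  proof -
    have "1 / real (Suc n) > 0" by simp
    then have "\<not> (\<forall>x\<in>D. norm x = 1 \<longrightarrow> norm (B \<mu> x) \<le> 1 / real (Suc n) \<longrightarrow> (\<exists>z\<in>kernel \<mu>. norm z = 1 \<and> norm (x - z) < e))"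
      using no by blast
    then show ?thesis by (auto simp: not_less)
  qed
  then have "\<exists>x. \<forall>n. ?P n (x n)" by (intro choice allI)
  then obtain x where "\<And>n. ?P n (x n)" by blast
  then have x: "\<And>n. x n \<in> D" "\<And>n. norm (x n) = 1" "\<And>n. norm (B \<mu> (x n)) \<le> 1 / real (Suc n)"
    "\<And>n z. z \<in> kernel \<mu> \<Longrightarrow> norm z = 1 \<Longrightarrow> e \<le> norm (x n - z)" by blast+
  have "(\<lambda>n. B \<mu> (x n)) \<longlonglongrightarrow> 0" by (rule LIMSEQ_norm_le_inverse[OF x(3)])
  from tame_unit_limit[OF tame x(1,2) this]
  obtain r :: "nat \<Rightarrow> nat" and l where r: "strict_mono r" "(\<lambda>n. x (r n)) \<longlonglongrightarrow> l" "l \<in> kernel \<mu>" "norm l = 1"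
    by blast
  obtain n where "norm (x (r n) - l) < e" using r(2) e unfolding LIMSEQ_iff by blast
  then show False using x(4)[OF r(3,4), of "r n"] by simp
qed

lemma bounded_below_of_not_eigenvalue:
  assumes tame: "tame \<mu>" and "\<mu> \<notin> point_spectrum D A"
  shows "bounded_below \<mu>"
proof -
  obtain \<epsilon> where \<epsilon>: "\<epsilon> > 0" "\<forall>x\<in>D. norm x = 1 \<longrightarrow> norm (B \<mu> x) \<le> \<epsilon> \<longrightarrow> (\<exists>z\<in>kernel \<mu>. norm z = 1 \<and> norm (x - z) < 1)"
    using approximate_kernel_near_kernel[OF tame zero_less_one] by blast
  have ker: "z = 0" if "z \<in> kernel \<mu>" for z
    using assms(2) that by (auto simp: point_spectrum_def)
  have "\<epsilon> * norm x \<le> norm (B \<mu> x)" if x: "x \<in> D" for x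
  proof (cases "x = 0")
    case False
    let ?u = "(1 / norm x) *\<^sub>R x"
    have u: "?u \<in> D" "norm ?u = 1" using x False generator_scaleR by auto
    have "\<not> norm (B \<mu> ?u) \<le> \<epsilon>"
    proof
      assume "norm (B \<mu> ?u) \<le> \<epsilon>"
      then obtain z where "z \<in> kernel \<mu>" "norm z = 1" using \<epsilon>(2) u by blast
      then show False using ker by fastforce
    qed
    then have "\<epsilon> < norm (B \<mu> ?u)" by simp
    also have "norm (B \<mu> ?u) = norm (B \<mu> x) / norm x" unfolding B_scaleR[OF x] by simp
    finally show ?thesis using False by (simp add: field_simps)
  qed simp
  then show ?thesis using \<epsilon>(1) by blast
qed

lemma finite_dim_kernel:
  assumes "tame \<mu>"
  shows "finite_cdim (kernel \<mu>)"
proof (rule ccontr)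
  assume "\<not> ?thesis"
  then have "\<exists>x\<in>kernel \<mu>. x \<notin> cspan F" if "finite F" for F
    using that unfolding finite_cdim_def by blast
  from avoiding_sequence[of "kernel \<mu>" cspan, OF this]
  obtain x where x: "\<And>n. x n \<in> kernel \<mu>" "\<And>n::nat. x n \<notin> cspan (x ` {..<n})"
    by blast
  obtain y r where y: "\<And>n. norm (y n) = 1" "\<And>n. y n - r n *\<^sub>R x n \<in> cspan (x ` {..<n})"
    "\<And>n g. g \<in> cspan (x ` {..<n}) \<Longrightarrow> 1/2 \<le> norm (y n - g)"
    using Riesz_sequence[OF x(2)] by blast
  have y_E: "y m \<in> cspan (x ` {..<n})" if "m < n" for m n by (rule Riesz_in_span[OF y(2) that])
  have "y n \<in> kernel \<mu>" for n
  proof -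
    have "cspan (x ` {..<Suc n}) \<subseteq> kernel \<mu>"
      by (rule complex_vector.span_minimal[OF _ kernel_subspace]) (use x(1) in auto)
    then show ?thesis using y_E[of n "Suc n"] by blast
  qed
  then have yk: "y n \<in> D" "B \<mu> (y n) = 0" for n by auto
  have "1/2 \<le> norm (y m - y n)" if "m < n" for m n
    using y(3)[OF y_E[OF that]] by (simp add: norm_minus_commute)
  then have "\<not> has_convergent_subseq y" by (intro not_convergent_separated[of "1/2"]) auto
  moreover have "has_convergent_subseq y"
    using tameD[where u = y and M = 1 and y = 0, OF assms yk(1)] y(1) yk(2)
    unfolding has_convergent_subseq_def by auto
  ultimately show False by blast
qed

text \<open>Preimages are chosen nearly minimal modulo the kernel. If they are bounded, tameness applies
directly. If not, the normalised preimages accumulate at a kernel vector, and subtracting a multiple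
of it contradicts minimality.\<close>

lemma closed_range:
  assumes tame: "tame \<mu>"
  shows "closed (B \<mu> ` D)"
  unfolding closed_sequential_limits
proof (intro allI impI, elim conjE)
  fix y :: "nat \<Rightarrow> 'a" and l
  assume yD: "\<forall>n. y n \<in> B \<mu> ` D" and yl: "y \<longlonglongrightarrow> l"
  have "\<forall>n. \<exists>x. x \<in> D \<and> B \<mu> x = y n"
  proof
    fix n
    have "y n \<in> B \<mu> ` D" using yD by blast
    then obtain x where "y n = B \<mu> x" "x \<in> D" by (rule imageE)
    then show "\<exists>x. x \<in> D \<and> B \<mu> x = y n" by auto
  qed
  from choice[OF this] obtain x0 where x0: "\<And>n. x0 n \<in> D" "\<And>n. B \<mu> (x0 n) = y n" by blast
  have ne: "kernel \<mu> \<noteq> {}" using complex_vector.subspace_0[OF kernel_subspace] by blast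
  have "\<forall>n. \<exists>z. z \<in> kernel \<mu> \<and> dist (x0 n) z < infdist (x0 n) (kernel \<mu>) + 1"
  proof
    fix n
    have "(INF z\<in>kernel \<mu>. dist (x0 n) z) < infdist (x0 n) (kernel \<mu>) + 1"
      unfolding infdist_notempty[OF ne] by simp
    then obtain c where "c \<in> dist (x0 n) ` kernel \<mu>" "c < infdist (x0 n) (kernel \<mu>) + 1"
      using cInf_lessD[of "dist (x0 n) ` kernel \<mu>"] ne by blast
    then show "\<exists>z. z \<in> kernel \<mu> \<and> dist (x0 n) z < infdist (x0 n) (kernel \<mu>) + 1" by blast
  qed
  from choice[OF this] obtain z
    where z: "\<And>n. z n \<in> kernel \<mu>" "\<And>n. dist (x0 n) (z n) < infdist (x0 n) (kernel \<mu>) + 1"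
    by blast
  define x where "x n = x0 n - z n" for n
  have zD: "z n \<in> D" "B \<mu> (z n) = 0" for n using z(1)[of n] by auto
  have xD: "x n \<in> D" for n unfolding x_def by (rule generator_diff(1)[OF x0(1) zD(1)])
  have Bx: "B \<mu> (x n) = y n" for n unfolding x_def B_diff[OF x0(1) zD(1)] by (simp add: zD x0)
  have x_min: "norm (x n) < norm (x n - w) + 1" if w: "w \<in> kernel \<mu>" for n w
  proof -
    have "z n + w \<in> kernel \<mu>" by (rule complex_vector.subspace_add[OF kernel_subspace z(1) w])
    then have "infdist (x0 n) (kernel \<mu>) \<le> dist (x0 n) (z n + w)" by (rule infdist_le)
    then show ?thesis using z(2)[of n] by (simp add: x_def dist_norm algebra_simps)
  qed
  show "l \<in> B \<mu> ` D"
  proof (cases "\<exists>M. \<forall>n. norm (x n) \<le> M")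
    case True
    then obtain M where "\<And>n. norm (x n) \<le> M" by blast
    moreover have "(\<lambda>n. B \<mu> (x n)) \<longlonglongrightarrow> l" using yl by (simp add: Bx)
    ultimately obtain w where "w \<in> D" "B \<mu> w = l"
      using tameD[where u = x, OF tame xD] by blast
    then show ?thesis by (intro image_eqI[of _ _ w]) simp_all
  next
    case False
    then have "\<forall>k::nat. \<exists>n. real (Suc k) + 4 < norm (x n)" by (meson not_le)
    from choice[OF this] obtain q where q: "\<And>k::nat. real (Suc k) + 4 < norm (x (q k))" by blast
    obtain Y where Y: "\<And>n. norm (y n) \<le> Y" "0 < Y"
      using convergent_imp_bounded[OF yl] by (auto simp: bounded_pos)
    have pos: "0 < norm (x (q k))" for k by (rule le_less_trans[OF _ q[of k]]) simp
    define u where "u k = (1 / norm (x (q k))) *\<^sub>R x (q k)" for k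
    have u: "u k \<in> D" "norm (u k) = 1" for k
      using pos[of k] generator_scaleR(1)[OF xD] by (auto simp: u_def)
    have "norm ((1 / Y) *\<^sub>R B \<mu> (u k)) \<le> 1 / real (Suc k)" for k
    proof -
      have "norm ((1 / Y) *\<^sub>R B \<mu> (u k)) = norm (y (q k)) / Y / norm (x (q k))"
        unfolding u_def B_scaleR[OF xD] using Y(2) by (simp add: Bx)
      also have "\<dots> \<le> 1 / norm (x (q k))" using Y by (intro divide_right_mono) (auto simp: field_simps)
      also have "\<dots> \<le> 1 / real (Suc k)" using q[of k] pos[of k] by (intro divide_left_mono mult_pos_pos) auto
      finally show ?thesis .
    qed
    then have "(\<lambda>k. (1 / Y) *\<^sub>R B \<mu> (u k)) \<longlonglongrightarrow> 0" by (rule LIMSEQ_norm_le_inverse)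
    then have "(\<lambda>k. Y *\<^sub>R (1 / Y) *\<^sub>R B \<mu> (u k)) \<longlonglongrightarrow> Y *\<^sub>R 0" by (intro tendsto_scaleR tendsto_const)
    then have "(\<lambda>k. B \<mu> (u k)) \<longlonglongrightarrow> 0" using Y(2) by simp
    from tame_unit_limit[OF tame u this]
    obtain r :: "nat \<Rightarrow> nat" and w where w: "(\<lambda>n. u (r n)) \<longlonglongrightarrow> w" "w \<in> kernel \<mu>" by blast
    have half: "(0::real) < 1/2" by simp
    obtain n where n: "norm (u (r n) - w) < 1/2"
      using w(1) half unfolding LIMSEQ_iff by blast
    let ?s = "norm (x (q (r n)))"
    have "?s *\<^sub>R w \<in> kernel \<mu>"
      using complex_vector.subspace_scale[OF kernel_subspace w(2), of "complex_of_real ?s"]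
      by (simp add: scaleC_of_real)
    then have "?s < norm (x (q (r n)) - ?s *\<^sub>R w) + 1" by (rule x_min)
    also have "x (q (r n)) - ?s *\<^sub>R w = ?s *\<^sub>R (u (r n) - w)"
      using pos[of "r n"] by (simp add: u_def scaleR_diff_right)
    also have "norm \<dots> = ?s * norm (u (r n) - w)" by simp
    also have "\<dots> \<le> ?s * (1/2)" using n by (intro mult_left_mono) auto
    finally show ?thesis using q[of "r n"] by simp
  qed
qed

text \<open>Let \<open>r\<^sub>0\<close> be the infimum of the \<open>r\<close> beyond which surjectivity holds on the whole ray. Stability
from the right gives surjectivity at \<open>r\<^sub>0\<close>, and stability around \<open>r\<^sub>0\<close> excludes \<open>r\<^sub>0 > 0\<close>.\<close>

lemma surjective_of_clear_ray:
  assumes below: "\<And>r. 0 \<le> r \<Longrightarrow> bounded_below (\<mu> + of_real r)"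
  shows "surjective \<mu>"
proof -
  obtain \<omega> where \<omega>: "\<And>\<mu>. \<omega> < Re \<mu> \<Longrightarrow> bounded_below \<mu> \<and> surjective \<mu>"
    by (rule right_half_plane) blast
  define S where "S = {r. 0 \<le> r \<and> (\<forall>r'\<ge>r. surjective (\<mu> + of_real r'))}"
  have ne: "S \<noteq> {}"
  proof -
    have "surjective (\<mu> + of_real r')" if "r' \<ge> max 0 (\<omega> - Re \<mu> + 1)" for r'
      using \<omega>[of "\<mu> + of_real r'"] that by auto
    then have "max 0 (\<omega> - Re \<mu> + 1) \<in> S" by (auto simp: S_def)
    then show ?thesis by blast
  qed
  have bdd: "bdd_below S" by (auto simp: S_def intro: bdd_belowI[of _ 0])
  define r0 where "r0 = Inf S"
  have r0: "0 \<le> r0" unfolding r0_def by (rule cInf_greatest[OF ne]) (simp add: S_def)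
  obtain \<gamma> where \<gamma>: "\<gamma> > 0" "\<And>x. x \<in> D \<Longrightarrow> \<gamma> * norm x \<le> norm (B (\<mu> + of_real r0) x)"
    using below[OF r0] by blast
  obtain r where r: "r \<in> S" "r < r0 + \<gamma>/2"
    using cInf_lessD[OF ne, of "r0 + \<gamma>/2"] \<gamma>(1) unfolding r0_def by auto
  have "r0 \<le> r" unfolding r0_def by (rule cInf_lower[OF r(1) bdd])
  have surj0: "surjective (\<mu> + of_real r0)"
  proof
    fix y
    show "\<exists>x\<in>D. B (\<mu> + of_real r0) x = y"
    proof (rule surjective_stable[where \<gamma> = "\<gamma>/2"])
      show "0 < \<gamma>/2" using \<gamma>(1) by simp
      show "\<gamma>/2 * norm x \<le> norm (B (\<mu> + of_real r) x)" if "x \<in> D" for x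
      proof -
        have eq: "B (\<mu> + of_real r0) x = B (\<mu> + of_real r) x - (r - r0) *\<^sub>R x"
          by (simp add: scaleC_add_left scaleC_of_real scaleR_diff_left)
        have "norm ((r - r0) *\<^sub>R x) = (r - r0) * norm x" using \<open>r0 \<le> r\<close> by simp
        then have "norm (B (\<mu> + of_real r0) x) \<le> norm (B (\<mu> + of_real r) x) + (r - r0) * norm x"
          unfolding eq using norm_triangle_ineq4[of "B (\<mu> + of_real r) x" "(r - r0) *\<^sub>R x"] by linarith
        moreover have "(r - r0) * norm x \<le> \<gamma>/2 * norm x" using r(2) by (intro mult_right_mono) auto
        ultimately show ?thesis using \<gamma>(2)[OF that] by linarith
      qed
      show "\<exists>x\<in>D. B (\<mu> + of_real r) x = y" for y using r(1) by (simp add: S_def)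
      have "cmod ((\<mu> + of_real r0) - (\<mu> + of_real r)) = r - r0"
        using \<open>r0 \<le> r\<close> by (metis abs_minus_commute abs_of_nonneg add_diff_cancel_left
            diff_ge_0_iff_ge norm_of_real of_real_diff)
      then show "cmod ((\<mu> + of_real r0) - (\<mu> + of_real r)) < \<gamma>/2" using r(2) by simp
    qed
  qed
  have surj_near: "surjective (\<mu> + of_real r')" if "\<bar>r' - r0\<bar> < \<gamma>" for r'
  proof
    fix y
    show "\<exists>x\<in>D. B (\<mu> + of_real r') x = y"
    proof (rule surjective_stable[where \<gamma> = \<gamma> and \<mu> = "\<mu> + of_real r0"])
      have "cmod ((\<mu> + of_real r') - (\<mu> + of_real r0)) = \<bar>r' - r0\<bar>"
        by (metis add_diff_cancel_left norm_of_real of_real_diff)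
      then show "cmod ((\<mu> + of_real r') - (\<mu> + of_real r0)) < \<gamma>" using that by simp
    qed (use \<gamma> surj0 in auto)
  qed
  have surj_right: "surjective (\<mu> + of_real r')" if r': "r' > r0" for r'
  proof -
    obtain p where "p \<in> S" "p < r'" using cInf_lessD[OF ne, of r'] r' unfolding r0_def by auto
    then show ?thesis by (auto simp: S_def)
  qed
  have "surjective (\<mu> + of_real r')" if "r' \<ge> max 0 (r0 - \<gamma>/2)" for r'
  proof (cases "r' > r0")
    case False
    then have "\<bar>r' - r0\<bar> < \<gamma>" using that \<gamma>(1) by simp
    then show ?thesis by (rule surj_near)
  qed (rule surj_right)
  then have "max 0 (r0 - \<gamma>/2) \<in> S" unfolding S_def by simp
  then have "r0 \<le> max 0 (r0 - \<gamma>/2)" unfolding r0_def by (rule cInf_lower[OF _ bdd])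
  then have "r0 = 0" using \<gamma>(1) r0 by (auto simp: max_def split: if_splits)
  then show ?thesis using surj0 by simp
qed


lemma compact_kernel_sphere:
  assumes tame: "tame \<mu>"
  shows "compact {z \<in> kernel \<mu>. norm z = 1}"
  unfolding compact_eq_seq_compact_metric seq_compact_def
proof (intro allI impI)
  fix u :: "nat \<Rightarrow> 'a" assume u: "\<forall>n. u n \<in> {z \<in> kernel \<mu>. norm z = 1}"
  then have "\<And>n. u n \<in> D" "\<And>n. norm (u n) = 1" "(\<lambda>n. B \<mu> (u n)) \<longlonglongrightarrow> 0" by auto
  from tame_unit_limit[OF tame this]
  show "\<exists>l\<in>{z \<in> kernel \<mu>. norm z = 1}. \<exists>r. strict_mono r \<and> (u \<circ> r) \<longlonglongrightarrow> l"
    unfolding o_def by auto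
qed

text \<open>If the codimension is infinite, choose \<open>d + 1\<close> vectors that are independent modulo the closed
range, where \<open>d\<close> balls of radius \<open>1/8\<close> cover the unit sphere of the kernel. For \<open>\<mu>'\<close> near \<open>\<mu>\<close>, their
preimages under \<open>\<mu>' - A\<close> span a space on whose unit vectors \<open>u\<close> the norm of \<open>(\<mu> - A)u\<close> is small,
because the distance of \<open>(\<mu>' - A)u\<close> from the range is at least a multiple of its norm, while
\<open>(\<mu>' - A)u - (\<mu>' - \<mu>)u\<close> belongs to the range. Hence such \<open>u\<close> lie near the unit sphere of the kernel. A Riesz
sequence of length \<open>d + 1\<close> in this space contradicts the pigeonhole principle.\<close>

lemma finite_codim_range:
  assumes tame: "tame \<mu>"
    and approx: "\<And>\<epsilon>. 0 < \<epsilon> \<Longrightarrow> \<exists>\<mu>'. cmod (\<mu>' - \<mu>) < \<epsilon> \<and> surjective \<mu>'"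
  shows "finite_ccodim (B \<mu> ` D)"
proof (rule ccontr)
  let ?R = "B \<mu> ` D"
  assume nfin: "\<not> finite_ccodim ?R"
  have "\<exists>y\<in>UNIV. y \<notin> cspan (?R \<union> F)" if "finite F" for F
    using nfin that unfolding finite_ccodim_def by blast
  from avoiding_sequence[of UNIV "\<lambda>F. cspan (?R \<union> F)", OF this]
  obtain y :: "nat \<Rightarrow> 'a" where y: "\<And>n. y n \<notin> cspan (?R \<union> y ` {..<n})" by blast
  have eighth: "(0::real) < 1/8" by simp
  from compact_kernel_sphere[OF tame, unfolded compact_eq_totally_bounded, THEN conjunct2, rule_format, OF eighth]
  obtain k where k: "finite k" "{z \<in> kernel \<mu>. norm z = 1} \<subseteq> (\<Union>x\<in>k. ball x (1/8))"
    by blast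
  define d where "d = card k"
  let ?Y = "cspan (y ` {..<Suc d})"
  have Y0: "v = 0" if "v \<in> ?Y" "v \<in> ?R" for v
    by (rule span_Int_range[OF range_subspace y that])
  obtain \<kappa> where \<kappa>: "\<kappa> > 0" "\<forall>v\<in>?Y. \<kappa> * norm v \<le> infdist v ?R"
    using span_away_from_closed_subspace[OF _ range_subspace closed_range[OF tame] Y0] by blast
  obtain \<epsilon> where \<epsilon>: "\<epsilon> > 0" "\<forall>x\<in>D. norm x = 1 \<longrightarrow> norm (B \<mu> x) \<le> \<epsilon> \<longrightarrow>
      (\<exists>z\<in>kernel \<mu>. norm z = 1 \<and> norm (x - z) < 1/8)"
    using approximate_kernel_near_kernel[OF tame, of "1/8"] by auto
  have "0 < \<epsilon> / (1 + 1 / \<kappa>)" using \<epsilon>(1) \<kappa>(1) by (simp add: add_pos_pos)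
  from approx[OF this] obtain \<mu>' where \<mu>': "cmod (\<mu>' - \<mu>) < \<epsilon> / (1 + 1 / \<kappa>)" "surjective \<mu>'" by blast
  have "\<forall>n. \<exists>x. x \<in> D \<and> B \<mu>' x = y n" using \<mu>'(2) by blast
  from choice[OF this] obtain x where x: "\<And>n. x n \<in> D" "\<And>n. B \<mu>' (x n) = y n" by blast
  have span: "v \<in> D" "B \<mu>' v \<in> cspan (y ` {..<n})" if "v \<in> cspan (x ` {..<n})" for v n
  proof -
    have "cspan (x ` {..<n}) \<subseteq> {v \<in> D. B \<mu>' v \<in> cspan (y ` {..<n})}"
    proof (rule complex_vector.span_minimal)
      show "x ` {..<n} \<subseteq> {v \<in> D. B \<mu>' v \<in> cspan (y ` {..<n})}"
        using x by (auto intro: cspan_image_base)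
    qed (rule preimage_subspace[OF complex_vector.subspace_span])
    then show "v \<in> D" "B \<mu>' v \<in> cspan (y ` {..<n})" using that by auto
  qed
  have indep: "x n \<notin> cspan (x ` {..<n})" for n
  proof
    assume "x n \<in> cspan (x ` {..<n})"
    then have "y n \<in> cspan (y ` {..<n})" using span(2)[of "x n" n] x(2) by simp
    moreover have "cspan (y ` {..<n}) \<subseteq> cspan (?R \<union> y ` {..<n})" by (rule complex_vector.span_mono) simp
    ultimately show False using y[of n] by blast
  qed
  obtain u r where u: "\<And>n. norm (u n) = 1" "\<And>n. u n - r n *\<^sub>R x n \<in> cspan (x ` {..<n})"
    "\<And>n g. g \<in> cspan (x ` {..<n}) \<Longrightarrow> 1/2 \<le> norm (u n - g)"
    using Riesz_sequence[OF indep] by blast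
  have near: "\<exists>z\<in>kernel \<mu>. norm z = 1 \<and> norm (u j - z) < 1/8" if j: "j < Suc d" for j
  proof -
    have "u j \<in> cspan (x ` {..<Suc d})" by (rule Riesz_in_span[OF u(2) j])
    then have uD: "u j \<in> D" and By: "B \<mu>' (u j) \<in> ?Y" by (auto dest: span)
    have eq: "B \<mu> (u j) = B \<mu>' (u j) - (\<mu>' - \<mu>) *\<^sub>C u j" by (simp add: scaleC.diff_left)
    then have diff: "norm (B \<mu>' (u j) - B \<mu> (u j)) = cmod (\<mu>' - \<mu>)" by (simp add: norm_scaleC u(1))
    have "\<kappa> * norm (B \<mu>' (u j)) \<le> infdist (B \<mu>' (u j)) ?R" using \<kappa>(2) By by blast
    also have "\<dots> \<le> dist (B \<mu>' (u j)) (B \<mu> (u j))" by (rule infdist_le[OF imageI[OF uD]])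
    finally have "\<kappa> * norm (B \<mu>' (u j)) \<le> cmod (\<mu>' - \<mu>)" unfolding dist_norm diff .
    then have "norm (B \<mu>' (u j)) \<le> cmod (\<mu>' - \<mu>) / \<kappa>" using \<kappa>(1) by (simp add: field_simps)
    moreover have "norm (B \<mu> (u j)) \<le> norm (B \<mu>' (u j)) + cmod (\<mu>' - \<mu>)"
      using norm_triangle_sub[of "B \<mu> (u j)" "B \<mu>' (u j)"] diff by (simp add: norm_minus_commute)
    ultimately have "norm (B \<mu> (u j)) \<le> cmod (\<mu>' - \<mu>) * (1 + 1 / \<kappa>)" by (simp add: algebra_simps)
    also have "\<dots> \<le> \<epsilon> / (1 + 1 / \<kappa>) * (1 + 1 / \<kappa>)"
      using \<mu>'(1) \<kappa>(1) by (intro mult_right_mono) auto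
    also have "\<dots> = \<epsilon>"
    proof -
      have "0 < 1 + 1 / \<kappa>" using \<kappa>(1) by (simp add: add_pos_pos)
      moreover have "\<epsilon> / q * q = \<epsilon>" if "0 < q" for q using that by simp
      ultimately show ?thesis by blast
    qed
    finally show ?thesis using \<epsilon>(2) uD u(1) by blast
  qed
  have "\<forall>j\<in>{..<Suc d}. \<exists>c. c \<in> k \<and> norm (u j - c) < 1/4"
  proof
    fix j assume "j \<in> {..<Suc d}"
    then obtain z where z: "z \<in> kernel \<mu>" "norm z = 1" "norm (u j - z) < 1/8" using near by blast
    then obtain c where c: "c \<in> k" "dist c z < 1/8" using k(2) by auto
    have "norm (u j - c) \<le> norm (u j - z) + dist c z"
      using dist_triangle[of "u j" c z] by (simp add: dist_norm norm_minus_commute)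
    then show "\<exists>c. c \<in> k \<and> norm (u j - c) < 1/4" using c z(3) by (intro exI[of _ c]) auto
  qed
  from bchoice[OF this] obtain c where c: "\<forall>j\<in>{..<Suc d}. c j \<in> k \<and> norm (u j - c j) < 1/4" by blast
  have "\<not> inj_on c {..<Suc d}"
  proof
    assume "inj_on c {..<Suc d}"
    then have "card {..<Suc d} \<le> card k" using c k(1) by (intro card_inj_on_le[of c]) auto
    then show False by (simp add: d_def)
  qed
  then obtain i j where ij: "i < Suc d" "j < Suc d" "i < j" "c i = c j"
    unfolding inj_on_def by (metis lessThan_iff linorder_neqE_nat)
  have "1/2 \<le> norm (u j - u i)" by (rule u(3)[OF Riesz_in_span[OF u(2) ij(3)]])
  also have "\<dots> \<le> norm (u j - c j) + norm (u i - c i)"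
    using dist_triangle[of "u j" "u i" "c j"] ij(4) by (simp add: dist_norm norm_minus_commute)
  also have "\<dots> < 1/4 + 1/4" using c ij(1,2) by (intro add_strict_mono) auto
  finally show False by simp
qed

text \<open>Without separating sequences every vertical line to the right of \<open>a\<close> is admissible in the definition of
the resolvent bound. The half-plane \<open>Re \<mu> \<ge> a\<close> contains only finitely many eigenvalues, so
horizontal rays at almost all heights are free of them, and a resolvent that is not bounded for
large \<open>|b|\<close> would give approximate eigenvectors with frequencies tending to infinity.\<close>

theorem resolvent_bound_le:
  assumes N: "0 \<le> N" and C: "1 \<le> C" "\<And>s x. s \<in> {0..1} \<Longrightarrow> norm (T s x) \<le> C * norm x"
    and nsep: "\<not> separating (1 / (8 * C)) a N"
  shows "resolvent_bound D A \<le> ereal a"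
proof -
  have small: "\<not> separating c a' N" if "a \<le> a'" "1 / (8 * C) \<le> c" for c a'
    using separating_mono[of c a' N "1 / (8 * C)" a] that nsep C(1) by auto
  have C8: "1 / (8 * C) \<le> 1/4" "1 / (8 * C) \<le> 1/2" using C(1) by (auto simp: field_simps)
  have tame: "tame \<mu>" if "a \<le> Re \<mu>" for \<mu>
    by (rule tameI[OF N that small[OF order_refl C8(1)]])
  define P where "P = {\<mu> \<in> point_spectrum D A. a \<le> Re \<mu>}"
  have finP: "finite P"
    using separating_of_infinite_point_spectrum[OF N] small[OF order_refl C8(2)] unfolding P_def by blast
  have below: "bounded_below \<mu>" if "a \<le> Re \<mu>" "Im \<mu> \<notin> Im ` P" for \<mu>
    using bounded_below_of_not_eigenvalue[OF tame[OF that(1)]] that unfolding P_def by blast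
  have surj: "surjective \<mu>" if "a \<le> Re \<mu>" "Im \<mu> \<notin> Im ` P" for \<mu>
    by (rule surjective_of_clear_ray) (rule below, use that in auto)
  have fredholm: "fredholm_on D (B \<mu>)" if \<mu>: "a \<le> Re \<mu>" for \<mu>
  proof -
    have "\<exists>\<mu>'. cmod (\<mu>' - \<mu>) < \<epsilon> \<and> surjective \<mu>'" if e: "0 < \<epsilon>" for \<epsilon>
    proof -
      have "infinite ({Im \<mu><..<Im \<mu> + \<epsilon>} - Im ` P)"
        using finP e by (intro Diff_infinite_finite) auto
      then obtain b where b: "b \<in> {Im \<mu><..<Im \<mu> + \<epsilon>} - Im ` P" using infinite_imp_nonempty by blast
      have "Complex (Re \<mu>) b - \<mu> = \<i> * complex_of_real (b - Im \<mu>)" by (simp add: complex_eq_iff)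
      then have "cmod (Complex (Re \<mu>) b - \<mu>) = \<bar>b - Im \<mu>\<bar>" by (simp add: norm_mult del: of_real_diff)
      moreover have "surjective (Complex (Re \<mu>) b)" by (rule surj) (use b \<mu> in auto)
      ultimately show ?thesis using b by (intro exI[of _ "Complex (Re \<mu>) b"]) auto
    qed
    then show ?thesis
      unfolding fredholm_on_def
      using finite_dim_kernel[OF tame[OF \<mu>]] closed_range[OF tame[OF \<mu>]] finite_codim_range[OF tame[OF \<mu>]]
      by blast
  qed
  have ess: "essential_spectral_bound D A \<le> ereal a"
    unfolding essential_spectral_bound_def
  proof (rule SUP_least)
    fix \<mu> assume "\<mu> \<in> essential_spectrum D A"
    then have "\<not> a \<le> Re \<mu>" using fredholm unfolding essential_spectrum_def by blast
    then show "ereal (Re \<mu>) \<le> ereal a" by simp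
  qed
  obtain b0 where b0: "\<And>\<mu>. \<mu> \<in> P \<Longrightarrow> \<bar>Im \<mu>\<bar> \<le> b0"
    using finite_imp_bounded[OF finite_imageI[OF finP, of Im]] by (auto simp: bounded_iff)
  have "resolvent_bound D A \<le> ereal a'" if a': "a < a'" for a'
  proof -
    have "\<exists>\<gamma>>0. \<exists>b1. \<forall>b. b1 \<le> \<bar>b\<bar> \<longrightarrow> (\<forall>x\<in>D. \<gamma> * norm x \<le> norm (B (Complex a' b) x))"
    proof (rule ccontr)
      assume no: "\<not> ?thesis"
      have "\<exists>p. real n \<le> \<bar>fst p\<bar> \<and> snd p \<in> D \<and> norm (snd p) = 1 \<and>
          norm (B (Complex a' (fst p)) (snd p)) \<le> 1 / real (Suc n)" for n
      proof -
        have "0 < 1 / real (Suc n)" by simp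
        then have "\<not> (\<forall>b. real n \<le> \<bar>b\<bar> \<longrightarrow> (\<forall>x\<in>D. 1 / real (Suc n) * norm x \<le> norm (B (Complex a' b) x)))"
          using no by blast
        then obtain b x where bx: "real n \<le> \<bar>b\<bar>" "x \<in> D" "norm (B (Complex a' b) x) < 1 / real (Suc n) * norm x"
          by (auto simp: not_le)
        then have "x \<noteq> 0" by auto
        have "norm (B (Complex a' b) ((1 / norm x) *\<^sub>R x)) = norm (B (Complex a' b) x) / norm x"
          unfolding B_scaleR[OF bx(2)] by simp
        also have "\<dots> \<le> 1 / real (Suc n)" using bx(3) \<open>x \<noteq> 0\<close> by (simp add: divide_le_eq)
        finally show ?thesis
          using bx \<open>x \<noteq> 0\<close> generator_scaleR(1)[OF bx(2)] by (intro exI[of _ "(b, (1 / norm x) *\<^sub>R x)"]) simp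
      qed
      then have "\<exists>p. \<forall>n. real n \<le> \<bar>fst (p n)\<bar> \<and> snd (p n) \<in> D \<and> norm (snd (p n)) = 1 \<and>
          norm (B (Complex a' (fst (p n))) (snd (p n))) \<le> 1 / real (Suc n)" by (intro choice allI)
      then obtain p where p: "\<And>n. real n \<le> \<bar>fst (p n)\<bar>" "\<And>n. snd (p n) \<in> D" "\<And>n. norm (snd (p n)) = 1"
        "\<And>n. norm (B (Complex a' (fst (p n))) (snd (p n))) \<le> 1 / real (Suc n)" by blast
      have "filterlim (\<lambda>n. cmod (Complex a' (fst (p n)))) at_top sequentially"
      proof (rule filterlim_at_top_mono[OF filterlim_real_sequentially])
        have "real n \<le> cmod (Complex a' (fst (p n)))" for n
          using p(1)[of n] abs_Im_le_cmod[of "Complex a' (fst (p n))"] by simp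
        then show "\<forall>\<^sub>F n in sequentially. real n \<le> cmod (Complex a' (fst (p n)))" by simp
      qed
      then have "separating (1 / (8 * C)) a' N"
        using separating_of_unbounded_frequencies[where x = "\<lambda>n. snd (p n)" and \<mu> = "\<lambda>n. Complex a' (fst (p n))"
            and a = a', OF N C p(2,3) _ _ LIMSEQ_norm_le_inverse[OF p(4)]] by simp
      then show False using small[of a' "1 / (8 * C)"] a' by simp
    qed
    then obtain \<gamma> b1 where \<gamma>: "0 < \<gamma>" "\<And>b x. b1 \<le> \<bar>b\<bar> \<Longrightarrow> x \<in> D \<Longrightarrow> \<gamma> * norm x \<le> norm (B (Complex a' b) x)"
      by blast
    have ev: "\<forall>\<^sub>F b in at_infinity. Complex a' b \<in> resolvent_set D A \<and> onorm (resolvent D A (Complex a' b)) \<le> 1 / \<gamma>"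
      unfolding eventually_at_infinity
    proof (intro exI allI impI)
      fix b :: real assume b: "max b1 (b0 + 1) \<le> norm b"
      have "surjective (Complex a' b)"
      proof (rule surj)
        show "Im (Complex a' b) \<notin> Im ` P" using b b0 by fastforce
      qed (use a' in auto)
      then show "Complex a' b \<in> resolvent_set D A \<and> onorm (resolvent D A (Complex a' b)) \<le> 1 / \<gamma>"
        using resolvent_setI[OF \<gamma>(1), of "Complex a' b"] \<gamma>(2)[of b] b by auto
    qed
    have "Limsup at_infinity (\<lambda>b. ereal (onorm (resolvent D A (Complex a' b)))) \<le> ereal (1 / \<gamma>)"
      by (rule Limsup_bounded) (use ev in \<open>auto elim: eventually_mono\<close>)
    then have "Limsup at_infinity (\<lambda>b. ereal (onorm (resolvent D A (Complex a' b)))) < \<infinity>"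
      by (rule le_less_trans) simp
    moreover have "essential_spectral_bound D A < ereal a'" using ess a' by (simp add: le_less_trans)
    moreover have "finite (point_spectrum D A \<inter> {\<mu>. Re \<mu> = a'})"
      by (rule finite_subset[OF _ finP]) (use a' in \<open>auto simp: P_def\<close>)
    moreover have "\<forall>\<^sub>F b in at_infinity. Complex a' b \<in> resolvent_set D A"
      using ev by (rule eventually_mono) blast
    ultimately show ?thesis unfolding resolvent_bound_def by (intro Inf_lower imageI CollectI conjI)
  qed
  note le = this
  show ?thesis
  proof (rule ccontr)
    assume "\<not> ?thesis"
    then obtain r where r: "ereal a < ereal r" "ereal r < resolvent_bound D A"
      using ereal_dense2[of "ereal a" "resolvent_bound D A"] by (auto simp: not_le)
    then show False using le[of r] by simp
  qed
qed

end

section \<open>Evolution families\<close>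

locale compactly_perturbed = C0_generator T D A
  for T :: "real \<Rightarrow> 'a::complex_banach \<Rightarrow> 'a" and D A +
  fixes K :: "real \<Rightarrow> 'a \<Rightarrow> 'a" and U :: "real \<Rightarrow> real \<Rightarrow> 'a \<Rightarrow> 'a"
  assumes K_compact: "\<And>t. 0 \<le> t \<Longrightarrow> compact_operator (K t)"
    and K_continuous: "\<And>x. continuous_on {0..} (\<lambda>t. K t x)"
    and U_evolution: "evolution_family U"
    and U_eq: "\<And>t \<tau> x. 0 \<le> \<tau> \<Longrightarrow> \<tau> \<le> t \<Longrightarrow>
      U t \<tau> x = T (t - \<tau>) x + integral {\<tau>..t} (\<lambda>s. T (t - s) (K s (U s \<tau> x)))"
begin

lemma U_linear: "0 \<le> \<tau> \<Longrightarrow> \<tau> \<le> t \<Longrightarrow> bounded_linear (U t \<tau>)"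
  using U_evolution by (simp add: evolution_family_def bounded_clinear_def)

lemma U_compose:
  assumes "0 \<le> \<tau>" "\<tau> \<le> s" "s \<le> t"
  shows "U t s (U s \<tau> x) = U t \<tau> x"
proof -
  have "U t s \<circ> U s \<tau> = U t \<tau>" using U_evolution assms unfolding evolution_family_def by blast
  then show ?thesis by (simp add: fun_eq_iff)
qed

lemma U_continuous: assumes "0 \<le> \<tau>" shows "continuous_on {\<tau>..b} (\<lambda>s. U s \<tau> x)"
proof -
  have "continuous_on {(t, \<tau>). 0 \<le> \<tau> \<and> \<tau> \<le> t} (\<lambda>(t, \<tau>). U t \<tau> x)"
    using U_evolution by (simp add: evolution_family_def)
  then have "continuous_on {\<tau>..b} (\<lambda>s. (\<lambda>(t, \<tau>). U t \<tau> x) (s, \<tau>))"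
    by (rule continuous_on_compose2) (use assms in \<open>auto intro!: continuous_intros\<close>)
  then show ?thesis by simp
qed

lemma K_linear: "0 \<le> t \<Longrightarrow> bounded_linear (K t)"
  using K_compact by (simp add: compact_operator_def bounded_clinear_def)

lemma K_continuous_Icc: "0 \<le> a \<Longrightarrow> continuous_on {a..b} (\<lambda>t. K t x)"
  by (rule continuous_on_subset[OF K_continuous]) auto

lemma integrand_continuous:
  assumes \<tau>: "0 \<le> \<tau>"
  shows "continuous_on {\<tau>..t} (\<lambda>s. T (t - s) (K s (U s \<tau> x)))"
proof (rule continuous_on_apply_family[where L = "\<lambda>s. T (t - s)"])
  show "continuous_on {\<tau>..t} (\<lambda>s. T (t - s) x)" for x
    by (rule continuous_on_compose2[OF T_continuous]) (auto intro!: continuous_intros)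
  show "continuous_on {\<tau>..t} (\<lambda>s. K s (U s \<tau> x))"
    by (rule continuous_on_apply_family[where L = K]) (use \<tau> in \<open>auto intro: K_linear K_continuous_Icc U_continuous\<close>)
qed (auto intro: T_linear)

text \<open>On a short interval the integral term contributes at most half of the maximum of the orbit
there. The length \<open>h\<close> depends on \<open>K\<close> on \<open>[0,b]\<close>, but the constant \<open>2C\<close> does not depend on \<open>b\<close>.\<close>

lemma short_time_bound:
  assumes C: "1 \<le> C" "\<And>s x. s \<in> {0..1} \<Longrightarrow> norm (T s x) \<le> C * norm x"
  shows "\<exists>h. 0 < h \<and> h \<le> 1 \<and> (\<forall>\<tau> t x. 0 \<le> \<tau> \<longrightarrow> \<tau> \<le> t \<longrightarrow> t \<le> b \<longrightarrow> t \<le> \<tau> + h \<longrightarrow> norm (U t \<tau> x) \<le> 2 * C * norm x)"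
proof -
  obtain k where k: "1 \<le> k" "\<forall>s\<in>{0..b}. \<forall>x. norm (K s x) \<le> k * norm x"
    using continuous_family_bound[of 0 b K] K_linear K_continuous_Icc by auto
  define h where "h = 1 / (2 * C * k)"
  have "1 * 1 \<le> C * k" using C(1) k(1) by (intro mult_mono) auto
  then have h: "0 < h" "h \<le> 1" "C * k * h = 1/2" by (auto simp: h_def)
  moreover have "norm (U t \<tau> x) \<le> 2 * C * norm x" if t: "0 \<le> \<tau>" "\<tau> \<le> t" "t \<le> b" "t \<le> \<tau> + h" for \<tau> t x
  proof -
    have "continuous_on {\<tau>..t} (\<lambda>s. norm (U s \<tau> x))" using t by (intro continuous_on_norm U_continuous)
    then obtain p where p: "p \<in> {\<tau>..t}" "\<And>s. s \<in> {\<tau>..t} \<Longrightarrow> norm (U s \<tau> x) \<le> norm (U p \<tau> x)"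
      using continuous_attains_sup[of "{\<tau>..t}" "\<lambda>s. norm (U s \<tau> x)"] t by auto
    let ?m = "norm (U p \<tau> x)"
    have "norm (T (p - s) (K s (U s \<tau> x))) \<le> C * (k * ?m)" if s: "s \<in> {\<tau>..p}" for s
    proof -
      have "norm (T (p - s) (K s (U s \<tau> x))) \<le> C * norm (K s (U s \<tau> x))"
        using s p(1) t h(2) by (intro C(2)) auto
      also have "\<dots> \<le> C * (k * norm (U s \<tau> x))" using s p(1) t k(2) C(1) by (intro mult_left_mono) auto
      also have "\<dots> \<le> C * (k * ?m)" using s p C(1) k(1) by (intro mult_left_mono) auto
      finally show ?thesis .
    qed
    then have "norm (integral {\<tau>..p} (\<lambda>s. T (p - s) (K s (U s \<tau> x)))) \<le> C * (k * ?m) * (p - \<tau>)"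
      using p(1) t by (intro integral_bound integrand_continuous) auto
    also have "\<dots> \<le> C * (k * ?m) * h" using p(1) t C(1) k(1) by (intro mult_left_mono) auto
    also have "\<dots> = (C * k * h) * ?m" by simp
    also have "\<dots> = ?m / 2" using h(3) by simp
    finally have I: "norm (integral {\<tau>..p} (\<lambda>s. T (p - s) (K s (U s \<tau> x)))) \<le> ?m / 2" .
    have "?m \<le> norm (T (p - \<tau>) x) + norm (integral {\<tau>..p} (\<lambda>s. T (p - s) (K s (U s \<tau> x))))"
      using U_eq[of \<tau> p x] p(1) t(1) norm_triangle_ineq by simp
    moreover have "norm (T (p - \<tau>) x) \<le> C * norm x" using p(1) t h(2) by (intro C(2)) auto
    ultimately have "?m \<le> 2 * C * norm x" using I by linarith
    then show ?thesis using p(2)[of t] t(2) by simp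
  qed
  ultimately show ?thesis by blast
qed

text \<open>As \<open>U(g,0) = U(g,t) U(t,0)\<close>, a lower bound for an orbit at the next grid point \<open>g\<close> is, up to the
factor \<open>2C\<close>, a lower bound at time \<open>t\<close>. The grid may have to be very fine, but it is finite.\<close>

lemma evolution_grid:
  assumes C: "1 \<le> C" "\<And>s x. s \<in> {0..1} \<Longrightarrow> norm (T s x) \<le> C * norm x"
  shows "\<exists>G. finite G \<and> G \<subseteq> {0..} \<and>
    (\<forall>t. 0 \<le> t \<longrightarrow> t \<le> b \<longrightarrow> (\<exists>g\<in>G. t \<le> g \<and> g \<le> t + 1 \<and> (\<forall>y. norm (U g t y) \<le> 2 * C * norm y)))"
proof -
  obtain h where h: "0 < h" "h \<le> 1"
    "\<And>\<tau> t x. 0 \<le> \<tau> \<Longrightarrow> \<tau> \<le> t \<Longrightarrow> t \<le> b + 1 \<Longrightarrow> t \<le> \<tau> + h \<Longrightarrow> norm (U t \<tau> x) \<le> 2 * C * norm x"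
    using short_time_bound[OF C, of "b + 1"] by blast
  define G where "G = (\<lambda>i. real i * h) ` {..nat \<lceil>b / h\<rceil>}"
  have "\<exists>g\<in>G. t \<le> g \<and> g \<le> t + 1 \<and> (\<forall>y. norm (U g t y) \<le> 2 * C * norm y)" if t: "0 \<le> t" "t \<le> b" for t
  proof -
    define i where "i = nat \<lceil>t / h\<rceil>"
    have "\<lceil>t / h\<rceil> \<le> \<lceil>b / h\<rceil>" using t h(1) by (intro ceiling_mono divide_right_mono) auto
    then have "i \<le> nat \<lceil>b / h\<rceil>" unfolding i_def by (rule nat_mono)
    then have G: "real i * h \<in> G" by (auto simp: G_def)
    have "0 \<le> t / h" using t h(1) by simp
    then have "real i = of_int \<lceil>t / h\<rceil>" unfolding i_def by (simp add: of_nat_nat)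
    then have "t / h \<le> real i" "real i < t / h + 1" by linarith+
    then have i: "t \<le> real i * h" "real i * h \<le> t + h" using h(1) by (simp_all add: field_simps)
    show ?thesis
      using G i t h by (intro bexI[OF _ G] conjI allI h(3)) auto
  qed
  moreover have "finite G" "G \<subseteq> {0..}" using h(1) by (auto simp: G_def)
  ultimately show ?thesis by blast
qed

abbreviation W :: "real \<Rightarrow> 'a \<Rightarrow> 'a" where
  "W t x \<equiv> U t 0 x - T t x"

lemma difference_compact:
  assumes t: "0 \<le> t" and v: "\<And>n::nat. norm (v n) \<le> 1"
  shows "has_convergent_subseq (\<lambda>n. W t (v n))"
proof -
  obtain M where M: "1 \<le> M" "\<forall>s\<in>{0..t}. \<forall>x. norm (U s 0 x) \<le> M * norm x"
    using continuous_family_bound[of 0 t "\<lambda>s. U s 0"] U_linear U_continuous by auto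
  obtain k where k: "1 \<le> k" "\<forall>s\<in>{0..t}. \<forall>x. norm (K s x) \<le> k * norm x"
    using continuous_family_bound[of 0 t K] K_linear K_continuous_Icc by auto
  obtain C where C: "1 \<le> C" "\<forall>s\<in>{0..t}. \<forall>x. norm (T s x) \<le> C * norm x" using T_bound by blast
  have Uv: "norm (U s 0 (v n)) \<le> M" if "s \<in> {0..t}" for s n
  proof -
    have "norm (U s 0 (v n)) \<le> M * norm (v n)" using M(2) that by blast
    also have "\<dots> \<le> M * 1" using v M(1) by (intro mult_left_mono) auto
    finally show ?thesis by simp
  qed
  define g where "g n s = T (t - s) (K s (U s 0 (v n)))" for n s
  have "has_convergent_subseq (\<lambda>n. integral {0..t} (g n))"
  proof (rule integral_of_compact_family)
    show "continuous_on {0..t} (g n)" for n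
      unfolding g_def[abs_def] by (rule integrand_continuous) simp
    show "norm (g n s) \<le> C * (k * M)" if s: "s \<in> {0..t}" for n s
    proof -
      have "norm (g n s) \<le> C * norm (K s (U s 0 (v n)))" unfolding g_def using C(2) s by simp
      also have "\<dots> \<le> C * (k * norm (U s 0 (v n)))" using s k(2) C(1) by (intro mult_left_mono) auto
      also have "\<dots> \<le> C * (k * M)" using Uv[OF s] C(1) k(1) by (intro mult_left_mono) auto
      finally show ?thesis .
    qed
    show "\<exists>S. compact S \<and> range (\<lambda>n. g n s) \<subseteq> S" if s: "s \<in> {0..t}" for s
    proof (intro exI conjI)
      interpret Ks: bounded_linear "K s" by (rule K_linear) (use s in simp)
      interpret Ts: bounded_linear "T (t - s)" by (rule T_linear) (use s in simp)
      let ?S = "(\<lambda>z. T (t - s) (M *\<^sub>R z)) ` closure (K s ` cball 0 1)"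
      have "compact (closure (K s ` cball 0 1))" using K_compact s by (simp add: compact_operator_def)
      then show "compact ?S"
        by (rule compact_continuous_image[rotated])
          (intro Ts.continuous_on continuous_on_scaleR continuous_on_const continuous_on_id)
      show "range (\<lambda>n. g n s) \<subseteq> ?S"
      proof
        fix z assume "z \<in> range (\<lambda>n. g n s)"
        then obtain n where z: "z = g n s" by blast
        have "(1 / M) *\<^sub>R U s 0 (v n) \<in> cball 0 1" using Uv[OF s, of n] M(1) by simp
        then have "K s ((1 / M) *\<^sub>R U s 0 (v n)) \<in> closure (K s ` cball 0 1)"
          by (intro subsetD[OF closure_subset] imageI)
        moreover have "z = T (t - s) (M *\<^sub>R K s ((1 / M) *\<^sub>R U s 0 (v n)))"
          using M(1) by (simp add: z g_def Ks.scaleR)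
        ultimately show "z \<in> ?S" by (intro image_eqI)
      qed
    qed
  qed (rule t)
  moreover have "integral {0..t} (g n) = W t (v n)" for n
    using U_eq[of 0 t "v n"] t by (simp add: g_def[abs_def])
  ultimately show ?thesis by simp
qed

lemma difference_small_subseq:
  fixes v :: "nat \<Rightarrow> 'a"
  assumes "finite G" "G \<subseteq> {0..}" and \<eta>: "\<And>g. 0 < \<eta> g" and v: "\<And>n. norm (v n) \<le> 1"
  shows "\<exists>r :: nat \<Rightarrow> nat. strict_mono r \<and>
    (\<forall>g\<in>G. \<forall>m n. norm (W g (v (r m)) - W g (v (r n))) < \<eta> g)"
  using assms(1,2)
proof (induction G rule: finite_induct)
  case empty
  have "strict_mono (id :: nat \<Rightarrow> nat)" by (simp add: strict_mono_def)
  then show ?case by blast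
next
  case (insert g G)
  then obtain r :: "nat \<Rightarrow> nat" where r: "strict_mono r"
    "\<And>g m n. g \<in> G \<Longrightarrow> norm (W g (v (r m)) - W g (v (r n))) < \<eta> g"
    by auto
  have "has_convergent_subseq (\<lambda>n. W g (v (r n)))"
    using insert.prems by (intro difference_compact v) auto
  then obtain r' :: "nat \<Rightarrow> nat" and l where r': "strict_mono r'"
    "(\<lambda>n. W g (v (r (r' n)))) \<longlonglongrightarrow> l"
    unfolding has_convergent_subseq_def by blast
  have "Cauchy (\<lambda>n. W g (v (r (r' n))))" using r'(2) by (rule LIMSEQ_imp_Cauchy)
  then obtain n0 where n0: "\<forall>m\<ge>n0. \<forall>n\<ge>n0. norm (W g (v (r (r' m))) -
      W g (v (r (r' n)))) < \<eta> g"
    using \<eta>[of g] unfolding Cauchy_iff by blast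
  define q where "q n = r (r' (n + n0))" for n
  have "strict_mono q" using r(1) r'(1) by (simp add: q_def strict_mono_def)
  moreover have "norm (W i (v (q m)) - W i (v (q n))) < \<eta> i"
    if "i \<in> insert g G" for i m n
  proof (cases "i = g")
    case True
    then show ?thesis using n0 by (simp add: q_def)
  next
    case False
    then show ?thesis using that r(2)[of i] by (simp add: q_def)
  qed
  ultimately show ?case by blast
qed

text \<open>The thinned sequence is chosen so that on its differences \<open>U(g,0)\<close> and \<open>T(g)\<close> differ by less than half
of the lower bound for \<open>T(g)\<close>.\<close>

lemma separating_evolution:
  assumes sep: "separating c a N" and c: "0 < c" and G: "finite G" "G \<subseteq> {0..N}"
  shows "\<exists>v::nat \<Rightarrow> 'a. (\<forall>n. norm (v n) \<le> 1) \<and>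
    (\<forall>m. \<forall>\<^sub>F n in sequentially. \<forall>g\<in>G. c / 2 * exp (a * g) \<le> norm (U g 0 (v m - v n)))"
proof -
  obtain v :: "nat \<Rightarrow> 'a" where v: "\<And>n. norm (v n) \<le> 1"
    "\<And>m. \<forall>\<^sub>F n in sequentially. \<forall>t\<in>{0..N}. c * exp (a * t) \<le> norm (T t (v m - v n))"
    using sep unfolding separating_def by blast
  have G0: "G \<subseteq> {0..}" using G(2) by auto
  have \<eta>: "0 < c / 2 * exp (a * g)" for g using c by simp
  obtain r :: "nat \<Rightarrow> nat" where r: "strict_mono r"
    "\<And>g m n. g \<in> G \<Longrightarrow> norm (W g (v (r m)) - W g (v (r n))) < c / 2 * exp (a * g)"
    using difference_small_subseq[where \<eta> = "\<lambda>g. c / 2 * exp (a * g)" and v = v, OF G(1) G0 \<eta> v(1)] by blast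
  have "\<forall>\<^sub>F n in sequentially. \<forall>g\<in>G. c / 2 * exp (a * g) \<le> norm (U g 0 (v (r m) - v (r n)))" for m
  proof -
    have "\<forall>\<^sub>F n in sequentially. \<forall>t\<in>{0..N}. c * exp (a * t) \<le> norm (T t (v (r m) - v (r n)))"
      by (rule eventually_subseq[OF r(1) v(2)])
    then show ?thesis
    proof (rule eventually_mono, intro ballI)
      fix n g assume n: "\<forall>t\<in>{0..N}. c * exp (a * t) \<le> norm (T t (v (r m) - v (r n)))" and g: "g \<in> G"
      have g0: "0 \<le> g" using g G(2) by auto
      interpret Tg: bounded_linear "T g" by (rule T_linear[OF g0])
      interpret Ug: bounded_linear "U g 0" by (rule U_linear) (use g0 in auto)
      let ?W = "W g (v (r m)) - W g (v (r n))"
      have "T g (v (r m) - v (r n)) = U g 0 (v (r m) - v (r n)) - ?W" by (simp add: Tg.diff Ug.diff)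
      then have "norm (T g (v (r m) - v (r n))) \<le> norm (U g 0 (v (r m) - v (r n))) + norm ?W"
        by (metis norm_triangle_ineq4)
      moreover have "c * exp (a * g) \<le> norm (T g (v (r m) - v (r n)))" using n g G(2) by blast
      ultimately show "c / 2 * exp (a * g) \<le> norm (U g 0 (v (r m) - v (r n)))"
        using r(2)[OF g, of m n] by (simp add: field_simps)
    qed
  qed
  then show ?thesis using v(1) by (intro exI[of _ "\<lambda>n. v (r n)"]) auto
qed

text \<open>If the resolvent bound is \<open>\<infinity>\<close>, then \<open>\<sigma>\<close> below is \<open>0\<close>, and the argument remains valid because it
only uses that every real \<open>b < \<sigma>\<close> lies strictly below the resolvent bound.\<close>

theorem dense_lower_bound:
  assumes nbot: "resolvent_bound D A \<noteq> -\<infinity>" and \<delta>: "0 < \<delta>"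
    and a: "(a \<longlongrightarrow> 0) at_top"
  shows "\<exists>x t\<^sub>0. norm (x - u\<^sub>0) < \<delta> \<and> 0 \<le> t\<^sub>0 \<and>
    (\<forall>t\<ge>t\<^sub>0. a t * exp (real_of_ereal (resolvent_bound D A) * t) \<le> norm (U t 0 x))"
proof -
  define \<sigma> where "\<sigma> = real_of_ereal (resolvent_bound D A)"
  obtain C where C: "1 \<le> C" "\<And>s x. s \<in> {0..1} \<Longrightarrow> norm (T s x) \<le> C * norm x" using T_bound by blast
  define c where "c = 1 / (8 * C)"
  have c: "0 < c" using C(1) by (simp add: c_def)
  have sep: "separating c b N" if "b < \<sigma>" "0 \<le> N" for b N
  proof (rule ccontr)
    assume "\<not> separating c b N"
    then have le: "resolvent_bound D A \<le> ereal b"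
      using resolvent_bound_le[OF that(2) C] unfolding c_def by blast
    then show False using nbot that(1) by (cases "resolvent_bound D A") (auto simp: \<sigma>_def)
  qed
  define \<epsilon> where "\<epsilon> k = \<delta> / 8 * (1/2) ^ k" for k :: nat
  have \<epsilon>: "0 < \<epsilon> k" for k using \<delta> by (simp add: \<epsilon>_def)
  have \<epsilon>_sums: "\<epsilon> sums (\<delta> / 8 * (1 / (1 - 1/2)))"
    unfolding \<epsilon>_def by (intro sums_mult geometric_sums) simp
  define c1 where "c1 = c / 2 * exp (- 1)"
  have c1: "0 < c1" using c by (simp add: c1_def)
  define c2 where "c2 = c1 / 4 * exp (- \<bar>\<sigma>\<bar>) / (2 * C)"
  have c2: "0 < c2" using c1 C(1) by (simp add: c2_def)
  have "\<forall>k. \<exists>\<tau>. real k \<le> \<tau> \<and> (\<forall>t\<ge>\<tau>. a t < c2 * \<epsilon> k)"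
  proof
    fix k
    have "0 < c2 * \<epsilon> k" using c2 \<epsilon> by simp
    from order_tendstoD(2)[OF a this] obtain \<tau> where "\<forall>t\<ge>\<tau>. a t < c2 * \<epsilon> k"
      by (auto simp: eventually_at_top_linorder)
    then show "\<exists>\<tau>. real k \<le> \<tau> \<and> (\<forall>t\<ge>\<tau>. a t < c2 * \<epsilon> k)" by (intro exI[of _ "max \<tau> (real k)"]) auto
  qed
  from choice[OF this] obtain \<tau> where \<tau>: "\<And>k. real k \<le> \<tau> k" "\<And>k t. \<tau> k \<le> t \<Longrightarrow> a t < c2 * \<epsilon> k" by blast
  have "\<forall>k. \<exists>G. finite G \<and> G \<subseteq> {0..} \<and> (\<forall>t. 0 \<le> t \<longrightarrow> t \<le> \<tau> (Suc k) \<longrightarrow>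
      (\<exists>g\<in>G. t \<le> g \<and> g \<le> t + 1 \<and> (\<forall>y. norm (U g t y) \<le> 2 * C * norm y)))"
    using evolution_grid[OF C] by blast
  from choice[OF this] obtain G where G: "\<And>k. finite (G k)" "\<And>k. G k \<subseteq> {0..}"
    "\<And>k t. 0 \<le> t \<Longrightarrow> t \<le> \<tau> (Suc k) \<Longrightarrow>
      \<exists>g\<in>G k. t \<le> g \<and> g \<le> t + 1 \<and> (\<forall>y. norm (U g t y) \<le> 2 * C * norm y)" by blast
  have U_sep: "\<exists>v::nat \<Rightarrow> 'a. (\<forall>n. norm (v n) \<le> 1) \<and>
      (\<forall>m. \<forall>\<^sub>F n in sequentially. \<forall>g\<in>G k. c1 * exp (\<sigma> * g) \<le> norm (U g 0 (v m - v n)))" for k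
  proof -
    define N where "N = Max (insert 0 (G k))"
    have N: "0 \<le> N" "\<And>g. g \<in> G k \<Longrightarrow> g \<le> N" using G(1)[of k] by (auto simp: N_def)
    \<comment> \<open>replacing \<open>\<sigma>\<close> by this rate loses at most the factor \<open>e\<^sup>-\<^sup>1\<close> on \<open>[0,N]\<close>, whatever \<open>N\<close> is\<close>
    define b where "b = \<sigma> - 1 / (N + 1)"
    have "b < \<sigma>" using N(1) by (simp add: b_def)
    have "G k \<subseteq> {0..N}" using N(2) G(2)[of k] by auto
    from separating_evolution[OF sep[OF \<open>b < \<sigma>\<close> N(1)] c G(1) this]
    obtain v :: "nat \<Rightarrow> 'a" where v: "\<And>n. norm (v n) \<le> 1"
      "\<And>m. \<forall>\<^sub>F n in sequentially. \<forall>g\<in>G k. c / 2 * exp (b * g) \<le> norm (U g 0 (v m - v n))" by blast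
    have le: "c1 * exp (\<sigma> * g) \<le> c / 2 * exp (b * g)" if g: "g \<in> G k" for g
    proof -
      have "g \<le> N + 1" using N(2)[OF g] by simp
      then have "- 1 + \<sigma> * g \<le> b * g" using N(1) by (simp add: b_def left_diff_distrib divide_le_eq)
      then have "exp (- 1) * exp (\<sigma> * g) \<le> exp (b * g)" by (simp add: exp_add[symmetric])
      then have "c / 2 * (exp (- 1) * exp (\<sigma> * g)) \<le> c / 2 * exp (b * g)" using c by (intro mult_left_mono) auto
      then show ?thesis by (simp add: c1_def mult.assoc)
    qed
    have "\<forall>\<^sub>F n in sequentially. \<forall>g\<in>G k. c1 * exp (\<sigma> * g) \<le> norm (U g 0 (v m - v n))" for m
      using v(2)[of m] by (rule eventually_mono) (meson le order_trans)
    then show ?thesis using v(1) by blast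
  qed
  obtain x where x: "norm (x - u\<^sub>0) \<le> 2 * suminf \<epsilon>"
    "\<And>k g. g \<in> G k \<Longrightarrow> c1 / 4 * \<epsilon> k * exp (\<sigma> * g) \<le> norm (U g 0 x)"
  proof (rule gliding_hump[where L = "\<lambda>g. U g 0" and G = G and w = "\<lambda>g. exp (\<sigma> * g)" and c = c1 and \<epsilon> = \<epsilon>
        and u\<^sub>0 = u\<^sub>0])
    show "bounded_linear (U g 0)" if "g \<in> G k" for k g using G(2)[of k] that by (intro U_linear) auto
    show "summable \<epsilon>" using \<epsilon>_sums by (rule sums_summable)
  qed (use G(1) c1 U_sep \<epsilon> in auto)
  have "2 * suminf \<epsilon> < \<delta>" using sums_unique[OF \<epsilon>_sums] \<delta> by simp
  then have "norm (x - u\<^sub>0) < \<delta>" using x(1) by simp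
  moreover have "a t * exp (\<sigma> * t) \<le> norm (U t 0 x)" if t: "max 0 (\<tau> 0) \<le> t" for t
  proof -
    have t0: "0 \<le> t" using t by simp
    have ex: "t \<le> \<tau> (Suc (nat \<lceil>t\<rceil>))"
      using \<tau>(1)[of "Suc (nat \<lceil>t\<rceil>)"] by linarith
    \<comment> \<open>such \<open>k\<close> exist because \<open>\<tau> k \<ge> k\<close>, and minimality gives \<open>\<tau> k \<le> t\<close>\<close>
    define k where "k = (LEAST k. t \<le> \<tau> (Suc k))"
    have k1: "t \<le> \<tau> (Suc k)" unfolding k_def using ex by (rule LeastI)
    have k2: "\<tau> k \<le> t"
    proof (cases k)
      case 0
      then show ?thesis using t by simp
    next
      case (Suc j)
      then have "\<not> t \<le> \<tau> (Suc j)" using not_less_Least[of j "\<lambda>k. t \<le> \<tau> (Suc k)"] by (simp add: k_def)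
      then show ?thesis using Suc by simp
    qed
    obtain g where g: "g \<in> G k" "t \<le> g" "g \<le> t + 1" "\<And>y. norm (U g t y) \<le> 2 * C * norm y"
      using G(3)[OF t0 k1] by blast
    have "\<sigma> * t - \<bar>\<sigma>\<bar> \<le> \<sigma> * g"
    proof -
      have "\<bar>\<sigma> * (g - t)\<bar> \<le> \<bar>\<sigma>\<bar> * 1"
        unfolding abs_mult using g(2,3) by (intro mult_left_mono) auto
      then show ?thesis by (simp add: algebra_simps abs_le_iff)
    qed
    then have "exp (- \<bar>\<sigma>\<bar>) * exp (\<sigma> * t) \<le> exp (\<sigma> * g)" by (simp add: exp_add[symmetric])
    then have "c1 / 4 * \<epsilon> k * (exp (- \<bar>\<sigma>\<bar>) * exp (\<sigma> * t)) \<le> c1 / 4 * \<epsilon> k * exp (\<sigma> * g)"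
      using c1 \<epsilon>[of k] by (intro mult_left_mono) auto
    also have "\<dots> \<le> norm (U g 0 x)" by (rule x(2)[OF g(1)])
    also have "\<dots> = norm (U g t (U t 0 x))" using U_compose[of 0 t g x] t0 g(2) by simp
    also have "\<dots> \<le> 2 * C * norm (U t 0 x)" by (rule g(4))
    finally have "c2 * \<epsilon> k * exp (\<sigma> * t) \<le> norm (U t 0 x)"
      using C(1) by (simp add: c2_def field_simps)
    moreover have "a t * exp (\<sigma> * t) \<le> c2 * \<epsilon> k * exp (\<sigma> * t)"
      using \<tau>(2)[OF k2] by (intro mult_right_mono) auto
    ultimately show ?thesis by linarith
  qed
  ultimately show ?thesis unfolding \<sigma>_def by (intro exI[of _ x] exI[of _ "max 0 (\<tau> 0)"]) auto
qed

end

section \<open>Lower bounds for a dense set of orbits\<close>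

theorem corollary7p10:
  fixes D :: "'a::complex_banach set"
    and A :: "'a \<Rightarrow> 'a"
    and T K :: "real \<Rightarrow> 'a \<Rightarrow> 'a"
    and U :: "real \<Rightarrow> real \<Rightarrow> 'a \<Rightarrow> 'a"
    and a :: "real \<Rightarrow> real"
  assumes infinite_dim: "\<not> finite_cdim (UNIV :: 'a set)"
    and semigroup: "C0_semigroup T"
    and generator: "is_generator D A T"
    and K_compact: "\<And>t. 0 \<le> t \<Longrightarrow> compact_operator (K t)"
    and K_continuous: "\<And>x. continuous_on {0..} (\<lambda>t. K t x)"
    and U_evolution: "evolution_family U"
    and U_eq: "\<And>t \<tau> x. 0 \<le> \<tau> \<Longrightarrow> \<tau> \<le> t \<Longrightarrow>
      U t \<tau> x = T (t - \<tau>) x + integral {\<tau>..t} (\<lambda>s. T (t - s) (K s (U s \<tau> x)))"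
    and a_nonneg: "\<And>t. 0 \<le> t \<Longrightarrow> 0 \<le> a t"
    and a_decreasing: "antimono_on {0..} a"
    and a_tendsto: "(a \<longlongrightarrow> 0) at_top"
  shows "\<exists>S. closure S = UNIV \<and>
    (\<forall>x\<in>S. \<exists>t\<^sub>0\<ge>0. \<forall>t\<ge>t\<^sub>0. norm (U t 0 x) \<ge> a t * exp_bound (resolvent_bound D A) t)"
proof (cases "resolvent_bound D A = -\<infinity>")
  case True
  then show ?thesis by (intro exI[of _ UNIV]) (auto simp: exp_bound_def)
next
  case False
  interpret compactly_perturbed T D A K U
    by unfold_locales (fact semigroup generator K_compact K_continuous U_evolution U_eq)+
  define S where "S = {x. \<exists>t\<^sub>0\<ge>0. \<forall>t\<ge>t\<^sub>0. norm (U t 0 x) \<ge> a t * exp_bound (resolvent_bound D A) t}"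
  have "u \<in> closure S" for u
    unfolding closure_approachable
  proof (intro allI impI)
    fix \<delta> :: real assume "0 < \<delta>"
    from dense_lower_bound[OF False this a_tendsto, of u]
    obtain x t\<^sub>0 where "norm (x - u) < \<delta>" "0 \<le> t\<^sub>0"
      "\<forall>t\<ge>t\<^sub>0. a t * exp (real_of_ereal (resolvent_bound D A) * t) \<le> norm (U t 0 x)" by blast
    then show "\<exists>x\<in>S. dist x u < \<delta>"
      using False by (intro bexI[of _ x]) (auto simp: S_def exp_bound_def dist_norm)
  qed
  then have "closure S = UNIV" by blast
  then show ?thesis by (intro exI[of _ S]) (simp add: S_def)
qed

end
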